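(* Let $K$ be a field, let $E$ be an arbitrary directed graph, and let $A=\mathcal{L}_K(E)$ be its Leavitt path algebra with the canonical $\mathbb{Z}$-grading. Then: (a) every finitely generated graded right (respectively left) ideal of $A$ is generated by one homogeneous idempotent; (b) every graded right (respectively left) ideal $I$ of $A$ is idempotent, i.e. $I^2=I$; (c) every graded two-sided ideal of $A$ is semiprime; (d) every finitely generated graded right (respectively left) ideal of $A$ is a projective $A$-module; (e) $J(A)=J^{\mathrm{gr}}(A)=0$; (f) if $E^0$ is finite (so that $A$ is unital), then every graded right (respectively left) $A$-module is flat.
   Context: A directed graph $E=(E^0,E^1,r,s)$ consists of two sets $E^0$ (vertices) and $E^1$ (edges), of arbitrary cardinality, and maps $r,s:E^1\to E^0$ (range and source). A vertex $v$ is regular if $s^{-1}(v)$ is finite and non-empty. For a field $K$, the Leavitt path algebra $\mathcal{L}_K(E)$ is the (associative, not necessarily unital) $K$-algebra generated by $\{v\mid v\in E^0\}\cup\{\alpha\mid\alpha\in E^1\}\cup\{\alpha^*\mid\alpha\in E^1\}$ subject to the relations: (1) $v_iv_j=\delta_{ij}v_i$ for all $v_i,v_j\in E^0$; (2) $s(\alpha)\alpha=\alpha r(\alpha)=\alpha$ and $r(\alpha)\alpha^*=\alpha^*s(\alpha)=\alpha^*$ for all $\alpha\in E^1$; (3) $\alpha^*\alpha'=\delta_{\alpha\alpha'}r(\alpha)$ for all $\alpha,\alpha'\in E^1$; (4) $\sum_{\{\alpha\in E^1:\, s(\alpha)=v\}}\alpha\alpha^*=v$ for every regular vertex $v\in E^0$.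 The canonical $\mathbb{Z}$-grading on $\mathcal{L}_K(E)$ is induced by $\deg(v)=0$ for $v\in E^0$, and $\deg(\alpha)=1$, $\deg(\alpha^* )=-1$ for $\alpha\in E^1$. The finite sums of distinct vertices form a set of homogeneous local units of $\mathcal{L}_K(E)$, i.e. a set of commuting homogeneous idempotents (of degree $0$) such that every $x$ in the algebra satisfies $ex=xe=x$ for some $e$ in the set. An ideal (right, left or two-sided) is graded if it is generated, as an additive group, by homogeneous elements. A two-sided ideal $I$ is semiprime if $J^2\subseteq I$ implies $J\subseteq I$ for every two-sided ideal $J$. $J(A)$ denotes the Jacobson radical of $A$, and $J^{\mathrm{gr}}(A)$ the graded Jacobson radical, i.e. the intersection of the annihilators of all graded-simple graded right $A$-modules $M$ (graded modules with $MA\neq 0$ and no graded submodules other than $0$ and $M$). *)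

theory Defs
  imports
    "HOL-Algebra.Algebra"
    "HOL-Library.Poly_Mapping"
    "Graph_Theory.Digraph"
begin

section \<open>Rings without identity, ideals\<close>

text \<open>
  Most library notions for rings presuppose an identity element, so the ones needed for
  rings without identity are introduced here on top of the library's ring records; the field
  \<^const>\<open>one\<close> of such a record carries no meaning unless the record is a \<^locale>\<open>ring\<close>.
\<close>

locale nonunital_ring = abelian_group R for R (structure) +
  assumes m_closed [simp, intro]:
      "\<lbrakk>x \<in> carrier R; y \<in> carrier R\<rbrakk> \<Longrightarrow> x \<otimes> y \<in> carrier R"
    and m_assoc:
      "\<lbrakk>x \<in> carrier R; y \<in> carrier R; z \<in> carrier R\<rbrakk> \<Longrightarrow> (x \<otimes> y) \<otimes> z = x \<otimes> (y \<otimes> z)"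
    and l_distr:
      "\<lbrakk>x \<in> carrier R; y \<in> carrier R; z \<in> carrier R\<rbrakk> \<Longrightarrow> (x \<oplus> y) \<otimes> z = x \<otimes> z \<oplus> y \<otimes> z"
    and r_distr:
      "\<lbrakk>x \<in> carrier R; y \<in> carrier R; z \<in> carrier R\<rbrakk> \<Longrightarrow> z \<otimes> (x \<oplus> y) = z \<otimes> x \<oplus> z \<otimes> y"

definition right_ideal :: "('a, 'r) ring_scheme \<Rightarrow> 'a set \<Rightarrow> bool" where
  "right_ideal R I \<longleftrightarrow> additive_subgroup I R \<and> (\<forall>x\<in>I. \<forall>a\<in>carrier R. x \<otimes>\<^bsub>R\<^esub> a \<in> I)"

definition left_ideal :: "('a, 'r) ring_scheme \<Rightarrow> 'a set \<Rightarrow> bool" where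
  "left_ideal R I \<longleftrightarrow> additive_subgroup I R \<and> (\<forall>x\<in>I. \<forall>a\<in>carrier R. a \<otimes>\<^bsub>R\<^esub> x \<in> I)"

definition two_sided_ideal :: "('a, 'r) ring_scheme \<Rightarrow> 'a set \<Rightarrow> bool" where
  "two_sided_ideal R I \<longleftrightarrow> right_ideal R I \<and> left_ideal R I"

definition right_ideal_gen :: "('a, 'r) ring_scheme \<Rightarrow> 'a set \<Rightarrow> 'a set" where
  "right_ideal_gen R S = \<Inter>{I. right_ideal R I \<and> S \<subseteq> I}"

definition left_ideal_gen :: "('a, 'r) ring_scheme \<Rightarrow> 'a set \<Rightarrow> 'a set" where
  "left_ideal_gen R S = \<Inter>{I. left_ideal R I \<and> S \<subseteq> I}"

definition fg_right_ideal :: "('a, 'r) ring_scheme \<Rightarrow> 'a set \<Rightarrow> bool" where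
  "fg_right_ideal R I \<longleftrightarrow> (\<exists>S. finite S \<and> S \<subseteq> carrier R \<and> I = right_ideal_gen R S)"

definition fg_left_ideal :: "('a, 'r) ring_scheme \<Rightarrow> 'a set \<Rightarrow> bool" where
  "fg_left_ideal R I \<longleftrightarrow> (\<exists>S. finite S \<and> S \<subseteq> carrier R \<and> I = left_ideal_gen R S)"

text \<open>Here \<^term>\<open>ideal_prod R J J\<close> is the additive span of the products of two elements of
  \<open>J\<close>; the ideals \<open>J\<close> are not required to be graded.\<close>

definition semiprime_ideal :: "('a, 'r) ring_scheme \<Rightarrow> 'a set \<Rightarrow> bool" where
  "semiprime_ideal R I \<longleftrightarrow> two_sided_ideal R I \<and>
     (\<forall>J. two_sided_ideal R J \<longrightarrow> ideal_prod R J J \<subseteq> I \<longrightarrow> J \<subseteq> I)"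

lemma nonunital_ring_quotient:
  fixes R (structure)
  assumes "nonunital_ring R" and I: "two_sided_ideal R I"
  shows "nonunital_ring (R Quot I)"
proof -
  interpret nonunital_ring R by fact
  have sub: "additive_subgroup I R"
    and I_r: "\<And>x a. x \<in> I \<Longrightarrow> a \<in> carrier R \<Longrightarrow> x \<otimes> a \<in> I"
    and I_l: "\<And>x a. x \<in> I \<Longrightarrow> a \<in> carrier R \<Longrightarrow> a \<otimes> x \<in> I"
    using I by (auto simp: two_sided_ideal_def right_ideal_def left_ideal_def)
  interpret abelian_subgroup I R
    using sub abelian_group_axioms by (rule abelian_subgroupI3)
  have shift: "I +> (h \<oplus> z) = I +> z" if "h \<in> I" "z \<in> carrier R" for h z
    using that by (metis a_Hcarr a_coset_add_assoc a_rcos_const a_subset)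
  have rep: "I +> (x' \<otimes> y') = I +> (x \<otimes> y)"
    if x: "x \<in> carrier R" and y: "y \<in> carrier R" and x': "x' \<in> I +> x" and y': "y' \<in> I +> y"
    for x y x' y'
  proof -
    obtain h k where h: "h \<in> I" "x' = h \<oplus> x" and k: "k \<in> I" "y' = k \<oplus> y"
      using x' y' by (auto simp: a_r_coset_def r_coset_def)
    have hk: "h \<in> carrier R" "k \<in> carrier R" using h k by auto
    have "x' \<otimes> y' = (h \<otimes> y' \<oplus> x \<otimes> k) \<oplus> x \<otimes> y"
      unfolding h(2) k(2) using hk x y by (simp add: l_distr r_distr a_ac)
    moreover have "h \<otimes> y' \<oplus> x \<otimes> k \<in> I"
      using h k hk x y by (intro a_closed I_r I_l) auto
    ultimately show ?thesis using shift x y by simp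
  qed
  have mult: "rcoset_mult R I (I +> x) (I +> y) = I +> (x \<otimes> y)"
    if "x \<in> carrier R" "y \<in> carrier R" for x y
    using that rep[OF that] a_rcos_self[OF that(1)] a_rcos_self[OF that(2)]
    unfolding rcoset_mult_def by blast
  show ?thesis
  proof (intro nonunital_ring.intro nonunital_ring_axioms.intro)
    show "abelian_group (R Quot I)"
      by (rule comm_group_abelian_groupI)
        (simp add: FactRing_def a_factorgroup_is_comm_group[unfolded A_FactGroup_def'])
  qed (auto simp: FactRing_simps mult a_rcos_sum m_assoc l_distr r_distr)
qed


section \<open>One-sided modules\<close>

text \<open>
  Right and left modules both use the library's module record.  For a right module,
  \<open>a \<odot> x\<close> stands for \<open>x \<cdot> a\<close>, so the two notions differ only in the associativity law.
\<close>

locale right_module = R?: nonunital_ring R + M?: abelian_group M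
  for R :: "('a, 'r) ring_scheme" and M :: "('a, 'm) module" (structure) +
  assumes smult_closed:
      "\<lbrakk>a \<in> carrier R; x \<in> carrier M\<rbrakk> \<Longrightarrow> a \<odot> x \<in> carrier M"
    and smult_l_distr:
      "\<lbrakk>a \<in> carrier R; b \<in> carrier R; x \<in> carrier M\<rbrakk> \<Longrightarrow>
        (a \<oplus>\<^bsub>R\<^esub> b) \<odot> x = a \<odot> x \<oplus> b \<odot> x"
    and smult_r_distr:
      "\<lbrakk>a \<in> carrier R; x \<in> carrier M; y \<in> carrier M\<rbrakk> \<Longrightarrow>
        a \<odot> (x \<oplus> y) = a \<odot> x \<oplus> a \<odot> y"
    and smult_assoc:
      "\<lbrakk>a \<in> carrier R; b \<in> carrier R; x \<in> carrier M\<rbrakk> \<Longrightarrow>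
        (a \<otimes>\<^bsub>R\<^esub> b) \<odot> x = b \<odot> (a \<odot> x)"

locale left_module = R?: nonunital_ring R + M?: abelian_group M
  for R :: "('a, 'r) ring_scheme" and M :: "('a, 'm) module" (structure) +
  assumes smult_closed:
      "\<lbrakk>a \<in> carrier R; x \<in> carrier M\<rbrakk> \<Longrightarrow> a \<odot> x \<in> carrier M"
    and smult_l_distr:
      "\<lbrakk>a \<in> carrier R; b \<in> carrier R; x \<in> carrier M\<rbrakk> \<Longrightarrow>
        (a \<oplus>\<^bsub>R\<^esub> b) \<odot> x = a \<odot> x \<oplus> b \<odot> x"
    and smult_r_distr:
      "\<lbrakk>a \<in> carrier R; x \<in> carrier M; y \<in> carrier M\<rbrakk> \<Longrightarrow>
        a \<odot> (x \<oplus> y) = a \<odot> x \<oplus> a \<odot> y"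
    and smult_assoc:
      "\<lbrakk>a \<in> carrier R; b \<in> carrier R; x \<in> carrier M\<rbrakk> \<Longrightarrow>
        (a \<otimes>\<^bsub>R\<^esub> b) \<odot> x = a \<odot> (b \<odot> x)"

locale unital_right_module = ring R + right_module R M
  for R :: "('a, 'r) ring_scheme" and M :: "('a, 'm) module" (structure) +
  assumes smult_one: "x \<in> carrier M \<Longrightarrow> \<one>\<^bsub>R\<^esub> \<odot> x = x"

locale unital_left_module = ring R + left_module R M
  for R :: "('a, 'r) ring_scheme" and M :: "('a, 'm) module" (structure) +
  assumes smult_one: "x \<in> carrier M \<Longrightarrow> \<one>\<^bsub>R\<^esub> \<odot> x = x"

definition module_hom :: "('a, 'r) ring_scheme \<Rightarrow> ('a, 'm) module \<Rightarrow> ('a, 'n) module \<Rightarrow> ('m \<Rightarrow> 'n) set"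
  where
  "module_hom R M N = {h. h \<in> hom (add_monoid M) (add_monoid N) \<and>
     (\<forall>a\<in>carrier R. \<forall>x\<in>carrier M. h (a \<odot>\<^bsub>M\<^esub> x) = a \<odot>\<^bsub>N\<^esub> h x)}"

definition right_ideal_module :: "('a, 'r) ring_scheme \<Rightarrow> 'a set \<Rightarrow> ('a, 'a) module" where
  "right_ideal_module R I = \<lparr>carrier = I, monoid.mult = monoid.mult R, monoid.one = monoid.one R,
     ring.zero = ring.zero R, ring.add = ring.add R, module.smult = (\<lambda>a x. x \<otimes>\<^bsub>R\<^esub> a)\<rparr>"

definition left_ideal_module :: "('a, 'r) ring_scheme \<Rightarrow> 'a set \<Rightarrow> ('a, 'a) module" where
  "left_ideal_module R I = \<lparr>carrier = I, monoid.mult = monoid.mult R, monoid.one = monoid.one R,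
     ring.zero = ring.zero R, ring.add = ring.add R, module.smult = (\<lambda>a x. a \<otimes>\<^bsub>R\<^esub> x)\<rparr>"


subsection \<open>Projective modules\<close>

text \<open>
  HOL cannot quantify over types inside a formula, so the lifting property is relative to the
  types \<open>'n\<close> and \<open>'l\<close> of the elements of the test modules.  In a theorem that concludes
  projectivity and leaves \<open>'n\<close> and \<open>'l\<close> as type variables, the test modules are arbitrary.
  They need not satisfy \<open>NR = N\<close>.
\<close>

definition projective_right_module ::
    "'n itself \<Rightarrow> 'l itself \<Rightarrow> ('a, 'r) ring_scheme \<Rightarrow> ('a, 'p) module \<Rightarrow> bool" where
  "projective_right_module TN TL R P \<longleftrightarrow> right_module R P \<and>
     (\<forall>(N :: ('a, 'n) module) (L :: ('a, 'l) module) g f.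
        right_module R N \<and> right_module R L \<and>
        g \<in> module_hom R N L \<and> g ` carrier N = carrier L \<and> f \<in> module_hom R P L \<longrightarrow>
        (\<exists>h \<in> module_hom R P N. \<forall>x\<in>carrier P. g (h x) = f x))"

definition projective_left_module ::
    "'n itself \<Rightarrow> 'l itself \<Rightarrow> ('a, 'r) ring_scheme \<Rightarrow> ('a, 'p) module \<Rightarrow> bool" where
  "projective_left_module TN TL R P \<longleftrightarrow> left_module R P \<and>
     (\<forall>(N :: ('a, 'n) module) (L :: ('a, 'l) module) g f.
        left_module R N \<and> left_module R L \<and>
        g \<in> module_hom R N L \<and> g ` carrier N = carrier L \<and> f \<in> module_hom R P L \<longrightarrow>
        (\<exists>h \<in> module_hom R P N. \<forall>x\<in>carrier P. g (h x) = f x))"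


subsection \<open>Tensor products and flat modules\<close>

text \<open>In \<^term>\<open>tensor_product R M N\<close>, \<open>M\<close> is a right and \<open>N\<close> a left module.\<close>

definition tensor_relators ::
    "('a, 'r) ring_scheme \<Rightarrow> ('a, 'm) module \<Rightarrow> ('a, 'n) module \<Rightarrow> ('m \<times> 'n \<Rightarrow>\<^sub>0 int) set" where
  "tensor_relators R M N =
     {frag_of (x \<oplus>\<^bsub>M\<^esub> x', y) - frag_of (x, y) - frag_of (x', y) | x x' y.
        x \<in> carrier M \<and> x' \<in> carrier M \<and> y \<in> carrier N} \<union>
     {frag_of (x, y \<oplus>\<^bsub>N\<^esub> y') - frag_of (x, y) - frag_of (x, y') | x y y'.
        x \<in> carrier M \<and> y \<in> carrier N \<and> y' \<in> carrier N} \<union>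
     {frag_of (a \<odot>\<^bsub>M\<^esub> x, y) - frag_of (x, a \<odot>\<^bsub>N\<^esub> y) | a x y.
        a \<in> carrier R \<and> x \<in> carrier M \<and> y \<in> carrier N}"

definition tensor_kernel ::
    "('a, 'r) ring_scheme \<Rightarrow> ('a, 'm) module \<Rightarrow> ('a, 'n) module \<Rightarrow> ('m \<times> 'n \<Rightarrow>\<^sub>0 int) set" where
  "tensor_kernel R M N =
     generate (free_Abelian_group (carrier M \<times> carrier N)) (tensor_relators R M N)"

definition tensor_product ::
    "('a, 'r) ring_scheme \<Rightarrow> ('a, 'm) module \<Rightarrow> ('a, 'n) module \<Rightarrow> ('m \<times> 'n \<Rightarrow>\<^sub>0 int) set monoid" where
  "tensor_product R M N = free_Abelian_group (carrier M \<times> carrier N) Mod tensor_kernel R M N"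

text \<open>The map \<open>f \<otimes> g\<close> into the tensor product of \<open>M'\<close> and \<open>N'\<close>, on cosets.\<close>

definition tensor_map ::
    "('a, 'r) ring_scheme \<Rightarrow> ('a, 'm') module \<Rightarrow> ('a, 'n') module \<Rightarrow> ('m \<Rightarrow> 'm') \<Rightarrow> ('n \<Rightarrow> 'n') \<Rightarrow>
       ('m \<times> 'n \<Rightarrow>\<^sub>0 int) set \<Rightarrow> ('m' \<times> 'n' \<Rightarrow>\<^sub>0 int) set" where
  "tensor_map R M' N' f g C =
     (\<Union>c\<in>C. tensor_kernel R M' N' #>\<^bsub>free_Abelian_group (carrier M' \<times> carrier N')\<^esub>
              frag_extend (\<lambda>(x, y). frag_of (f x, g y)) c)"

text \<open>As for projectivity, \<open>'p\<close> and \<open>'q\<close> are the types of the elements of the test modules.\<close>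

definition flat_right_module ::
    "'p itself \<Rightarrow> 'q itself \<Rightarrow> ('a, 'r) ring_scheme \<Rightarrow> ('a, 'm) module \<Rightarrow> bool" where
  "flat_right_module TP TQ R M \<longleftrightarrow> unital_right_module R M \<and>
     (\<forall>(P :: ('a, 'p) module) (Q :: ('a, 'q) module) f.
        unital_left_module R P \<and> unital_left_module R Q \<and>
        f \<in> module_hom R P Q \<and> inj_on f (carrier P) \<longrightarrow>
        inj_on (tensor_map R M Q (\<lambda>x. x) f) (carrier (tensor_product R M P)))"

definition flat_left_module ::
    "'p itself \<Rightarrow> 'q itself \<Rightarrow> ('a, 'r) ring_scheme \<Rightarrow> ('a, 'm) module \<Rightarrow> bool" where
  "flat_left_module TP TQ R M \<longleftrightarrow> unital_left_module R M \<and>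
     (\<forall>(P :: ('a, 'p) module) (Q :: ('a, 'q) module) f.
        unital_right_module R P \<and> unital_right_module R Q \<and>
        f \<in> module_hom R P Q \<and> inj_on f (carrier P) \<longrightarrow>
        inj_on (tensor_map R Q M f (\<lambda>x. x)) (carrier (tensor_product R P M)))"


section \<open>Gradings by the integers\<close>

text \<open>A grading is given by its family of homogeneous components.\<close>

definition homogeneous :: "(int \<Rightarrow> 'm set) \<Rightarrow> 'm set" where
  "homogeneous D = (\<Union>n. D n)"

definition graded_subgroup :: "('m, 'r) ring_scheme \<Rightarrow> (int \<Rightarrow> 'm set) \<Rightarrow> 'm set \<Rightarrow> bool" where
  "graded_subgroup M D H \<longleftrightarrow> (\<exists>S \<subseteq> homogeneous D. H = generate (add_monoid M) S)"

definition direct_decomposition :: "('m, 'r) ring_scheme \<Rightarrow> (int \<Rightarrow> 'm set) \<Rightarrow> bool" where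
  "direct_decomposition M D \<longleftrightarrow> (\<forall>n. additive_subgroup (D n) M) \<and>
     (\<forall>x\<in>carrier M. \<exists>!f. (\<forall>n. f n \<in> D n) \<and> finite {n. f n \<noteq> \<zero>\<^bsub>M\<^esub>} \<and>
        x = finsum M f {n. f n \<noteq> \<zero>\<^bsub>M\<^esub>})"

definition graded_right_module ::
    "('a, 'r) ring_scheme \<Rightarrow> (int \<Rightarrow> 'a set) \<Rightarrow> ('a, 'm) module \<Rightarrow> (int \<Rightarrow> 'm set) \<Rightarrow> bool" where
  "graded_right_module R G M D \<longleftrightarrow> right_module R M \<and> direct_decomposition M D \<and>
     (\<forall>i j. \<forall>a\<in>G i. \<forall>x\<in>D j. a \<odot>\<^bsub>M\<^esub> x \<in> D (j + i))"

definition graded_left_module ::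
    "('a, 'r) ring_scheme \<Rightarrow> (int \<Rightarrow> 'a set) \<Rightarrow> ('a, 'm) module \<Rightarrow> (int \<Rightarrow> 'm set) \<Rightarrow> bool" where
  "graded_left_module R G M D \<longleftrightarrow> left_module R M \<and> direct_decomposition M D \<and>
     (\<forall>i j. \<forall>a\<in>G i. \<forall>x\<in>D j. a \<odot>\<^bsub>M\<^esub> x \<in> D (i + j))"


section \<open>The Jacobson radical and the graded Jacobson radical\<close>

definition simple_right_module :: "('a, 'r) ring_scheme \<Rightarrow> ('a, 'm) module \<Rightarrow> bool" where
  "simple_right_module R M \<longleftrightarrow> right_module R M \<and>
     (\<exists>a\<in>carrier R. \<exists>x\<in>carrier M. a \<odot>\<^bsub>M\<^esub> x \<noteq> \<zero>\<^bsub>M\<^esub>) \<and>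
     (\<forall>H. submodule H R M \<longrightarrow> H = {\<zero>\<^bsub>M\<^esub>} \<or> H = carrier M)"

definition graded_simple_right_module ::
    "('a, 'r) ring_scheme \<Rightarrow> (int \<Rightarrow> 'a set) \<Rightarrow> ('a, 'm) module \<Rightarrow> (int \<Rightarrow> 'm set) \<Rightarrow> bool" where
  "graded_simple_right_module R G M D \<longleftrightarrow> graded_right_module R G M D \<and>
     (\<exists>a\<in>carrier R. \<exists>x\<in>carrier M. a \<odot>\<^bsub>M\<^esub> x \<noteq> \<zero>\<^bsub>M\<^esub>) \<and>
     (\<forall>H. submodule H R M \<and> graded_subgroup M D H \<longrightarrow> H = {\<zero>\<^bsub>M\<^esub>} \<or> H = carrier M)"

definition module_annihilator :: "('a, 'r) ring_scheme \<Rightarrow> ('a, 'm) module \<Rightarrow> 'a set" where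
  "module_annihilator R M = {a \<in> carrier R. \<forall>x\<in>carrier M. a \<odot>\<^bsub>M\<^esub> x = \<zero>\<^bsub>M\<^esub>}"

text \<open>
  It suffices to let the modules range over those whose elements are sets of ring elements.  A
  simple right module \<open>M\<close> equals \<open>xR\<close> for some \<open>x\<close>, hence is isomorphic to the quotient of \<open>R\<close>
  by the right annihilator of \<open>x\<close>, and its elements can be taken to be cosets; in the graded
  case \<open>x\<close> can be chosen homogeneous.  Moreover, further modules could only shrink the
  intersection.
\<close>

definition jacobson_radical :: "('a, 'r) ring_scheme \<Rightarrow> 'a set" where
  "jacobson_radical R = carrier R \<inter>
     (\<Inter>{module_annihilator R M | M :: ('a, 'a set) module. simple_right_module R M})"

definition graded_jacobson_radical :: "('a, 'r) ring_scheme \<Rightarrow> (int \<Rightarrow> 'a set) \<Rightarrow> 'a set" where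
  "graded_jacobson_radical R G = carrier R \<inter>
     (\<Inter>{module_annihilator R M | (M :: ('a, 'a set) module) D. graded_simple_right_module R G M D})"


section \<open>Free algebras without identity\<close>

datatype 'g free_word = Word (letters: "'g list")

instantiation free_word :: (type) monoid_add
begin
definition "0 = Word []"
definition "u + w = Word (letters u @ letters w)"
instance by standard (simp_all add: zero_free_word_def plus_free_word_def)
end

text \<open>
  The product of \<^typ>\<open>'g free_word \<Rightarrow>\<^sub>0 'k\<close> is convolution over concatenation of words, so this
  type is the free unital algebra on \<open>'g\<close>.  Admitting only nonempty words over \<open>S\<close> gives the free
  algebra on \<open>S\<close> in the category of not necessarily unital algebras; the field \<^const>\<open>one\<close> is a dummy.
\<close>

definition free_algebra :: "'g set \<Rightarrow> ('k :: field, 'g free_word \<Rightarrow>\<^sub>0 'k) module" where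
  "free_algebra S =
     \<lparr>carrier = {p. \<forall>w \<in> Poly_Mapping.keys p. letters w \<noteq> [] \<and> set (letters w) \<subseteq> S},
      monoid.mult = (*), monoid.one = 0, ring.zero = 0, ring.add = (+),
      module.smult = (\<lambda>c. Poly_Mapping.map ((*) c))\<rparr>"

definition algebra_ideal :: "('k, 'a) module \<Rightarrow> 'a set \<Rightarrow> bool" where
  "algebra_ideal F I \<longleftrightarrow> two_sided_ideal F I \<and> (\<forall>c. \<forall>x\<in>I. c \<odot>\<^bsub>F\<^esub> x \<in> I)"

definition algebra_ideal_gen :: "('k, 'a) module \<Rightarrow> 'a set \<Rightarrow> 'a set" where
  "algebra_ideal_gen F S = \<Inter>{I. algebra_ideal F I \<and> S \<subseteq> I}"

lemma nonunital_ring_free_algebra: "nonunital_ring (free_algebra S :: ('k :: field, _) module)"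
proof (intro nonunital_ring.intro nonunital_ring_axioms.intro abelian_groupI, goal_cases)
  case (1 x y)
  then show ?case
    using keys_add[of x y] by (auto simp: free_algebra_def)
next
  case (6 x)
  then show ?case by (intro bexI[of _ "- x"]) (auto simp: free_algebra_def)
next
  case (7 x y)
  then show ?case
    using keys_mult[of x y] by (fastforce simp: free_algebra_def plus_free_word_def)
qed (auto simp: free_algebra_def algebra_simps)

lemma algebra_ideal_gen:
  assumes "nonunital_ring F" and S: "S \<subseteq> carrier F"
    and smult: "\<And>c x. x \<in> carrier F \<Longrightarrow> c \<odot>\<^bsub>F\<^esub> x \<in> carrier F"
  shows "algebra_ideal F (algebra_ideal_gen F S)"
proof -
  interpret nonunital_ring F by fact
  let ?J = "{I. algebra_ideal F I \<and> S \<subseteq> I}"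
  have add: "subgroup I (add_monoid F)" if "I \<in> ?J" for I
    using that by (simp add: algebra_ideal_def two_sided_ideal_def right_ideal_def additive_subgroup_def)
  have "algebra_ideal F (carrier F)"
    using smult add.subgroup_self
    by (auto simp: algebra_ideal_def two_sided_ideal_def right_ideal_def left_ideal_def
        additive_subgroup_def)
  with S have ne: "?J \<noteq> {}" by blast
  have "additive_subgroup (\<Inter>?J) F"
    unfolding additive_subgroup_def by (rule add.subgroups_Inter[OF _ ne]) (rule add)
  then show ?thesis
    unfolding algebra_ideal_gen_def
    by (auto simp: algebra_ideal_def two_sided_ideal_def right_ideal_def left_ideal_def)
qed


section \<open>Leavitt path algebras\<close>

text \<open>The library's \<^const>\<open>tail\<close> and \<^const>\<open>head\<close> are the source and the range map.\<close>

datatype ('v, 'e) lpa_gen = Vertex 'v | Edge 'e | Ghost 'e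

definition lpa_gens :: "('v, 'e) pre_digraph \<Rightarrow> ('v, 'e) lpa_gen set" where
  "lpa_gens E = Vertex ` verts E \<union> Edge ` arcs E \<union> Ghost ` arcs E"

definition gen_var :: "'g \<Rightarrow> 'g free_word \<Rightarrow>\<^sub>0 'k :: field" where
  "gen_var g = Poly_Mapping.single (Word [g]) 1"

abbreviation vtx :: "'v \<Rightarrow> ('v, 'e) lpa_gen free_word \<Rightarrow>\<^sub>0 'k :: field" where
  "vtx v \<equiv> gen_var (Vertex v)"

abbreviation edg :: "'e \<Rightarrow> ('v, 'e) lpa_gen free_word \<Rightarrow>\<^sub>0 'k :: field" where
  "edg \<alpha> \<equiv> gen_var (Edge \<alpha>)"

abbreviation gho :: "'e \<Rightarrow> ('v, 'e) lpa_gen free_word \<Rightarrow>\<^sub>0 'k :: field" where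
  "gho \<alpha> \<equiv> gen_var (Ghost \<alpha>)"

definition regular_vertex :: "('v, 'e) pre_digraph \<Rightarrow> 'v \<Rightarrow> bool" where
  "regular_vertex E v \<longleftrightarrow> v \<in> verts E \<and> finite (out_arcs E v) \<and> out_arcs E v \<noteq> {}"

definition lpa_relators :: "('v, 'e) pre_digraph \<Rightarrow> (('v, 'e) lpa_gen free_word \<Rightarrow>\<^sub>0 'k :: field) set"
  where
  "lpa_relators E =
     {vtx v * vtx w - (if v = w then vtx v else 0) | v w. v \<in> verts E \<and> w \<in> verts E} \<union>
     {vtx (tail E \<alpha>) * edg \<alpha> - edg \<alpha> | \<alpha>. \<alpha> \<in> arcs E} \<union>
     {edg \<alpha> * vtx (head E \<alpha>) - edg \<alpha> | \<alpha>. \<alpha> \<in> arcs E} \<union>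
     {vtx (head E \<alpha>) * gho \<alpha> - gho \<alpha> | \<alpha>. \<alpha> \<in> arcs E} \<union>
     {gho \<alpha> * vtx (tail E \<alpha>) - gho \<alpha> | \<alpha>. \<alpha> \<in> arcs E} \<union>
     {gho \<alpha> * edg \<beta> - (if \<alpha> = \<beta> then vtx (head E \<alpha>) else 0) | \<alpha> \<beta>. \<alpha> \<in> arcs E \<and> \<beta> \<in> arcs E} \<union>
     {(\<Sum>\<alpha>\<in>out_arcs E v. edg \<alpha> * gho \<alpha>) - vtx v | v. regular_vertex E v}"

definition lpa_ideal :: "('v, 'e) pre_digraph \<Rightarrow> (('v, 'e) lpa_gen free_word \<Rightarrow>\<^sub>0 'k :: field) set" where
  "lpa_ideal E = algebra_ideal_gen (free_algebra (lpa_gens E)) (lpa_relators E)"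

definition lpa_class ::
    "('v, 'e) pre_digraph \<Rightarrow> (('v, 'e) lpa_gen free_word \<Rightarrow>\<^sub>0 'k :: field) \<Rightarrow>
       (('v, 'e) lpa_gen free_word \<Rightarrow>\<^sub>0 'k) set" where
  "lpa_class E p = lpa_ideal E +>\<^bsub>free_algebra (lpa_gens E)\<^esub> p"

text \<open>The field \<^const>\<open>one\<close> is meaningful only if there are finitely many vertices.\<close>

definition leavitt_path_algebra ::
    "('v, 'e) pre_digraph \<Rightarrow> ('k :: field, (('v, 'e) lpa_gen free_word \<Rightarrow>\<^sub>0 'k) set) module" where
  "leavitt_path_algebra E = (let Q = free_algebra (lpa_gens E) Quot lpa_ideal E in
     \<lparr>carrier = carrier Q, monoid.mult = monoid.mult Q, monoid.one = lpa_class E (\<Sum>v\<in>verts E. vtx v),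
      ring.zero = ring.zero Q, ring.add = ring.add Q,
      module.smult = (\<lambda>c C. \<Union>p\<in>C. lpa_class E (c \<odot>\<^bsub>free_algebra (lpa_gens E)\<^esub> p))\<rparr>)"

lemma lpa_relators_subset:
  assumes "wf_digraph E"
  shows "lpa_relators E \<subseteq> carrier (free_algebra (lpa_gens E) :: ('k :: field, _) module)"
proof -
  interpret nonunital_ring "free_algebra (lpa_gens E) :: ('k, _) module"
    by (rule nonunital_ring_free_algebra)
  let ?C = "carrier (free_algebra (lpa_gens E) :: ('k, _) module)"
  have gen: "gen_var g \<in> ?C" if "g \<in> lpa_gens E" for g
    using that by (simp add: gen_var_def free_algebra_def)
  have vtx: "vtx v \<in> ?C" if "v \<in> verts E" for v
    using that by (intro gen) (auto simp: lpa_gens_def)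
  have edg: "edg \<alpha> \<in> ?C" "gho \<alpha> \<in> ?C" if "\<alpha> \<in> arcs E" for \<alpha>
    using that gen[of "Edge \<alpha>"] gen[of "Ghost \<alpha>"] by (simp_all add: lpa_gens_def)
  have mult: "p * q \<in> ?C" if "p \<in> ?C" "q \<in> ?C" for p q
    using m_closed[OF that] by (simp add: free_algebra_def)
  have diff: "p - q \<in> ?C" if "p \<in> ?C" "q \<in> ?C" for p q
    using that keys_diff[of p q] by (auto simp: free_algebra_def)
  have zero: "0 \<in> ?C" by (simp add: free_algebra_def)
  have sum: "sum f V \<in> ?C" if "\<And>v. v \<in> V \<Longrightarrow> f v \<in> ?C" for f and V :: "'b set"
    using that keys_sum[of f V] by (fastforce simp: free_algebra_def)
  show ?thesis
    using wf_digraph.tail_in_verts[OF assms] wf_digraph.head_in_verts[OF assms]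
    unfolding lpa_relators_def regular_vertex_def
    by (auto intro!: vtx edg mult diff zero sum simp: out_arcs_def)
qed

text \<open>In particular, the module locales above are not vacuous for Leavitt path algebras.\<close>

lemma nonunital_ring_leavitt_path_algebra:
  assumes "wf_digraph E"
  shows "nonunital_ring (leavitt_path_algebra E :: ('k :: field, _) module)"
proof -
  let ?F = "free_algebra (lpa_gens E) :: ('k, _) module"
  have "algebra_ideal ?F (lpa_ideal E)"
    unfolding lpa_ideal_def
  proof (rule algebra_ideal_gen[OF nonunital_ring_free_algebra lpa_relators_subset[OF assms]])
    show "c \<odot>\<^bsub>?F\<^esub> x \<in> carrier ?F" if "x \<in> carrier ?F" for c x
      using that by (auto simp: free_algebra_def in_keys_iff map.rep_eq when_def)
  qed
  then have "nonunital_ring (?F Quot lpa_ideal E)"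
    by (intro nonunital_ring_quotient nonunital_ring_free_algebra) (simp add: algebra_ideal_def)
  then interpret Q: nonunital_ring "?F Quot lpa_ideal E" .
  show ?thesis
    by (intro nonunital_ring.intro nonunital_ring_axioms.intro abelian_groupI)
      (auto simp: leavitt_path_algebra_def Let_def Q.a_ac Q.m_assoc Q.l_distr Q.r_distr
        intro!: bexI[of _ "\<ominus>\<^bsub>?F Quot lpa_ideal E\<^esub> _"] Q.l_neg)
qed

fun gen_degree :: "('v, 'e) lpa_gen \<Rightarrow> int" where
  "gen_degree (Vertex v) = 0"
| "gen_degree (Edge \<alpha>) = 1"
| "gen_degree (Ghost \<alpha>) = -1"

definition word_degree :: "('v, 'e) lpa_gen free_word \<Rightarrow> int" where
  "word_degree w = sum_list (map gen_degree (letters w))"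

definition lpa_component ::
    "('v, 'e) pre_digraph \<Rightarrow> int \<Rightarrow> (('v, 'e) lpa_gen free_word \<Rightarrow>\<^sub>0 'k :: field) set set" where
  "lpa_component E n = lpa_class E ` {p \<in> carrier (free_algebra (lpa_gens E)).
     \<forall>w \<in> Poly_Mapping.keys p. word_degree w = n}"

end

theory Submission
  imports Defs
begin

text \<open>
  The proof rests on the fact that a Leavitt path algebra is graded von Neumann regular: every
  homogeneous element \<open>x\<close> of degree \<open>n\<close> has the form \<open>x = xyx\<close> for some \<open>y\<close> of degree \<open>-n\<close>.

  To see this, write \<open>x\<close> as a linear combination of monomials \<open>ab'\<close>, where \<open>a\<close> is a path and \<open>b'\<close> a
  ghost path.  By McCoy's lemma it suffices to make \<open>x - xzx\<close> regular for a suitable \<open>z\<close> of degree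
  \<open>-n\<close>.  Let \<open>a\<close> be a left factor of minimal length in \<open>x\<close> and let \<open>b'\<close> be one of the right factors that
  occur with \<open>a\<close>, with coefficient \<open>k\<close>.  For \<open>z = k\<^sup>-\<^sup>1 b q a'\<close>, where \<open>q = v - \<Sum> ff'\<close> is the common range of
  \<open>a\<close> and \<open>b\<close> minus a sum over finitely many edges that suffices to annihilate the longer monomials,
  the left factor \<open>a\<close> disappears from \<open>x - xzx\<close>, at the price of new monomials with longer left factors;
  the maximal length does not grow, so the process ends.  This is Gaussian elimination; it uses only
  the relations other than the one at regular vertices, and no basis of the algebra (\<open>eliminate_row\<close>, \<open>regular_kspan_Mon\<close>).

  The rest holds in any graded von Neumann regular ring \<open>R\<close>.  Finitely many homogeneous elements
  \<open>n\<^sub>h\<close> are fixed from the right by a homogeneous idempotent \<open>e = \<Sum> y\<^sub>h n\<^sub>h\<close> of the left ideal that they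
  generate (\<open>homogeneous_right_identity\<close>).  This gives (a), and (d) follows because ideals generated by
  an idempotent are projective.  Part (b) is immediate from \<open>x = (xy)x\<close>, and (c) follows by looking
  at the component of largest degree outside the ideal.  A homogeneous idempotent \<open>e\<close> in the graded
  Jacobson radical is zero, as otherwise a maximal graded right ideal that contains all \<open>r - er\<close> but not
  \<open>e\<close> yields a graded-simple module that \<open>e\<close> does not annihilate; since the graded radical is
  generated by such idempotents, it vanishes.  For the Jacobson radical there is an argument with
  an element that has the least number of components (\<open>jacobson_radical_eq_zero\<close>).  For (f), an element
  of a tensor product \<open>M \<otimes> Q\<close> with \<open>M\<close> graded vanishes only because of finitely many homogeneous
  relations \<open>\<Sum> g n\<^sub>g = 0\<close> in \<open>M\<close>, and these can be eliminated one by one by means of the idempotents just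
  mentioned (\<open>rebuild_in_kernel\<close>).

  Statements about the other side follow by passing to the opposite ring, which is again graded
  regular.
\<close>


section \<open>Rings without identity\<close>

context abelian_group
begin

lemma minus_zero_group: "\<ominus> \<zero> = \<zero>"
  by (simp add: a_inv_def)

lemmas abelian_group_simprules
  [algebra abelian_group "ring.zero G" "ring.add G" "a_inv G" "a_minus G"] =
  a_closed zero_closed a_inv_closed minus_closed a_assoc l_zero l_neg a_comm minus_eq
  r_zero r_neg r_neg2 r_neg1 minus_add minus_minus minus_zero_group a_lcomm

lemma add_diff_add:
  "\<lbrakk>a \<in> carrier G; b \<in> carrier G; c \<in> carrier G; d \<in> carrier G\<rbrakk> \<Longrightarrow>
     (a \<oplus> b) \<ominus> (c \<oplus> d) = (a \<ominus> c) \<oplus> (b \<ominus> d)"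
  by algebra

lemma minus_eq_zero_iff: "x \<in> carrier G \<Longrightarrow> y \<in> carrier G \<Longrightarrow> x \<ominus> y = \<zero> \<longleftrightarrow> x = y"
  by (metis a_assoc a_inv_closed l_neg l_zero minus_eq r_neg r_zero)

lemma finsum_minus:
  "finite S \<Longrightarrow> f \<in> S \<rightarrow> carrier G \<Longrightarrow> finsum G (\<lambda>i. \<ominus> f i) S = \<ominus> finsum G f S"
  by (induction S rule: finite_induct) (simp_all add: minus_zero_group minus_add Pi_def)

lemma finsum_in_subgroup:
  assumes "additive_subgroup H G" and "\<And>i. i \<in> S \<Longrightarrow> f i \<in> H"
  shows "finsum G f S \<in> H"
proof -
  interpret additive_subgroup H G by fact
  show ?thesis
  proof (cases "finite S")
    case True
    then show ?thesis using assms(2)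
      by (induction S rule: finite_induct) (auto simp: Pi_def a_Hcarr)
  qed (simp add: finsum_infinite)
qed

lemma finsum_mono_neutral:
  assumes "finite T" "S \<subseteq> T" "f \<in> S \<rightarrow> carrier G" "\<And>i. i \<in> T - S \<Longrightarrow> f i = \<zero>"
  shows "finsum G f S = finsum G f T"
  using assms by (intro add.finprod_mono_neutral_cong_left) auto

lemma finsum_remove:
  assumes "finite S" "i \<in> S" "f \<in> S \<rightarrow> carrier G"
  shows "finsum G f S = f i \<oplus> finsum G f (S - {i})"
proof -
  have "finsum G f (insert i (S - {i})) = f i \<oplus> finsum G f (S - {i})"
    using assms by (intro finsum_insert) auto
  then show ?thesis using assms by (simp add: insert_absorb)
qed

end

context nonunital_ring
begin

lemma l_null [simp]: "x \<in> carrier R \<Longrightarrow> \<zero> \<otimes> x = \<zero>"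
  using l_distr[of \<zero> \<zero> x] by simp

lemma r_null [simp]: "x \<in> carrier R \<Longrightarrow> x \<otimes> \<zero> = \<zero>"
  using r_distr[of \<zero> \<zero> x] by simp

lemma l_minus: "\<lbrakk>x \<in> carrier R; y \<in> carrier R\<rbrakk> \<Longrightarrow> \<ominus> x \<otimes> y = \<ominus> (x \<otimes> y)"
  using l_distr[of "\<ominus> x" x y] by (intro minus_equality[symmetric]) (simp_all add: l_neg)

lemma r_minus: "\<lbrakk>x \<in> carrier R; y \<in> carrier R\<rbrakk> \<Longrightarrow> x \<otimes> \<ominus> y = \<ominus> (x \<otimes> y)"
  using r_distr[of "\<ominus> y" y x] by (intro minus_equality[symmetric]) (simp_all add: l_neg)

lemmas nonunital_ring_simprules
  [algebra nonunital_ring "ring.zero R" "ring.add R" "a_inv R" "a_minus R" "monoid.mult R"] =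
  a_closed zero_closed a_inv_closed minus_closed m_closed a_assoc l_zero l_neg a_comm minus_eq
  r_zero r_neg r_neg2 r_neg1 minus_add minus_minus minus_zero_group a_lcomm
  m_assoc l_distr r_distr l_null r_null l_minus r_minus

lemma finsum_ldistr:
  "\<lbrakk>finite S; a \<in> carrier R; f \<in> S \<rightarrow> carrier R\<rbrakk> \<Longrightarrow>
     finsum R f S \<otimes> a = finsum R (\<lambda>i. f i \<otimes> a) S"
  by (induction S rule: finite_induct) (simp_all add: l_distr Pi_def)

lemma finsum_rdistr:
  "\<lbrakk>finite S; a \<in> carrier R; f \<in> S \<rightarrow> carrier R\<rbrakk> \<Longrightarrow>
     a \<otimes> finsum R f S = finsum R (\<lambda>i. a \<otimes> f i) S"
  by (induction S rule: finite_induct) (simp_all add: r_distr Pi_def)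

end

section \<open>Graded groups\<close>

text \<open>The homogeneous components of an element of a group with a direct decomposition.\<close>

definition hcomp :: "('m, 'r) ring_scheme \<Rightarrow> (int \<Rightarrow> 'm set) \<Rightarrow> 'm \<Rightarrow> int \<Rightarrow> 'm" where
  "hcomp M D x = (THE f. (\<forall>n. f n \<in> D n) \<and> finite {n. f n \<noteq> \<zero>\<^bsub>M\<^esub>} \<and>
     x = finsum M f {n. f n \<noteq> \<zero>\<^bsub>M\<^esub>})"

text \<open>\<open>cp x n\<close> is the component of \<open>x\<close> of degree \<open>n\<close>, and \<open>supp x\<close> is the set of degrees of its nonzero
  components.\<close>

locale graded_group = abelian_group M for M (structure) and D +
  assumes decomposition: "direct_decomposition M D"
begin

abbreviation cp where "cp \<equiv> hcomp M D"
abbreviation supp where "supp x \<equiv> {n. cp x n \<noteq> \<zero>}"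

lemma subgroup_D: "additive_subgroup (D n) M"
  using decomposition by (simp add: direct_decomposition_def)

lemma D_carrier [simp]: "x \<in> D n \<Longrightarrow> x \<in> carrier M"
  using additive_subgroup.a_subset[OF subgroup_D] by blast

lemma D_zero [simp]: "\<zero> \<in> D n"
  by (rule additive_subgroup.zero_closed[OF subgroup_D])

lemma D_add [intro]: "x \<in> D n \<Longrightarrow> y \<in> D n \<Longrightarrow> x \<oplus> y \<in> D n"
  by (rule additive_subgroup.a_closed[OF subgroup_D])

lemma D_inv [intro]: "x \<in> D n \<Longrightarrow> \<ominus> x \<in> D n"
  by (rule additive_subgroup.a_inv_closed[OF subgroup_D])

lemma D_minus [intro]: "x \<in> D n \<Longrightarrow> y \<in> D n \<Longrightarrow> x \<ominus> y \<in> D n"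
  unfolding minus_eq by blast

lemma
  assumes "x \<in> carrier M"
  shows cp_D [simp]: "cp x n \<in> D n"
    and finite_supp [simp]: "finite (supp x)"
    and sum_cp: "x = finsum M (cp x) (supp x)"
    and cp_eqI': "\<lbrakk>\<forall>n. f n \<in> D n; finite {n. f n \<noteq> \<zero>}; x = finsum M f {n. f n \<noteq> \<zero>}\<rbrakk> \<Longrightarrow> cp x = f"
proof -
  have ex1: "\<exists>!f. (\<forall>n. f n \<in> D n) \<and> finite {n. f n \<noteq> \<zero>} \<and> x = finsum M f {n. f n \<noteq> \<zero>}"
    using decomposition assms by (simp add: direct_decomposition_def)
  have "(\<forall>n. cp x n \<in> D n) \<and> finite (supp x) \<and> x = finsum M (cp x) (supp x)"
    unfolding hcomp_def by (rule theI'[OF ex1])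
  then show "cp x n \<in> D n" "finite (supp x)" "x = finsum M (cp x) (supp x)"
    by blast+
  assume "\<forall>n. f n \<in> D n" "finite {n. f n \<noteq> \<zero>}" "x = finsum M f {n. f n \<noteq> \<zero>}"
  then show "cp x = f"
    unfolding hcomp_def by (intro the1_equality[OF ex1]) blast
qed

lemma cp_carrier [simp]: "x \<in> carrier M \<Longrightarrow> cp x n \<in> carrier M"
  using cp_D D_carrier by blast

lemma sum_cp_superset:
  assumes "x \<in> carrier M" "finite S" "supp x \<subseteq> S"
  shows "finsum M (cp x) S = x"
proof -
  have "finsum M (cp x) (supp x) = finsum M (cp x) S"
    using assms by (intro finsum_mono_neutral) auto
  then show ?thesis by (metis sum_cp[OF assms(1)])
qed

lemma cp_eqI:
  assumes f: "\<And>n. f n \<in> D n" and S: "finite S" "\<And>n. n \<notin> S \<Longrightarrow> f n = \<zero>" and x: "x = finsum M f S"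
  shows "cp x = f"
proof (rule cp_eqI')
  have sub: "{n. f n \<noteq> \<zero>} \<subseteq> S" using S(2) by auto
  show "finite {n. f n \<noteq> \<zero>}" using sub S(1) finite_subset by blast
  show "x = finsum M f {n. f n \<noteq> \<zero>}"
    unfolding x by (rule finsum_mono_neutral[symmetric, OF S(1) sub]) (use D_carrier[OF f] S(2) in auto)
  show "x \<in> carrier M" unfolding x using D_carrier[OF f] by (intro finsum_closed) auto
qed (use f in auto)

lemma cp_add:
  assumes "x \<in> carrier M" "y \<in> carrier M"
  shows "cp (x \<oplus> y) n = cp x n \<oplus> cp y n"
proof -
  let ?S = "supp x \<union> supp y"
  have "cp (x \<oplus> y) = (\<lambda>n. cp x n \<oplus> cp y n)"
  proof (rule cp_eqI)
    have "finsum M (\<lambda>n. cp x n \<oplus> cp y n) ?S = finsum M (cp x) ?S \<oplus> finsum M (cp y) ?S"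
      using assms by (intro finsum_addf) auto
    then show "x \<oplus> y = finsum M (\<lambda>n. cp x n \<oplus> cp y n) ?S"
      using assms by (simp add: sum_cp_superset)
  qed (use assms in auto)
  then show ?thesis by simp
qed

lemma cp_homogeneous: "x \<in> D n \<Longrightarrow> cp x m = (if m = n then x else \<zero>)"
  by (rule fun_cong[where x = m], rule cp_eqI[where S = "{n}"]) (auto simp: Pi_def)

lemma cp_zero [simp]: "cp \<zero> n = \<zero>"
  using cp_homogeneous[of \<zero> n n] by simp

lemma cp_inv:
  assumes "x \<in> carrier M" shows "cp (\<ominus> x) n = \<ominus> cp x n"
proof -
  have "cp (\<ominus> x) n \<oplus> cp x n = \<zero>"
    using assms cp_add[of "\<ominus> x" x] by (simp add: l_neg)
  then show ?thesis using assms by (intro minus_equality[symmetric]) auto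
qed

lemma cp_minus:
  "x \<in> carrier M \<Longrightarrow> y \<in> carrier M \<Longrightarrow> cp (x \<ominus> y) n = cp x n \<ominus> cp y n"
  by (simp add: minus_eq cp_add cp_inv)

lemma cp_finsum:
  "\<lbrakk>finite S; f \<in> S \<rightarrow> carrier M\<rbrakk> \<Longrightarrow> cp (finsum M f S) n = finsum M (\<lambda>i. cp (f i) n) S"
  by (induction S rule: finite_induct) (simp_all add: cp_add Pi_def)

lemma eq_zero_if_cp: "x \<in> carrier M \<Longrightarrow> (\<And>n. cp x n = \<zero>) \<Longrightarrow> x = \<zero>"
  using sum_cp_superset[of x "{}"] by simp

lemma finsum_induct:
  assumes "finite S" "\<And>i. i \<in> S \<Longrightarrow> f i \<in> carrier M" "P \<zero>" "\<And>i. i \<in> S \<Longrightarrow> P (f i)"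
    and "\<And>x y. \<lbrakk>x \<in> carrier M; y \<in> carrier M; P x; P y\<rbrakk> \<Longrightarrow> P (x \<oplus> y)"
  shows "P (finsum M f S)"
  using assms(1,2,4)
proof (induction S rule: finite_induct)
  case (insert i S)
  have f: "f \<in> S \<rightarrow> carrier M" using insert.prems(1) by auto
  have "P (f i \<oplus> finsum M f S)"
  proof (rule assms(5))
    show "P (finsum M f S)" using insert.prems by (intro insert.IH) simp_all
  qed (use insert.prems f in \<open>simp_all add: finsum_closed\<close>)
  then show ?case using insert.hyps insert.prems(1)[of i] f by simp
qed (simp only: finsum_empty assms(3))

lemma homogeneous_induct [consumes 1, case_names homogeneous add]:
  assumes x: "x \<in> carrier M" and hom: "\<And>n x. x \<in> D n \<Longrightarrow> P x"
    and add: "\<And>x y. \<lbrakk>x \<in> carrier M; y \<in> carrier M; P x; P y\<rbrakk> \<Longrightarrow> P (x \<oplus> y)"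
  shows "P x"
proof -
  have "P (finsum M (cp x) (supp x))"
  proof (rule finsum_induct)
    show "P \<zero>" by (rule hom[OF D_zero])
    show "P (cp x i)" for i by (rule hom[OF cp_D[OF x]])
    show "P (x \<oplus> y)" if "x \<in> carrier M" "y \<in> carrier M" "P x" "P y" for x y
      using that by (rule add)
  qed (simp_all add: x)
  then show ?thesis by (simp only: sum_cp[OF x, symmetric])
qed

text \<open>A subgroup is graded if and only if it contains the components of its elements.\<close>

lemma graded_subgroup_iff:
  "graded_subgroup M D H \<longleftrightarrow> additive_subgroup H M \<and> (\<forall>x\<in>H. \<forall>n. cp x n \<in> H)"
proof (intro iffI conjI ballI allI)
  assume "graded_subgroup M D H"
  then obtain S where S: "S \<subseteq> homogeneous D" and H: "H = generate (add_monoid M) S"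
    by (auto simp: graded_subgroup_def)
  have S_carrier: "S \<subseteq> carrier M" using S by (auto simp: homogeneous_def)
  show sub: "additive_subgroup H M"
    unfolding H additive_subgroup_def
    using S_carrier by (intro group.generate_is_subgroup[OF a_group]) simp
  interpret H: additive_subgroup H M by (rule sub)
  fix x n assume "x \<in> H"
  then have "x \<in> generate (add_monoid M) S" by (simp add: H)
  moreover have incl: "h \<in> carrier M \<and> cp h n \<in> H" if "h \<in> S" for h
  proof -
    obtain m where m: "h \<in> D m" using S \<open>h \<in> S\<close> by (auto simp: homogeneous_def)
    have "h \<in> H" using \<open>h \<in> S\<close> by (simp add: H generate.incl)
    then show ?thesis using m by (simp add: cp_homogeneous)
  qed
  ultimately have "x \<in> carrier M \<and> cp x n \<in> H"
  proof (induction rule: generate.induct)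
    case (inv h)
    then have "h \<in> carrier M" "\<ominus> cp h n \<in> H" using incl[of h] H.a_inv_closed by blast+
    then show ?case by (simp add: cp_inv flip: a_inv_def)
  qed (simp_all add: cp_add incl)
  then show "cp x n \<in> H" by blast
next
  assume "additive_subgroup H M \<and> (\<forall>x\<in>H. \<forall>n. cp x n \<in> H)"
  then interpret H: additive_subgroup H M + group "add_monoid M" by (auto intro: a_group)
  have cp: "cp x n \<in> H" if "x \<in> H" for x n
    using that \<open>additive_subgroup H M \<and> _\<close> by blast
  let ?S = "H \<inter> homogeneous D"
  have sub: "additive_subgroup (generate (add_monoid M) ?S) M"
    unfolding additive_subgroup_def by (intro add.generate_is_subgroup) (auto simp: H.a_Hcarr)
  have "x \<in> generate (add_monoid M) ?S" if x: "x \<in> H" for x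
  proof -
    have "finsum M (cp x) (supp x) \<in> generate (add_monoid M) ?S"
      using x H.a_Hcarr[OF x] cp[OF x] cp_D
      by (intro finsum_in_subgroup[OF sub] generate.incl) (auto simp: homogeneous_def intro: cp_D[OF H.a_Hcarr[OF x]])
    then show ?thesis by (simp only: sum_cp[OF H.a_Hcarr[OF x], symmetric])
  qed
  moreover have "generate (add_monoid M) ?S \<subseteq> H"
    by (rule add.generate_subgroup_incl[OF _ H.a_subgroup]) simp
  ultimately have "H = generate (add_monoid M) ?S"
    by (intro equalityI subsetI) auto
  then show "graded_subgroup M D H"
    unfolding graded_subgroup_def by (intro exI[of _ ?S] conjI) simp
qed

end


section \<open>Graded von Neumann regular rings\<close>

locale graded_ring = nonunital_ring R + graded_group R G
  for R (structure) and G +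
  assumes G_mult: "\<lbrakk>a \<in> G i; b \<in> G j\<rbrakk> \<Longrightarrow> a \<otimes> b \<in> G (i + j)"
begin

lemma cp_mult_homogeneous_right:
  assumes "x \<in> carrier R" "a \<in> G n"
  shows "cp (x \<otimes> a) k = cp x (k - n) \<otimes> a"
  using assms(1)
proof (induction x rule: homogeneous_induct)
  case (homogeneous m x)
  then show ?case
    using assms(2) G_mult[of x m a n] by (auto simp: cp_homogeneous)
next
  case (add x y)
  then show ?case using assms(2) by (simp add: l_distr cp_add)
qed

lemma cp_mult_homogeneous_left:
  assumes "x \<in> carrier R" "a \<in> G n"
  shows "cp (a \<otimes> x) k = a \<otimes> cp x (k - n)"
  using assms(1)
proof (induction x rule: homogeneous_induct)
  case (homogeneous m x)
  then show ?case
    using assms(2) G_mult[of a n x m] by (auto simp: cp_homogeneous)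
next
  case (add x y)
  then show ?case using assms(2) by (simp add: r_distr cp_add)
qed

lemma cp_mult:
  assumes x: "x \<in> carrier R" and y: "y \<in> carrier R" and S: "finite S" "supp x \<subseteq> S"
  shows "cp (x \<otimes> y) k = finsum R (\<lambda>i. cp x i \<otimes> cp y (k - i)) S"
proof -
  have "x \<otimes> y = finsum R (cp x) S \<otimes> y"
    using x S by (simp add: sum_cp_superset)
  also have "\<dots> = finsum R (\<lambda>i. cp x i \<otimes> y) S"
    using x y S by (intro finsum_ldistr) auto
  finally have "cp (x \<otimes> y) k = finsum R (\<lambda>i. cp (cp x i \<otimes> y) k) S"
    using x y S by (simp add: cp_finsum Pi_def)
  also have "\<dots> = finsum R (\<lambda>i. cp x i \<otimes> cp y (k - i)) S"
    using x y by (intro finsum_cong') (auto simp: cp_mult_homogeneous_left[OF y cp_D[OF x]])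
  finally show ?thesis .
qed

end

locale graded_regular_ring = graded_ring +
  assumes regular: "x \<in> G n \<Longrightarrow> \<exists>y\<in>G (- n). x \<otimes> y \<otimes> x = x"


subsection \<open>The opposite ring\<close>

text \<open>Left ideals and left modules over a ring are right ideals and right modules over its opposite;
  thus every one-sided statement needs a proof for one side only.\<close>

definition opposite_ring :: "('a, 'r) ring_scheme \<Rightarrow> ('a, 'r) ring_scheme" where
  "opposite_ring R = R\<lparr>monoid.mult := \<lambda>x y. y \<otimes>\<^bsub>R\<^esub> x\<rparr>"

lemma opposite_ring_simps [simp]:
  "carrier (opposite_ring R) = carrier R"
  "x \<otimes>\<^bsub>opposite_ring R\<^esub> y = y \<otimes>\<^bsub>R\<^esub> x"
  "ring.zero (opposite_ring R) = ring.zero R"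
  "ring.add (opposite_ring R) = ring.add R"
  "monoid.one (opposite_ring R) = monoid.one R"
  "opposite_ring (opposite_ring R) = R"
  by (simp_all add: opposite_ring_def)

lemma opposite_finsum [simp]: "finsum (opposite_ring R) = finsum R"
  unfolding finsum_def by simp

lemma opposite_additive_subgroup [simp]:
  "additive_subgroup I (opposite_ring R) \<longleftrightarrow> additive_subgroup I R"
  by (simp add: additive_subgroup_def)

lemma opposite_right_ideal [simp]: "right_ideal (opposite_ring R) = left_ideal R"
  by (auto simp: right_ideal_def left_ideal_def fun_eq_iff)

lemma opposite_left_ideal [simp]: "left_ideal (opposite_ring R) = right_ideal R"
  by (auto simp: right_ideal_def left_ideal_def fun_eq_iff)

lemma opposite_left_ideal_gen [simp]: "left_ideal_gen (opposite_ring R) = right_ideal_gen R"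
  by (simp add: right_ideal_gen_def left_ideal_gen_def fun_eq_iff)

lemma opposite_fg_left_ideal [simp]: "fg_left_ideal (opposite_ring R) = fg_right_ideal R"
  by (simp add: fg_right_ideal_def fg_left_ideal_def fun_eq_iff)

lemma opposite_graded_subgroup [simp]: "graded_subgroup (opposite_ring R) = graded_subgroup R"
  by (simp add: graded_subgroup_def fun_eq_iff)

lemma opposite_direct_decomposition [simp]:
  "direct_decomposition (opposite_ring R) G \<longleftrightarrow> direct_decomposition R G"
  by (simp add: direct_decomposition_def)

lemma opposite_abelian_group [simp]: "abelian_group (opposite_ring R) \<longleftrightarrow> abelian_group R"
  by (simp add: abelian_group_def abelian_monoid_def abelian_group_axioms_def)

lemma opposite_nonunital_ring [simp]:
  "nonunital_ring (opposite_ring R) \<longleftrightarrow> nonunital_ring R"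
  by (auto simp: nonunital_ring_def nonunital_ring_axioms_def)

lemma opposite_ring_unital:
  assumes "ring R"
  shows "ring (opposite_ring R)"
proof -
  interpret ring R by fact
  have "monoid (opposite_ring R)" by (rule monoidI) (simp_all add: m_assoc)
  then show ?thesis
    using is_abelian_group by (intro ringI) (simp_all add: l_distr r_distr)
qed

lemma opposite_left_module [simp]: "left_module (opposite_ring R) M \<longleftrightarrow> right_module R M"
  by (auto simp: left_module_def right_module_def left_module_axioms_def right_module_axioms_def)

lemma opposite_right_module [simp]: "right_module (opposite_ring R) M \<longleftrightarrow> left_module R M"
  by (auto simp: left_module_def right_module_def left_module_axioms_def right_module_axioms_def)

lemma opposite_module_hom [simp]: "module_hom (opposite_ring R) = module_hom R"
  by (simp add: module_hom_def fun_eq_iff)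

lemma opposite_projective_left_module [simp]:
  "projective_left_module TN TL (opposite_ring R) P \<longleftrightarrow> projective_right_module TN TL R P"
  by (simp add: projective_left_module_def projective_right_module_def)

lemma opposite_ideal_prod [simp]: "ideal_prod (opposite_ring R) I I = ideal_prod R I I"
proof -
  have "x \<in> ideal_prod R' I I" if "x \<in> ideal_prod (opposite_ring R') I I" for x and R' :: "('a, 'b) ring_scheme"
    using that by (induction rule: ideal_prod.induct) (auto intro: ideal_prod.intros)
  from this[of _ R] this[of _ "opposite_ring R"] show ?thesis by auto
qed

lemma opposite_graded_regular_ring:
  assumes "graded_regular_ring R G"
  shows "graded_regular_ring (opposite_ring R) G"
proof -
  interpret graded_regular_ring R G by fact
  have "b \<otimes>\<^bsub>R\<^esub> a \<in> G (i + j)" if "a \<in> G i" "b \<in> G j" for a b i j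
    using G_mult[OF that(2,1)] by (simp add: add.commute)
  then show ?thesis
    using nonunital_ring_axioms abelian_group_axioms decomposition regular
    by (auto simp: graded_regular_ring_def graded_ring_def graded_group_def m_assoc
        graded_group_axioms_def graded_ring_axioms_def graded_regular_ring_axioms_def)
qed


subsection \<open>Finitely generated graded one-sided ideals\<close>

context nonunital_ring
begin

lemma left_ideal_carrier: "left_ideal R (carrier R)"
  by (simp add: left_ideal_def additive_subgroup_def add.subgroup_self)

lemma left_ideal_gen_superset: "S \<subseteq> left_ideal_gen R S"
  by (auto simp: left_ideal_gen_def)

lemma left_ideal_gen_least: "\<lbrakk>left_ideal R I; S \<subseteq> I\<rbrakk> \<Longrightarrow> left_ideal_gen R S \<subseteq> I"
  by (auto simp: left_ideal_gen_def)

lemma left_ideal_left_ideal_gen: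
  assumes "S \<subseteq> carrier R"
  shows "left_ideal R (left_ideal_gen R S)"
proof -
  let ?J = "{I. left_ideal R I \<and> S \<subseteq> I}"
  have "?J \<noteq> {}" using left_ideal_carrier assms by blast
  then have "additive_subgroup (\<Inter>?J) R"
    unfolding additive_subgroup_def
    by (rule add.subgroups_Inter[rotated])
      (auto simp: left_ideal_def additive_subgroup_def)
  then show ?thesis
    unfolding left_ideal_gen_def left_ideal_def by (auto simp: left_ideal_def)
qed

end

context graded_regular_ring
begin

text \<open>
  The key to everything that concerns finitely many homogeneous elements: the left ideal they
  generate contains a homogeneous idempotent that fixes all of them from the right.
\<close>

lemma homogeneous_right_identity:
  assumes "finite S" "\<And>h. h \<in> S \<Longrightarrow> n h \<in> G (d h)"
  shows "\<exists>e y. e \<in> G 0 \<and> (\<forall>h\<in>S. y h \<in> G (- d h)) \<and> e = finsum R (\<lambda>h. y h \<otimes> n h) S \<and>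
    (\<forall>h\<in>S. n h \<otimes> e = n h)"
  using assms
proof (induction S rule: finite_induct)
  case empty
  then show ?case by (intro exI[of _ \<zero>]) simp
next
  case (insert x S)
  then obtain e y where e: "e \<in> G 0" and y: "\<And>h. h \<in> S \<Longrightarrow> y h \<in> G (- d h)"
    and e_eq: "e = finsum R (\<lambda>h. y h \<otimes> n h) S" and ne: "\<And>h. h \<in> S \<Longrightarrow> n h \<otimes> e = n h"
    by auto
  have n: "n h \<in> G (d h)" if "h \<in> insert x S" for h using insert.prems that by blast
  have C: "e \<in> carrier R" "\<And>h. h \<in> S \<Longrightarrow> y h \<in> carrier R" "n x \<in> carrier R"
    "\<And>h. h \<in> S \<Longrightarrow> n h \<in> carrier R"
    using e y n by (auto intro: D_carrier)
  have ee: "e \<otimes> e = e"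
  proof -
    have "e \<otimes> e = finsum R (\<lambda>h. y h \<otimes> n h \<otimes> e) S"
      by (subst (1) e_eq, subst finsum_ldistr) (use C insert.hyps in \<open>auto simp: Pi_def\<close>)
    also have "\<dots> = finsum R (\<lambda>h. y h \<otimes> n h) S"
      using C ne by (intro finsum_cong') (auto simp: m_assoc)
    finally show ?thesis by (simp only: e_eq)
  qed
  \<comment> \<open>Apply regularity to the part of the new element that \<open>e\<close> does not fix.\<close>
  define m where "m = n x \<ominus> n x \<otimes> e"
  have m: "m \<in> G (d x)"
    using n[of x] e G_mult[of "n x" "d x" e 0] by (auto simp: m_def)
  then obtain r where r: "r \<in> G (- d x)" and mrm: "m \<otimes> r \<otimes> m = m"
    using regular by blast
  have C': "m \<in> carrier R" "r \<in> carrier R" using m r by auto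
  have me: "m \<otimes> e = \<zero>"
  proof -
    have "m \<otimes> e = n x \<otimes> e \<ominus> n x \<otimes> (e \<otimes> e)" unfolding m_def using C by algebra
    then show ?thesis using C by (simp add: ee minus_eq r_neg)
  qed
  define s where "s = r \<ominus> e \<otimes> r"
  have s: "s \<in> G (- d x)"
    using r e G_mult[of e 0 r "- d x"] by (auto simp: s_def)
  define e' where "e' = e \<oplus> s \<otimes> m"
  define y' where "y' h = (if h = x then s else y h \<ominus> s \<otimes> n x \<otimes> y h)" for h
  have Cs: "s \<in> carrier R" using s by auto
  have "e' \<in> G 0"
    using e s m G_mult[of s "- d x" m "d x"] by (auto simp: e'_def)
  moreover have "\<forall>h\<in>insert x S. y' h \<in> G (- d h)"
  proof
    fix h assume "h \<in> insert x S"
    moreover have "s \<otimes> n x \<otimes> y h \<in> G (- d h)" if "h \<in> S"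
      using G_mult[OF G_mult[OF s n[of x]] y[OF that]] by simp
    ultimately show "y' h \<in> G (- d h)" using s y by (auto simp: y'_def)
  qed
  moreover have "e' = finsum R (\<lambda>h. y' h \<otimes> n h) (insert x S)"
  proof -
    have "finsum R (\<lambda>h. y' h \<otimes> n h) S = finsum R (\<lambda>h. y h \<otimes> n h \<oplus> \<ominus> (s \<otimes> n x) \<otimes> (y h \<otimes> n h)) S"
    proof (intro finsum_cong')
      fix h assume h: "h \<in> S"
      then have "h \<noteq> x" using insert.hyps by auto
      then show "y' h \<otimes> n h = y h \<otimes> n h \<oplus> \<ominus> (s \<otimes> n x) \<otimes> (y h \<otimes> n h)"
        unfolding y'_def using C(2,4)[OF h] C(3) Cs by simp algebra
    qed (use C Cs in auto)
    also have "\<dots> = e \<oplus> \<ominus> (s \<otimes> n x) \<otimes> e"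
      unfolding e_eq using C Cs insert.hyps
      by (subst finsum_addf) (auto simp: finsum_rdistr Pi_def)
    finally have eq: "finsum R (\<lambda>h. y' h \<otimes> n h) S = e \<oplus> \<ominus> (s \<otimes> n x) \<otimes> e" .
    have "(\<lambda>h. y' h \<otimes> n h) \<in> S \<rightarrow> carrier R"
      using C Cs by (auto simp: y'_def)
    then have "finsum R (\<lambda>h. y' h \<otimes> n h) (insert x S) = s \<otimes> n x \<oplus> (e \<oplus> \<ominus> (s \<otimes> n x) \<otimes> e)"
    proof -
      have "y' x = s" by (simp add: y'_def)
      with \<open>_ \<in> S \<rightarrow> carrier R\<close> show ?thesis
        using insert.hyps C(3) Cs by (subst finsum_insert) (simp_all add: eq)
    qed
    also have "\<dots> = e'"
      unfolding e'_def m_def using C Cs by algebra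
    finally show ?thesis by simp
  qed
  moreover have "\<forall>h\<in>insert x S. n h \<otimes> e' = n h"
  proof
    fix h assume "h \<in> insert x S"
    moreover have "n h \<otimes> e' = n h" if "h \<in> S"
    proof -
      have "n h \<otimes> e' = n h \<otimes> e \<oplus> (n h \<otimes> r \<ominus> (n h \<otimes> e) \<otimes> r) \<otimes> m"
        unfolding e'_def s_def using C C' that by algebra
      then show ?thesis using C C' that ne by (simp add: minus_eq r_neg)
    qed
    moreover have "n x \<otimes> e' = n x"
    proof -
      have "n x \<otimes> e' = n x \<otimes> e \<oplus> m \<otimes> r \<otimes> m"
        unfolding e'_def s_def using C C' by (simp add: m_def) algebra
      also have "\<dots> = n x \<otimes> e \<oplus> m" by (simp only: mrm)
      also have "\<dots> = n x" unfolding m_def using C by algebra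
      finally show ?thesis .
    qed
    ultimately show "n h \<otimes> e' = n h" by auto
  qed
  ultimately show ?case by blast
qed

lemma finitely_generated_graded_left_ideal:
  assumes I: "left_ideal R I" "graded_subgroup R G I" "fg_left_ideal R I"
  shows "\<exists>e\<in>G 0. e \<otimes> e = e \<and> e \<in> I \<and> I = left_ideal_gen R {e} \<and> (\<forall>x\<in>I. x \<otimes> e = x)"
proof -
  obtain S where S: "finite S" "S \<subseteq> carrier R" and I_gen: "I = left_ideal_gen R S"
    using I(3) by (auto simp: fg_left_ideal_def)
  interpret I: additive_subgroup I R using I(1) by (simp add: left_ideal_def)
  have I_mult: "a \<otimes> x \<in> I" if "a \<in> carrier R" "x \<in> I" for a x
    using I(1) that by (simp add: left_ideal_def)
  have S_I: "S \<subseteq> I" unfolding I_gen by (rule left_ideal_gen_superset)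
  define T where "T = (SIGMA x:S. supp x)"
  have T: "finite T" unfolding T_def using S by (intro finite_SigmaI) auto
  have T_I: "cp x n \<in> I" if "(x, n) \<in> T" for x n
    using that S_I I(2) by (auto simp: T_def graded_subgroup_iff)
  have "\<exists>e y. e \<in> G 0 \<and> (\<forall>h\<in>T. y h \<in> G (- snd h)) \<and>
     e = finsum R (\<lambda>h. y h \<otimes> cp (fst h) (snd h)) T \<and> (\<forall>h\<in>T. cp (fst h) (snd h) \<otimes> e = cp (fst h) (snd h))"
    using S by (intro homogeneous_right_identity[OF T]) (auto simp: T_def subset_iff)
  then obtain e y where e: "e \<in> G 0" and y: "\<And>h. h \<in> T \<Longrightarrow> y h \<in> G (- snd h)"
    and e_eq: "e = finsum R (\<lambda>h. y h \<otimes> cp (fst h) (snd h)) T"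
    and fixed: "\<And>h. h \<in> T \<Longrightarrow> cp (fst h) (snd h) \<otimes> e = cp (fst h) (snd h)"
    by auto
  have eC: "e \<in> carrier R" using e by auto
  have eI: "e \<in> I"
    unfolding e_eq
    using y by (intro finsum_in_subgroup[OF I.additive_subgroup_axioms] I_mult T_I) (auto intro: D_carrier)
  \<comment> \<open>The elements fixed by \<open>e\<close> form a left ideal that contains the generators.\<close>
  let ?F = "{x \<in> carrier R. x \<otimes> e = x}"
  have F: "left_ideal R ?F"
    using eC by (auto simp: left_ideal_def additive_subgroup_def m_assoc l_distr l_minus
        a_inv_def[symmetric] intro!: add.subgroupI)
  have "S \<subseteq> ?F"
  proof
    fix x assume x: "x \<in> S"
    then have xC: "x \<in> carrier R" using S by blast
    have "x \<otimes> e = finsum R (cp x) (supp x) \<otimes> e" using xC by (simp add: sum_cp_superset)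
    also have "\<dots> = finsum R (\<lambda>n. cp x n \<otimes> e) (supp x)"
      using xC eC by (intro finsum_ldistr) auto
    also have "\<dots> = finsum R (cp x) (supp x)"
      using xC fixed[of "(x, _)"] x by (intro finsum_cong') (auto simp: T_def)
    finally show "x \<in> ?F" using xC by (simp add: sum_cp_superset)
  qed
  then have I_F: "I \<subseteq> ?F" unfolding I_gen by (rule left_ideal_gen_least[OF F])
  moreover have "left_ideal_gen R {e} \<subseteq> I"
    using eI by (intro left_ideal_gen_least I(1)) simp
  moreover have "I \<subseteq> left_ideal_gen R {e}"
  proof
    fix x assume "x \<in> I"
    then have "x = x \<otimes> e" "x \<in> carrier R" using I_F by auto
    moreover have "x \<otimes> e \<in> left_ideal_gen R {e}"
      using left_ideal_left_ideal_gen[of "{e}"] left_ideal_gen_superset[of "{e}"] eC \<open>x \<in> carrier R\<close>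
      by (auto simp: left_ideal_def)
    ultimately show "x \<in> left_ideal_gen R {e}" by simp
  qed
  ultimately show ?thesis using e eI by blast
qed

end

text \<open>
  A homomorphism \<open>f\<close> on a left ideal generated by an idempotent \<open>e\<close> lifts along \<open>g\<close> to \<open>x \<mapsto> xn\<close>, where
  \<open>g(n) = f(e)\<close>.
\<close>

lemma projective_left_ideal:
  fixes R (structure) and P :: "('a, 'a) module"
  assumes R: "nonunital_ring R" and I: "left_ideal R I"
    and e: "e \<in> I" "\<And>x. x \<in> I \<Longrightarrow> x \<otimes> e = x"
    and P: "carrier P = I" "ring.add P = ring.add R" "ring.zero P = ring.zero R"
      "module.smult P = monoid.mult R"
  shows "projective_left_module TN TL R P"
proof -
  interpret nonunital_ring R by fact
  interpret I: additive_subgroup I R using I by (simp add: left_ideal_def)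
  have I_mult: "a \<otimes> x \<in> I" if "a \<in> carrier R" "x \<in> I" for a x
    using I that by (simp add: left_ideal_def)
  have "abelian_group P"
    by (rule abelian_groupI)
      (auto simp: P I.a_Hcarr a_ac intro!: bexI[of _ "\<ominus> _"] l_neg r_neg)
  then have mod: "left_module R P"
    using I_mult nonunital_ring_axioms
    by (auto simp: left_module_def left_module_axioms_def P l_distr r_distr m_assoc I.a_Hcarr)
  show ?thesis
    unfolding projective_left_module_def
  proof (intro conjI allI impI mod)
    fix N :: "('a, 'n) module" and L :: "('a, 'l) module" and g f
    assume *: "left_module R N \<and> left_module R L \<and> g \<in> module_hom R N L \<and>
        g ` carrier N = carrier L \<and> f \<in> module_hom R P L"
    then interpret N: left_module R N by blast
    have f: "f \<in> hom (add_monoid P) (add_monoid L)"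
      "\<And>a x. a \<in> carrier R \<Longrightarrow> x \<in> I \<Longrightarrow> f (a \<otimes> x) = a \<odot>\<^bsub>L\<^esub> f x"
      and g: "\<And>a x. a \<in> carrier R \<Longrightarrow> x \<in> carrier N \<Longrightarrow> g (a \<odot>\<^bsub>N\<^esub> x) = a \<odot>\<^bsub>L\<^esub> g x"
      using * by (auto simp: module_hom_def P)
    have "f e \<in> carrier L" using f(1) e(1) by (auto simp: hom_def P)
    then have "f e \<in> g ` carrier N" using * by simp
    then obtain n where n: "n \<in> carrier N" "g n = f e" by force
    have "(\<lambda>x. x \<odot>\<^bsub>N\<^esub> n) \<in> module_hom R P N"
      using n I_mult by (auto simp: module_hom_def hom_def P N.smult_closed N.smult_l_distr
          N.smult_assoc I.a_Hcarr)
    moreover have "g (x \<odot>\<^bsub>N\<^esub> n) = f x" if "x \<in> I" for x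
      using that g[of x n] n f(2)[of x e] e by (simp add: I.a_Hcarr)
    ultimately show "\<exists>h\<in>module_hom R P N. \<forall>x\<in>carrier P. g (h x) = f x"
      by (intro bexI[of _ "\<lambda>x. x \<odot>\<^bsub>N\<^esub> n"]) (auto simp: P)
  qed
qed

context graded_regular_ring
begin

subsection \<open>Graded ideals are idempotent and semiprime\<close>

lemma graded_left_ideal_idempotent:
  assumes I: "left_ideal R I" "graded_subgroup R G I"
  shows "ideal_prod R I I = I"
proof
  interpret I: additive_subgroup I R using I(1) by (simp add: left_ideal_def)
  have I_mult: "a \<otimes> x \<in> I" if "a \<in> carrier R" "x \<in> I" for a x
    using I(1) that by (simp add: left_ideal_def)
  show "ideal_prod R I I \<subseteq> I"
  proof
    fix x assume "x \<in> ideal_prod R I I"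
    then show "x \<in> I" by (induction rule: ideal_prod.induct) (auto simp: I_mult I.a_Hcarr)
  qed
  have zero: "\<zero> \<in> ideal_prod R I I"
    using ideal_prod.prod[OF I.zero_closed I.zero_closed, of R] by simp
  show "I \<subseteq> ideal_prod R I I"
  proof
    fix x assume x: "x \<in> I"
    then have xC: "x \<in> carrier R" by (simp add: I.a_Hcarr)
    have cp: "cp x n \<in> ideal_prod R I I" for n
    proof -
      have n: "cp x n \<in> I" "cp x n \<in> G n" using I(2) x xC by (auto simp: graded_subgroup_iff)
      obtain y where y: "y \<in> G (- n)" "cp x n \<otimes> y \<otimes> cp x n = cp x n"
        using regular[OF n(2)] by blast
      have "cp x n \<otimes> (y \<otimes> cp x n) \<in> ideal_prod R I I"
        using y n by (intro ideal_prod.prod I_mult) auto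
      then show ?thesis using y xC by (simp add: m_assoc D_carrier[OF y(1)])
    qed
    have "finsum R (cp x) (supp x) \<in> ideal_prod R I I"
      by (rule finsum_induct[where P = "\<lambda>z. z \<in> ideal_prod R I I"])
        (simp_all add: xC cp zero ideal_prod.sum)
    then show "x \<in> ideal_prod R I I" using xC by (simp add: sum_cp_superset)
  qed
qed

lemma graded_ideal_semiprime:
  assumes I: "two_sided_ideal R I" "graded_subgroup R G I"
  shows "semiprime_ideal R I"
  unfolding semiprime_ideal_def
proof (intro conjI allI impI I subsetI)
  fix J x assume J: "two_sided_ideal R J" "ideal_prod R J J \<subseteq> I" and x: "x \<in> J"
  interpret I: additive_subgroup I R using I(1) by (simp add: two_sided_ideal_def left_ideal_def)
  interpret J: additive_subgroup J R using J(1) by (simp add: two_sided_ideal_def left_ideal_def)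
  have I_mult: "a \<otimes> z \<in> I" "z \<otimes> a \<in> I" if "a \<in> carrier R" "z \<in> I" for a z
    using I(1) that by (simp_all add: two_sided_ideal_def left_ideal_def right_ideal_def)
  have xC: "x \<in> carrier R" using x by (simp add: J.a_Hcarr)
  show "x \<in> I"
  proof (rule ccontr)
    assume "x \<notin> I"
    \<comment> \<open>Look at the component of largest degree that is not in \<open>I\<close>.\<close>
    let ?B = "{n. cp x n \<notin> I}"
    have "?B \<subseteq> supp x" by auto
    then have fin: "finite ?B" by (rule finite_subset[OF _ finite_supp[OF xC]])
    have "?B \<noteq> {}"
    proof
      assume "?B = {}"
      then have "finsum R (cp x) (supp x) \<in> I"
        by (intro finsum_in_subgroup[OF I.additive_subgroup_axioms]) auto
      then show False using xC \<open>x \<notin> I\<close> by (simp add: sum_cp_superset)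
    qed
    define n where "n = Max ?B"
    have n: "cp x n \<notin> I" using Max_in[OF fin \<open>?B \<noteq> {}\<close>] by (simp add: n_def)
    have above: "cp x k \<in> I" if "k > n" for k
      using that Max_ge[OF fin, of k] by (force simp: n_def)
    obtain y where y: "y \<in> G (- n)" "cp x n \<otimes> y \<otimes> cp x n = cp x n"
      using regular[OF cp_D[OF xC]] by blast
    have yC: "y \<in> carrier R" using y by auto
    have "(x \<otimes> y) \<otimes> x \<in> I"
      using J x yC by (intro subsetD[OF J(2)] ideal_prod.prod)
        (auto simp: two_sided_ideal_def right_ideal_def)
    then have xyx: "cp (x \<otimes> y \<otimes> x) n \<in> I" using I(2) by (auto simp: graded_subgroup_iff)
    let ?S = "insert 0 ((\<lambda>k. k - n) ` supp x)"
    let ?f = "\<lambda>i. cp x (i + n) \<otimes> y \<otimes> cp x (n - i)"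
    have cpxy: "cp (x \<otimes> y) i = cp x (i + n) \<otimes> y" for i
      using cp_mult_homogeneous_right[OF xC y(1)] by simp
    have S: "finite ?S" "supp (x \<otimes> y) \<subseteq> ?S"
      using xC yC by (auto simp: cpxy image_iff) (metis add_diff_cancel_right' l_null)
    have "cp (x \<otimes> y \<otimes> x) n = finsum R ?f ?S"
      using cp_mult[OF _ xC S, of n] xC yC by (simp add: cpxy)
    also have "\<dots> = ?f 0 \<oplus> finsum R ?f (?S - {0})"
      using S(1) xC yC by (intro finsum_remove) auto
    finally have eq: "cp (x \<otimes> y \<otimes> x) n = cp x n \<oplus> finsum R ?f (?S - {0})"
      using y by simp
    have rest: "finsum R ?f (?S - {0}) \<in> I"
    proof (intro finsum_in_subgroup[OF I.additive_subgroup_axioms])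
      fix i assume "i \<in> ?S - {0}"
      then have "i > 0 \<or> - i > 0" by auto
      then show "?f i \<in> I"
      proof
        assume "i > 0"
        then have "cp x (i + n) \<in> I" by (intro above) simp
        then show ?thesis using xC yC by (intro I_mult) simp_all
      next
        assume "- i > 0"
        then have "cp x (n - i) \<in> I" by (intro above) simp
        then show ?thesis using xC yC by (intro I_mult(1)) simp_all
      qed
    qed
    have "cp x n = cp (x \<otimes> y \<otimes> x) n \<ominus> finsum R ?f (?S - {0})"
      unfolding eq using I.a_Hcarr[OF rest] xC by (simp add: minus_eq a_assoc r_neg)
    also have "\<dots> \<in> I"
      unfolding minus_eq by (intro I.a_closed I.a_inv_closed xyx rest)
    finally have "cp x n \<in> I" .
    then show False using n by simp
  qed
qed

end


section \<open>The two Jacobson radicals\<close>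

text \<open>The quotient of the right module \<open>R\<close> by a right ideal.\<close>

definition quotient_right_module :: "('a, 'r) ring_scheme \<Rightarrow> 'a set \<Rightarrow> ('a, 'a set) module" where
  "quotient_right_module R N = \<lparr>carrier = a_rcosets\<^bsub>R\<^esub> N, monoid.mult = set_add R, monoid.one = N,
     ring.zero = N, ring.add = set_add R, module.smult = (\<lambda>a C. \<Union>x\<in>C. N +>\<^bsub>R\<^esub> (x \<otimes>\<^bsub>R\<^esub> a))\<rparr>"

locale right_ideal_quotient = nonunital_ring R for R (structure) +
  fixes N
  assumes right_ideal_N: "right_ideal R N"
begin

abbreviation M where "M \<equiv> quotient_right_module R N"
abbreviation cls where "cls x \<equiv> N +> x"

sublocale N: abelian_subgroup N R
  using right_ideal_N abelian_group_axioms
  by (intro abelian_subgroupI3) (auto simp: right_ideal_def)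

lemma N_mult: "x \<in> N \<Longrightarrow> a \<in> carrier R \<Longrightarrow> x \<otimes> a \<in> N"
  using right_ideal_N by (simp add: right_ideal_def)

lemma carrier_M: "carrier M = cls ` carrier R"
  by (auto simp: quotient_right_module_def A_RCOSETS_def RCOSETS_def a_r_coset_def)

lemma zero_M [simp]: "\<zero>\<^bsub>M\<^esub> = N"
  by (simp add: quotient_right_module_def)

lemma add_M [simp]: "x \<in> carrier R \<Longrightarrow> y \<in> carrier R \<Longrightarrow> cls x \<oplus>\<^bsub>M\<^esub> cls y = cls (x \<oplus> y)"
  by (simp add: quotient_right_module_def N.a_rcos_sum)

lemma cls_eq_iff: "x \<in> carrier R \<Longrightarrow> y \<in> carrier R \<Longrightarrow> cls x = cls y \<longleftrightarrow> x \<ominus> y \<in> N"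
  by (metis N.a_rcos_self N.a_repr_independence' N.a_rcos_module minus_eq)

lemma cls_zero [simp]: "cls \<zero> = N"
  using N.a_rcos_const N.zero_closed by blast

lemma cls_eq_N_iff: "x \<in> carrier R \<Longrightarrow> cls x = N \<longleftrightarrow> x \<in> N"
  using N.a_rcos_self N.a_rcos_const by blast

lemma smult_M [simp]:
  assumes "x \<in> carrier R" "a \<in> carrier R"
  shows "a \<odot>\<^bsub>M\<^esub> cls x = cls (x \<otimes> a)"
proof -
  have const: "cls (y \<otimes> a) = cls (x \<otimes> a)" if y: "y \<in> cls x" for y
  proof -
    obtain h where h: "h \<in> N" "y = h \<oplus> x" using y by (auto simp: a_r_coset_def r_coset_def)
    have hC: "h \<in> carrier R" using h by (simp add: N.a_Hcarr)
    have "y \<otimes> a \<ominus> x \<otimes> a = h \<otimes> a" unfolding h(2) using hC assms by algebra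
    then show ?thesis
      using h hC assms by (subst cls_eq_iff) (auto simp: N_mult)
  qed
  have "a \<odot>\<^bsub>M\<^esub> cls x = (\<Union>y\<in>cls x. cls (y \<otimes> a))"
    by (simp add: quotient_right_module_def)
  also have "\<dots> = (\<Union>y\<in>cls x. cls (x \<otimes> a))"
    by (rule SUP_cong[OF refl]) (rule const)
  also have "\<dots> = cls (x \<otimes> a)"
    using N.a_rcos_self[OF assms(1)] by blast
  finally show ?thesis .
qed

lemma abelian_group_M: "abelian_group M"
proof (rule abelian_groupI)
  show "\<exists>y\<in>carrier M. y \<oplus>\<^bsub>M\<^esub> x = \<zero>\<^bsub>M\<^esub>" if x: "x \<in> carrier M" for x
  proof -
    obtain r where r: "r \<in> carrier R" "x = cls r" using x by (auto simp: carrier_M)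
    then show ?thesis
      by (intro bexI[of _ "cls (\<ominus> r)"]) (auto simp: carrier_M l_neg cls_eq_N_iff)
  qed
  show "\<zero>\<^bsub>M\<^esub> \<oplus>\<^bsub>M\<^esub> x = x" if x: "x \<in> carrier M" for x
  proof -
    obtain r where r: "r \<in> carrier R" "x = cls r" using x by (auto simp: carrier_M)
    then show ?thesis using add_M[of \<zero> r] by simp
  qed
  show "\<zero>\<^bsub>M\<^esub> \<in> carrier M" unfolding carrier_M zero_M by (rule image_eqI[where x = \<zero>]) simp_all
qed (auto simp: carrier_M a_ac)

sublocale M: abelian_group M by (rule abelian_group_M)

lemma right_module_M: "right_module R M"
  using nonunital_ring_axioms abelian_group_M
  by (auto simp: right_module_def right_module_axioms_def carrier_M l_distr r_distr m_assoc)

lemma finsum_M: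
  "finite S \<Longrightarrow> g \<in> S \<rightarrow> carrier R \<Longrightarrow> finsum M (\<lambda>i. cls (g i)) S = cls (finsum R g S)"
proof (induction S rule: finite_induct)
  case (insert i S)
  then have "finsum M (\<lambda>i. cls (g i)) (insert i S) = cls (g i) \<oplus>\<^bsub>M\<^esub> finsum M (\<lambda>i. cls (g i)) S"
    by (intro M.finsum_insert) (auto simp: carrier_M)
  then show ?case using insert by (simp add: Pi_def)
qed simp

lemma minus_M: "x \<in> carrier R \<Longrightarrow> \<ominus>\<^bsub>M\<^esub> cls x = cls (\<ominus> x)"
  by (intro M.minus_equality) (auto simp: carrier_M l_neg cls_eq_N_iff)

lemma submodule_preimage:
  assumes "submodule H R M"
  shows "right_ideal R {x \<in> carrier R. cls x \<in> H}" "N \<subseteq> {x \<in> carrier R. cls x \<in> H}"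
    "H = cls ` {x \<in> carrier R. cls x \<in> H}"
proof -
  interpret H: submodule H R M by fact
  have N: "N \<in> H" using H.one_closed by simp
  have inv: "\<ominus>\<^bsub>M\<^esub> C \<in> H" if "C \<in> H" for C
    using H.m_inv_closed[OF that] by (simp add: a_inv_def)
  show "right_ideal R {x \<in> carrier R. cls x \<in> H}"
    unfolding right_ideal_def additive_subgroup_def
  proof (intro conjI ballI add.subgroupI)
    show "{x \<in> carrier R. cls x \<in> H} \<noteq> {}" using N by (auto intro!: exI[of _ \<zero>])
    show "\<ominus> a \<in> {x \<in> carrier R. cls x \<in> H}" if "a \<in> {x \<in> carrier R. cls x \<in> H}" for a
      using that inv[of "cls a"] by (simp add: minus_M)
    show "a \<oplus> b \<in> {x \<in> carrier R. cls x \<in> H}"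
      if "a \<in> {x \<in> carrier R. cls x \<in> H}" "b \<in> {x \<in> carrier R. cls x \<in> H}" for a b
      using that H.m_closed[of "cls a" "cls b"] by simp
    show "x \<otimes> a \<in> {x \<in> carrier R. cls x \<in> H}"
      if "x \<in> {x \<in> carrier R. cls x \<in> H}" "a \<in> carrier R" for x a
      using that H.smult_closed[of a "cls x"] by simp
  qed auto
  show "N \<subseteq> {x \<in> carrier R. cls x \<in> H}"
    using N by (auto simp: N.a_Hcarr cls_eq_N_iff[THEN iffD2])
  show "H = cls ` {x \<in> carrier R. cls x \<in> H}"
    using H.subset by (auto simp: carrier_M)
qed

text \<open>
  If \<open>N\<close> contains all elements \<open>r - x \<cdot> r\<close> but not \<open>x\<close>, and is maximal with respect to these
  properties, then \<open>x\<close> does not annihilate \<open>M\<close> and \<open>M\<close> is simple.  The predicate \<open>Q\<close> allows for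
  maximality among graded right ideals.
\<close>

lemma maximal_modular:
  assumes x: "x \<in> carrier R" "x \<notin> N" and mod: "\<And>r. r \<in> carrier R \<Longrightarrow> r \<ominus> x \<otimes> r \<in> N"
    and max: "\<And>N'. \<lbrakk>right_ideal R N'; Q N'; N \<subseteq> N'; x \<notin> N'\<rbrakk> \<Longrightarrow> N' = N"
  shows "x \<odot>\<^bsub>M\<^esub> cls x \<noteq> \<zero>\<^bsub>M\<^esub>"
    and "\<lbrakk>submodule H R M; Q {x \<in> carrier R. cls x \<in> H}\<rbrakk> \<Longrightarrow> H = {\<zero>\<^bsub>M\<^esub>} \<or> H = carrier M"
proof -
  have "x \<otimes> x \<notin> N"
  proof
    assume "x \<otimes> x \<in> N"
    then have "(x \<ominus> x \<otimes> x) \<oplus> x \<otimes> x \<in> N" using mod x by blast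
    then show False using x by (simp add: minus_eq a_assoc l_neg)
  qed
  then show "x \<odot>\<^bsub>M\<^esub> cls x \<noteq> \<zero>\<^bsub>M\<^esub>" using x by (simp add: cls_eq_N_iff)
  assume H: "submodule H R M" and Q: "Q {x \<in> carrier R. cls x \<in> H}"
  note pre = submodule_preimage[OF H]
  let ?P = "{x \<in> carrier R. cls x \<in> H}"
  show "H = {\<zero>\<^bsub>M\<^esub>} \<or> H = carrier M"
  proof (cases "x \<in> ?P")
    case True
    interpret P: additive_subgroup ?P R using pre(1) by (simp add: right_ideal_def)
    have "r \<in> ?P" if r: "r \<in> carrier R" for r
    proof -
      have "r \<ominus> x \<otimes> r \<in> ?P" using mod[OF r] pre(2) by blast
      moreover have "x \<otimes> r \<in> ?P" using pre(1) True r unfolding right_ideal_def by blast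
      ultimately have "(r \<ominus> x \<otimes> r) \<oplus> x \<otimes> r \<in> ?P" by (rule P.a_closed)
      moreover have "(r \<ominus> x \<otimes> r) \<oplus> x \<otimes> r = r" using x(1) r by algebra
      ultimately show ?thesis by (simp only:)
    qed
    then have P: "?P = carrier R" by blast
    have "H = cls ` ?P" by (rule pre(3))
    also have "\<dots> = carrier M" by (simp only: P carrier_M)
    finally show ?thesis by blast
  next
    case False
    then have P: "?P = N" using max[OF pre(1) Q pre(2)] by blast
    have "H = cls ` ?P" by (rule pre(3))
    also have "\<dots> = cls ` N" by (simp only: P)
    also have "\<dots> = {N}"
      using N.zero_closed by (auto simp: N.a_rcos_const simp del: N.zero_closed)
    finally show ?thesis by (simp only: zero_M simp_thms)
  qed
qed

end

context nonunital_ring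
begin

lemma right_ideal_one_minus:
  assumes x: "x \<in> carrier R"
  shows "right_ideal R {r \<ominus> x \<otimes> r | r. r \<in> carrier R}"
  unfolding right_ideal_def additive_subgroup_def
proof (intro conjI ballI add.subgroupI)
  let ?L = "{r \<ominus> x \<otimes> r | r. r \<in> carrier R}"
  show "?L \<noteq> {}" by auto
  show "\<ominus> a \<in> ?L" if "a \<in> ?L" for a
  proof -
    obtain r where r: "r \<in> carrier R" "a = r \<ominus> x \<otimes> r" using \<open>a \<in> ?L\<close> by auto
    have "\<ominus> a = \<ominus> r \<ominus> x \<otimes> \<ominus> r" unfolding r(2) using r(1) x by algebra
    then show ?thesis using r(1) by auto
  qed
  show "a \<oplus> b \<in> ?L" if ab: "a \<in> ?L" "b \<in> ?L" for a b
  proof -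
    obtain r s where rs: "r \<in> carrier R" "a = r \<ominus> x \<otimes> r" "s \<in> carrier R" "b = s \<ominus> x \<otimes> s"
      using ab by auto
    have "a \<oplus> b = (r \<oplus> s) \<ominus> x \<otimes> (r \<oplus> s)" unfolding rs(2,4) using rs(1,3) x by algebra
    then show ?thesis using rs(1,3) by auto
  qed
  show "a \<otimes> b \<in> ?L" if "a \<in> ?L" "b \<in> carrier R" for a b
  proof -
    obtain r where r: "r \<in> carrier R" "a = r \<ominus> x \<otimes> r" using \<open>a \<in> ?L\<close> by auto
    have "a \<otimes> b = r \<otimes> b \<ominus> x \<otimes> (r \<otimes> b)" unfolding r(2) using r(1) x that(2) by algebra
    then show ?thesis using r(1) that(2) by auto
  qed
qed (use x in auto)

lemma right_ideal_Union_chain: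
  assumes "C \<noteq> {}" "subset.chain A C" "\<And>N. N \<in> C \<Longrightarrow> right_ideal R N"
  shows "right_ideal R (\<Union>C)"
  unfolding right_ideal_def additive_subgroup_def
proof (intro conjI ballI add.subgroupI)
  have add: "additive_subgroup N R" if "N \<in> C" for N
    using assms(3) that by (simp add: right_ideal_def)
  show "\<Union>C \<subseteq> carrier R" using additive_subgroup.a_subset[OF add] by blast
  show "\<Union>C \<noteq> {}" using assms(1) additive_subgroup.zero_closed[OF add] by blast
  show "\<ominus> a \<in> \<Union>C" if "a \<in> \<Union>C" for a
    using that subgroup.m_inv_closed[OF add[unfolded additive_subgroup_def]]
    by (auto simp: a_inv_def)
  show "a \<oplus> b \<in> \<Union>C" if ab: "a \<in> \<Union>C" "b \<in> \<Union>C" for a b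
  proof -
    obtain U V where UV: "U \<in> C" "a \<in> U" "V \<in> C" "b \<in> V" using ab by blast
    then have "U \<subseteq> V \<or> V \<subseteq> U" using assms(2) by (auto simp: subset.chain_def)
    then show ?thesis using UV additive_subgroup.a_closed[OF add] by blast
  qed
  show "a \<otimes> b \<in> \<Union>C" if "a \<in> \<Union>C" "b \<in> carrier R" for a b
    using that assms(3) by (auto simp: right_ideal_def)
qed

text \<open>An instance of Zorn's lemma; \<open>Q\<close> is either trivial or says that the ideal is graded.\<close>

lemma exists_maximal_right_ideal:
  assumes L: "right_ideal R L" "Q L" "x \<notin> L"
    and Q: "\<And>C. \<lbrakk>C \<noteq> {}; \<And>N. N \<in> C \<Longrightarrow> right_ideal R N \<and> Q N; right_ideal R (\<Union>C)\<rbrakk> \<Longrightarrow> Q (\<Union>C)"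
  obtains N where "right_ideal R N" "Q N" "L \<subseteq> N" "x \<notin> N"
    "\<And>N'. \<lbrakk>right_ideal R N'; Q N'; N \<subseteq> N'; x \<notin> N'\<rbrakk> \<Longrightarrow> N' = N"
proof -
  let ?A = "{N. right_ideal R N \<and> Q N \<and> L \<subseteq> N \<and> x \<notin> N}"
  have "\<exists>U\<in>?A. \<forall>V\<in>?A. U \<subseteq> V \<longrightarrow> V = U"
  proof (rule subset_Zorn_nonempty)
    show "?A \<noteq> {}" using L by blast
    fix C assume C: "C \<noteq> {}" "subset.chain ?A C"
    then have sub: "C \<subseteq> ?A" by (simp add: subset.chain_def)
    have "right_ideal R (\<Union>C)" using C sub by (intro right_ideal_Union_chain) auto
    moreover have "Q (\<Union>C)" using C sub \<open>right_ideal R (\<Union>C)\<close> by (intro Q) auto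
    ultimately show "\<Union>C \<in> ?A" using C(1) sub by blast
  qed
  then obtain N where N: "N \<in> ?A" "\<forall>V\<in>?A. N \<subseteq> V \<longrightarrow> V = N" by (elim bexE) (rule that)
  show ?thesis
  proof (rule that)
    show "N' = N" if "right_ideal R N'" "Q N'" "N \<subseteq> N'" "x \<notin> N'" for N'
    proof -
      have "N' \<in> ?A" using that N(1) by auto
      then show ?thesis using N(2) that(3) by blast
    qed
  qed (use N(1) in auto)
qed

lemma two_sided_ideal_annihilator:
  assumes "right_module R M"
  shows "two_sided_ideal R (module_annihilator R M)"
proof -
  interpret M: right_module R M by fact
  have smult_zero: "a \<odot>\<^bsub>M\<^esub> \<zero>\<^bsub>M\<^esub> = \<zero>\<^bsub>M\<^esub>" if "a \<in> carrier R" for a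
    using M.smult_r_distr[OF that, of "\<zero>\<^bsub>M\<^esub>" "\<zero>\<^bsub>M\<^esub>"] M.smult_closed[OF that, of "\<zero>\<^bsub>M\<^esub>"] by simp
  have zero_smult: "\<zero> \<odot>\<^bsub>M\<^esub> x = \<zero>\<^bsub>M\<^esub>" if "x \<in> carrier M" for x
    using M.smult_l_distr[of \<zero> \<zero> x] M.smult_closed[of \<zero> x] that by simp
  have minus_smult: "\<ominus> a \<odot>\<^bsub>M\<^esub> x = \<zero>\<^bsub>M\<^esub>"
    if "a \<in> carrier R" "x \<in> carrier M" "a \<odot>\<^bsub>M\<^esub> x = \<zero>\<^bsub>M\<^esub>" for a x
    using M.smult_l_distr[of "\<ominus> a" a x] M.smult_closed[of "\<ominus> a" x] that zero_smult
    by (simp add: l_neg)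
  have "subgroup (module_annihilator R M) (add_monoid R)"
    by (rule add.subgroupI)
      (auto simp: module_annihilator_def M.smult_l_distr minus_smult intro!: exI[of _ \<zero>] zero_smult)
  then show ?thesis
    by (auto simp: two_sided_ideal_def right_ideal_def left_ideal_def additive_subgroup_def
        module_annihilator_def M.smult_assoc M.smult_closed smult_zero)
qed

lemma two_sided_ideal_Inter:
  assumes "\<And>I. I \<in> S \<Longrightarrow> two_sided_ideal R I"
  shows "two_sided_ideal R (carrier R \<inter> \<Inter>S)"
proof -
  have "subgroup (\<Inter>(insert (carrier R) S)) (add_monoid R)"
    using assms by (intro add.subgroups_Inter)
      (auto simp: two_sided_ideal_def right_ideal_def additive_subgroup_def add.subgroup_self)
  then show ?thesis
    using assms by (auto simp: two_sided_ideal_def right_ideal_def left_ideal_def additive_subgroup_def)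
qed

lemma two_sided_ideal_jacobson_radical: "two_sided_ideal R (jacobson_radical R)"
  unfolding jacobson_radical_def
  by (rule two_sided_ideal_Inter) (auto simp: simple_right_module_def intro: two_sided_ideal_annihilator)

lemma two_sided_ideal_graded_jacobson_radical: "two_sided_ideal R (graded_jacobson_radical R G)"
  unfolding graded_jacobson_radical_def
  by (rule two_sided_ideal_Inter)
    (auto simp: graded_simple_right_module_def graded_right_module_def intro: two_sided_ideal_annihilator)

text \<open>Elements of the Jacobson radical are quasi-regular.\<close>

lemma jacobson_radical_quasi_regular:
  assumes a: "a \<in> jacobson_radical R"
  shows "\<exists>r\<in>carrier R. a = r \<ominus> a \<otimes> r"
proof (rule ccontr)
  assume no: "\<not> ?thesis"
  have aC: "a \<in> carrier R" using a by (simp add: jacobson_radical_def)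
  let ?L = "{r \<ominus> a \<otimes> r | r. r \<in> carrier R}"
  obtain N where N: "right_ideal R N" "?L \<subseteq> N" "a \<notin> N"
    and max: "\<And>N'. \<lbrakk>right_ideal R N'; True; N \<subseteq> N'; a \<notin> N'\<rbrakk> \<Longrightarrow> N' = N"
    by (rule exists_maximal_right_ideal[OF right_ideal_one_minus[OF aC], of "\<lambda>_. True" a]) (use no in auto)
  interpret right_ideal_quotient R N by unfold_locales fact
  have mod: "r \<ominus> a \<otimes> r \<in> N" if "r \<in> carrier R" for r using N(2) that by blast
  note * = maximal_modular[where Q = "\<lambda>_. True", OF aC N(3) mod max]
  have "simple_right_module R M"
    unfolding simple_right_module_def
    using right_module_M aC *(1) *(2) by (auto simp: carrier_M)
  then have "a \<in> module_annihilator R M"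
    using a by (auto simp: jacobson_radical_def)
  then show False using *(1) aC by (auto simp: module_annihilator_def carrier_M)
qed

end

context graded_ring
begin

text \<open>The quotient by a graded right ideal is graded by the images of the components of \<open>R\<close>.\<close>

lemma graded_quotient:
  assumes N: "right_ideal R N" "graded_subgroup R G N"
  defines "M \<equiv> quotient_right_module R N" and "D \<equiv> \<lambda>n. (\<lambda>x. N +> x) ` G n"
  shows "graded_right_module R G M D"
    and "x \<in> carrier R \<Longrightarrow> hcomp M D (N +> x) n = N +> cp x n"
proof -
  interpret Q: right_ideal_quotient R N by unfold_locales fact
  have M: "M = Q.M" by (simp add: M_def)
  have sub: "additive_subgroup (D n) M" for n
    unfolding additive_subgroup_def
  proof (rule Q.M.add.subgroupI[folded M])
    show "D n \<subseteq> carrier M" by (auto simp: D_def M Q.carrier_M)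
    show "D n \<noteq> {}" using D_zero[of n] by (auto simp: D_def simp del: D_zero)
    show "\<ominus>\<^bsub>M\<^esub> C \<in> D n" if "C \<in> D n" for C
      using that by (auto simp: D_def M Q.minus_M)
    show "C \<oplus>\<^bsub>M\<^esub> C' \<in> D n" if "C \<in> D n" "C' \<in> D n" for C C'
      using that by (auto simp: D_def M)
  qed
  have iff: "(\<forall>n. f n \<in> D n) \<and> finite {n. f n \<noteq> \<zero>\<^bsub>M\<^esub>} \<and> Q.cls x = finsum M f {n. f n \<noteq> \<zero>\<^bsub>M\<^esub>}
       \<longleftrightarrow> f = (\<lambda>n. Q.cls (cp x n))" (is "?L = ?R")
    if x: "x \<in> carrier R" for x f
  proof
    assume L: ?L
    let ?S = "{n. f n \<noteq> \<zero>\<^bsub>M\<^esub>}"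
    have "\<forall>n. \<exists>g. g \<in> G n \<and> f n = Q.cls g" using L by (auto simp: D_def)
    then obtain g where g: "\<And>n. g n \<in> G n" "\<And>n. f n = Q.cls (g n)" by metis
    have gC: "g n \<in> carrier R" for n using g(1) by (rule D_carrier)
    have "Q.cls x = finsum M f ?S" using L by blast
    also have "\<dots> = finsum M (\<lambda>n. Q.cls (g n)) ?S"
      by (rule arg_cong[where f = "\<lambda>h. finsum M h ?S"]) (simp add: g(2) fun_eq_iff)
    also have "\<dots> = Q.cls (finsum R g ?S)"
      unfolding M using L gC by (intro Q.finsum_M) (auto simp: M)
    finally have "Q.cls x = Q.cls (finsum R g ?S)" .
    then have "x \<ominus> finsum R g ?S \<in> N" using x gC by (subst (asm) Q.cls_eq_iff) auto
    then have "cp (x \<ominus> finsum R g ?S) n \<in> N" for n using N(2) by (auto simp: graded_subgroup_iff)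
    moreover have "cp (finsum R g ?S) n = (if n \<in> ?S then g n else \<zero>)" for n
    proof -
      have "cp (finsum R g ?S) n = finsum R (\<lambda>i. cp (g i) n) ?S"
        using L gC by (intro cp_finsum) auto
      also have "\<dots> = finsum R (\<lambda>i. if n = i then g i else \<zero>) ?S"
        using gC by (intro finsum_cong') (auto simp: cp_homogeneous[OF g(1)])
      also have "\<dots> = (if n \<in> ?S then g n else \<zero>)"
      proof (cases "n \<in> ?S")
        case True
        then show ?thesis using L gC finsum_singleton[of n ?S g] by auto
      next
        case False
        then have "finsum R (\<lambda>i. if n = i then g i else \<zero>) ?S = \<zero>"
          by (intro add.finprod_one_eqI) metis
        then show ?thesis using False by simp
      qed
      finally show ?thesis .
    qed
    ultimately have *: "cp x n \<ominus> (if n \<in> ?S then g n else \<zero>) \<in> N" for n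
      using x gC by (simp add: cp_minus)
    show ?R
    proof
      fix n
      show "f n = Q.cls (cp x n)"
      proof (cases "n \<in> ?S")
        case True
        then show ?thesis using *[of n] x gC by (simp add: g(2) Q.cls_eq_iff[symmetric])
      next
        case False
        then have "cp x n \<in> N" using *[of n] x by (simp add: minus_eq minus_zero_group)
        then show ?thesis using False x Q.cls_eq_N_iff[of "cp x n"] by (simp add: M)
      qed
    qed
  next
    assume R: ?R
    have sub: "{n. f n \<noteq> \<zero>\<^bsub>M\<^esub>} \<subseteq> supp x"
      using Q.cls_eq_N_iff[of \<zero>] by (auto simp: R M)
    have fin: "finite {n. f n \<noteq> \<zero>\<^bsub>M\<^esub>}" using finite_subset[OF sub] x by simp
    have "finsum M f {n. f n \<noteq> \<zero>\<^bsub>M\<^esub>} = finsum M f (supp x)"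
      unfolding M using x sub by (intro Q.M.finsum_mono_neutral) (auto simp: R M Q.carrier_M)
    also have "\<dots> = Q.cls (finsum R (cp x) (supp x))"
      unfolding R M using x by (intro Q.finsum_M) auto
    also have "\<dots> = Q.cls x" using x by (simp add: sum_cp_superset)
    finally show ?L using fin x by (auto simp: R D_def)
  qed
  have dd: "direct_decomposition M D"
    unfolding direct_decomposition_def
  proof (intro conjI allI ballI sub)
    fix C assume "C \<in> carrier M"
    then obtain x where x: "x \<in> carrier R" "C = Q.cls x" by (auto simp: M Q.carrier_M)
    show "\<exists>!f. (\<forall>n. f n \<in> D n) \<and> finite {n. f n \<noteq> \<zero>\<^bsub>M\<^esub>} \<and> C = finsum M f {n. f n \<noteq> \<zero>\<^bsub>M\<^esub>}"
      unfolding x(2) iff[OF x(1)] by simp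
  qed
  show "graded_right_module R G M D"
    unfolding graded_right_module_def
  proof (intro conjI allI ballI dd)
    show "right_module R M" unfolding M by (rule Q.right_module_M)
    fix i j a C assume "a \<in> G i" "C \<in> D j"
    then show "a \<odot>\<^bsub>M\<^esub> C \<in> D (j + i)" by (auto simp: D_def M G_mult)
  qed
  show "hcomp M D (N +> x) n = N +> cp x n" if "x \<in> carrier R"
    unfolding hcomp_def iff[OF that] by simp
qed

end

context graded_regular_ring
begin

lemma homogeneous_idempotent_in_graded_jacobson_radical:
  assumes e: "e \<in> G 0" "e \<otimes> e = e" "e \<in> graded_jacobson_radical R G"
  shows "e = \<zero>"
proof (rule ccontr)
  assume "e \<noteq> \<zero>"
  have eC: "e \<in> carrier R" using e by auto
  let ?L = "{r \<ominus> e \<otimes> r | r. r \<in> carrier R}"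
  have L: "right_ideal R ?L" by (rule right_ideal_one_minus[OF eC])
  moreover have "graded_subgroup R G ?L"
    unfolding graded_subgroup_iff
  proof (intro conjI ballI allI)
    show "additive_subgroup ?L R" using L by (simp add: right_ideal_def)
    fix x n assume "x \<in> ?L"
    then obtain r where r: "r \<in> carrier R" "x = r \<ominus> e \<otimes> r" by auto
    then have "cp x n = cp r n \<ominus> e \<otimes> cp r n"
      using eC cp_mult_homogeneous_left[OF r(1) e(1)] by (simp add: cp_minus)
    then show "cp x n \<in> ?L" using r(1) by auto
  qed
  moreover have "e \<notin> ?L"
  proof
    assume "e \<in> ?L"
    then obtain r where r: "r \<in> carrier R" "e = r \<ominus> e \<otimes> r" by auto
    have "e \<otimes> (r \<ominus> e \<otimes> r) = e \<otimes> r \<ominus> e \<otimes> e \<otimes> r" using r(1) eC by algebra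
    also have "\<dots> = \<zero>" using r(1) eC by (simp add: e(2) minus_eq r_neg)
    finally have "e \<otimes> e = \<zero>" by (simp only: r(2)[symmetric])
    then show False using e(2) \<open>e \<noteq> \<zero>\<close> by simp
  qed
  ultimately obtain N where N: "right_ideal R N" "graded_subgroup R G N" "?L \<subseteq> N" "e \<notin> N"
    and max: "\<And>N'. \<lbrakk>right_ideal R N'; graded_subgroup R G N'; N \<subseteq> N'; e \<notin> N'\<rbrakk> \<Longrightarrow> N' = N"
  proof (rule exists_maximal_right_ideal)
    fix C assume "\<And>N. N \<in> C \<Longrightarrow> right_ideal R N \<and> graded_subgroup R G N" "right_ideal R (\<Union>C)"
    then show "graded_subgroup R G (\<Union>C)"
      unfolding graded_subgroup_iff right_ideal_def by blast
  qed (rule that)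
  interpret Q: right_ideal_quotient R N by unfold_locales fact
  let ?D = "\<lambda>n. Q.cls ` G n"
  have mod: "r \<ominus> e \<otimes> r \<in> N" if "r \<in> carrier R" for r using N(3) that by blast
  note * = Q.maximal_modular[where Q = "graded_subgroup R G", OF eC N(4) mod max]
  note gr = graded_quotient[OF N(1,2)]
  interpret QM: graded_group Q.M ?D
    using gr(1) by unfold_locales (simp add: graded_right_module_def)
  have "graded_simple_right_module R G Q.M ?D"
    unfolding graded_simple_right_module_def
  proof (intro conjI allI impI gr(1))
    show "\<exists>a\<in>carrier R. \<exists>x\<in>carrier Q.M. a \<odot>\<^bsub>Q.M\<^esub> x \<noteq> \<zero>\<^bsub>Q.M\<^esub>"
      using *(1) eC by (auto simp: Q.carrier_M)
    fix H assume H: "submodule H R Q.M \<and> graded_subgroup Q.M ?D H"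
    have "graded_subgroup R G {x \<in> carrier R. Q.cls x \<in> H}"
      unfolding graded_subgroup_iff
    proof (intro conjI ballI allI)
      show "additive_subgroup {x \<in> carrier R. Q.cls x \<in> H} R"
        using Q.submodule_preimage(1) H by (simp add: right_ideal_def)
      fix x n assume x: "x \<in> {x \<in> carrier R. Q.cls x \<in> H}"
      then have "hcomp Q.M ?D (Q.cls x) n \<in> H"
        using H QM.graded_subgroup_iff by blast
      then show "cp x n \<in> {x \<in> carrier R. Q.cls x \<in> H}" using x gr(2) by simp
    qed
    then show "H = {\<zero>\<^bsub>Q.M\<^esub>} \<or> H = carrier Q.M" using H by (intro *(2)) auto
  qed
  then have "e \<in> module_annihilator R Q.M"
    using e(3) by (auto simp: graded_jacobson_radical_def)
  then show False using *(1) eC by (auto simp: module_annihilator_def Q.carrier_M)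
qed

lemma cp_graded_jacobson_radical:
  assumes a: "a \<in> graded_jacobson_radical R G"
  shows "cp a n \<in> graded_jacobson_radical R G"
proof -
  have aC: "a \<in> carrier R" using a by (simp add: graded_jacobson_radical_def)
  have "cp a n \<in> module_annihilator R M" if gs: "graded_simple_right_module R G M D"
    for M :: "('a, 'a set) module" and D
  proof -
    have grm: "graded_right_module R G M D" using gs by (simp add: graded_simple_right_module_def)
    then interpret M: right_module R M by (simp add: graded_right_module_def)
    interpret M: graded_group M D
      using grm by unfold_locales (simp add: graded_right_module_def)
    have D_smult: "a \<odot>\<^bsub>M\<^esub> x \<in> D (j + i)" if "a \<in> G i" "x \<in> D j" for a x i j
      using grm that by (auto simp: graded_right_module_def)
    have "a \<in> module_annihilator R M"
      using a gs unfolding graded_jacobson_radical_def by blast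
    then have ann: "a \<odot>\<^bsub>M\<^esub> x = \<zero>\<^bsub>M\<^esub>" if "x \<in> carrier M" for x
      using that by (simp add: module_annihilator_def)
    have cp: "M.cp (b \<odot>\<^bsub>M\<^esub> x) (j + n) = cp b n \<odot>\<^bsub>M\<^esub> x" if x: "x \<in> D j" and b: "b \<in> carrier R" for b x j
      using b
    proof (induction b rule: homogeneous_induct)
      case (homogeneous i b)
      have "\<zero> \<odot>\<^bsub>M\<^esub> x = \<zero>\<^bsub>M\<^esub>"
        using M.smult_l_distr[of \<zero> \<zero> x] M.smult_closed[of \<zero> x] x by simp
      then show ?case
        using D_smult[OF homogeneous x] homogeneous x by (simp add: cp_homogeneous M.cp_homogeneous)
    next
      case (add b c)
      then show ?case using x by (simp add: cp_add M.smult_l_distr M.smult_closed M.cp_add)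
    qed
    have "cp a n \<odot>\<^bsub>M\<^esub> x = \<zero>\<^bsub>M\<^esub>" if "x \<in> carrier M" for x
      using that
    proof (induction x rule: M.homogeneous_induct)
      case (homogeneous j x)
      then show ?case using cp[OF homogeneous aC] ann[of x] by simp
    next
      case (add x y)
      then show ?case using aC by (simp add: M.smult_r_distr)
    qed
    then show ?thesis using aC by (simp add: module_annihilator_def)
  qed
  then show ?thesis using aC by (auto simp: graded_jacobson_radical_def)
qed

lemma graded_jacobson_radical_eq_zero: "graded_jacobson_radical R G = {\<zero>}"
proof -
  note J = two_sided_ideal_graded_jacobson_radical[of G]
  interpret J: additive_subgroup "graded_jacobson_radical R G" R
    using J by (simp add: two_sided_ideal_def right_ideal_def)
  have "a = \<zero>" if a: "a \<in> graded_jacobson_radical R G" for a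
  proof (rule eq_zero_if_cp)
    show aC: "a \<in> carrier R" using a by (simp add: J.a_Hcarr)
    fix n
    obtain y where y: "y \<in> G (- n)" "cp a n \<otimes> y \<otimes> cp a n = cp a n"
      using regular[OF cp_D[OF aC]] by blast
    have yC: "y \<in> carrier R" using y by auto
    let ?e = "cp a n \<otimes> y"
    have "?e = \<zero>"
    proof (rule homogeneous_idempotent_in_graded_jacobson_radical)
      show "?e \<in> G 0" using G_mult[OF cp_D[OF aC, of n] y(1)] by simp
      show "?e \<otimes> ?e = ?e" using y(2) yC aC by (simp add: m_assoc[symmetric])
      show "?e \<in> graded_jacobson_radical R G"
        using cp_graded_jacobson_radical[OF a] J yC by (auto simp: two_sided_ideal_def right_ideal_def)
    qed
    then show "cp a n = \<zero>" using y(2) aC by simp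
  qed
  then show ?thesis using J.zero_closed by blast
qed

text \<open>
  A nonzero element of the Jacobson radical with the smallest number of components leads to an
  element \<open>b = e + \<dots> + \<theta>\<close> of the radical, where \<open>e\<close> is a homogeneous idempotent, \<open>b = ebe\<close>, and \<open>\<theta>\<close>
  is the component of least degree \<open>-m\<close>; here \<open>m > 0\<close>, since nonzero idempotents are not quasi-regular.
  Minimality makes \<open>b\<close> commute with homogeneous elements of
  \<open>eRe\<close>, so \<open>\<theta>\<close> is invertible in a corner with identity \<open>g\<close>.  By quasi-regularity \<open>g + \<theta>b\<close> has a
  right inverse in this corner, which is impossible for reasons of degree: the extreme components
  \<open>g\<close> and \<open>\<theta>\<^sup>2\<close> of \<open>g + \<theta>b\<close> are both invertible and of different degrees.
\<close>

lemma jacobson_radical_eq_zero: "jacobson_radical R = {\<zero>}"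
proof -
  note J = two_sided_ideal_jacobson_radical
  interpret J: additive_subgroup "jacobson_radical R" R
    using J by (simp add: two_sided_ideal_def right_ideal_def)
  have J_mult: "x \<otimes> a \<in> jacobson_radical R" "a \<otimes> x \<in> jacobson_radical R"
    if "x \<in> jacobson_radical R" "a \<in> carrier R" for x a
    using J that by (auto simp: two_sided_ideal_def right_ideal_def left_ideal_def)
  have False if ex: "x \<in> jacobson_radical R" "x \<noteq> \<zero>" for x
  proof -
    define a where "a = arg_min (\<lambda>x. card (supp x)) (\<lambda>x. x \<in> jacobson_radical R \<and> x \<noteq> \<zero>)"
    have a: "a \<in> jacobson_radical R" "a \<noteq> \<zero>"
      using arg_min_natI[of "\<lambda>x. x \<in> jacobson_radical R \<and> x \<noteq> \<zero>" x] ex by (auto simp: a_def)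
    have minimal: "c = \<zero>" if "c \<in> jacobson_radical R" "card (supp c) < card (supp a)" for c
      using arg_min_nat_le[of "\<lambda>x. x \<in> jacobson_radical R \<and> x \<noteq> \<zero>" c "\<lambda>x. card (supp x)"] that
      by (force simp: a_def)
    have aC: "a \<in> carrier R" using a by (simp add: J.a_Hcarr)
    have "supp a \<noteq> {}" using a(2) aC eq_zero_if_cp by blast
    define n where "n = Max (supp a)"
    have n_max: "k \<le> n" if "k \<in> supp a" for k
      unfolding n_def by (rule Max_ge[OF finite_supp[OF aC] that])
    have n: "cp a n \<noteq> \<zero>"
      using Max_in[OF finite_supp[OF aC] \<open>supp a \<noteq> {}\<close>] by (simp add: n_def)
    obtain y where y: "y \<in> G (- n)" "cp a n \<otimes> y \<otimes> cp a n = cp a n"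
      using regular[OF cp_D[OF aC]] by blast
    have yC: "y \<in> carrier R" using y by auto
    define e where "e = y \<otimes> cp a n"
    have e: "e \<in> G 0" using G_mult[OF y(1) cp_D[OF aC, of n]] by (simp add: e_def)
    have eC: "e \<in> carrier R" using e by auto
    have ane: "cp a n \<otimes> e = cp a n" using y aC yC by (simp add: e_def m_assoc)
    have ee: "e \<otimes> e = e"
    proof -
      have "e \<otimes> e = y \<otimes> (cp a n \<otimes> e)" unfolding e_def using cp_carrier[OF aC, of n] yC by algebra
      then show ?thesis by (simp only: ane e_def[symmetric])
    qed
    have e0: "e \<noteq> \<zero>" using ane n aC by auto
    define b where "b = e \<otimes> y \<otimes> a \<otimes> e"
    have b: "b \<in> jacobson_radical R" unfolding b_def using a eC yC by (intro J_mult) auto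
    have bC: "b \<in> carrier R" using b by (simp add: J.a_Hcarr)
    have ey: "e \<otimes> y \<in> G (- n)" using G_mult[OF e y(1)] by simp
    have cpb: "cp b k = e \<otimes> y \<otimes> cp a (k + n) \<otimes> e" for k
      unfolding b_def using cp_mult_homogeneous_left[OF aC ey] cp_mult_homogeneous_right[OF _ e] aC yC eC
      by simp
    have b0: "cp b 0 = e"
    proof -
      have "cp b 0 = e \<otimes> (y \<otimes> cp a n) \<otimes> e" unfolding cpb using aC yC eC by (simp add: m_assoc)
      then show ?thesis by (simp only: e_def[symmetric] ee)
    qed
    have ebe: "e \<otimes> cp b k = cp b k" "cp b k \<otimes> e = cp b k" for k
    proof -
      have "e \<otimes> cp b k = (e \<otimes> e) \<otimes> y \<otimes> cp a (k + n) \<otimes> e"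
        "cp b k \<otimes> e = e \<otimes> y \<otimes> cp a (k + n) \<otimes> (e \<otimes> e)"
        unfolding cpb using cp_carrier[OF aC, of "k + n"] yC eC by algebra+
      then show "e \<otimes> cp b k = cp b k" "cp b k \<otimes> e = cp b k" by (simp_all only: ee cpb)
    qed
    have supp_b: "supp b \<subseteq> (\<lambda>k. k - n) ` supp a"
    proof
      fix k assume "k \<in> supp b"
      then have "k + n \<in> supp a" using aC yC eC by (auto simp: cpb)
      then show "k \<in> (\<lambda>k. k - n) ` supp a" by (intro image_eqI[of _ _ "k + n"]) simp_all
    qed
    have card_b: "card (supp b) \<le> card (supp a)"
      by (rule order_trans[OF card_mono[OF _ supp_b] card_image_le]) (use aC in auto)
    have b_le: "k \<le> 0" if "k \<in> supp b" for k
    proof -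
      obtain j where "j \<in> supp a" "k = j - n" using subsetD[OF supp_b \<open>k \<in> supp b\<close>] by blast
      then show ?thesis using n_max[of j] by simp
    qed
    have z_b: "0 \<in> supp b" using b0 e0 by simp
    define m where "m = - Min (supp b)"
    have m_min: "- m \<le> k" if "k \<in> supp b" for k
      using Min_le[OF finite_supp[OF bC] that] by (simp add: m_def)
    have m_in: "- m \<in> supp b"
      using Min_in[OF finite_supp[OF bC]] z_b by (auto simp: m_def)
    have m_nonneg: "m \<ge> 0" using m_min[OF z_b] by simp
    show False
    proof (cases "m = 0")
      case True
      have "k = 0" if "k \<in> supp b" for k using b_le[OF that] m_min[OF that] True by simp
      then have "supp b \<subseteq> {0}" by blast
      then have "b = finsum R (cp b) {0}" using bC by (simp add: sum_cp_superset del: finsum_insert)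
      also have "\<dots> = e" using eC by (simp add: b0)
      finally obtain r where r: "r \<in> carrier R" "e = r \<ominus> e \<otimes> r"
        using jacobson_radical_quasi_regular[OF b] by auto
      have "e \<otimes> (r \<ominus> e \<otimes> r) = e \<otimes> r \<ominus> e \<otimes> e \<otimes> r" using r(1) eC by algebra
      also have "\<dots> = \<zero>" using r(1) eC by (simp add: ee minus_eq r_neg)
      finally have "e \<otimes> e = \<zero>" by (simp only: r(2)[symmetric])
      then show False using ee e0 by simp
    next
      case False
      then have m_pos: "m > 0" using m_nonneg by simp
      define \<theta> where "\<theta> = cp b (- m)"
      have \<theta>: "\<theta> \<in> G (- m)" "\<theta> \<noteq> \<zero>" "\<theta> \<in> carrier R" "e \<otimes> \<theta> = \<theta>" "\<theta> \<otimes> e = \<theta>"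
        using m_in bC ebe by (simp_all add: \<theta>_def)
      obtain z0 where z0: "z0 \<in> G m" "\<theta> \<otimes> z0 \<otimes> \<theta> = \<theta>" using regular[OF \<theta>(1)] by auto
      define z where "z = e \<otimes> z0 \<otimes> e"
      have z0C: "z0 \<in> carrier R" using z0 by auto
      have z: "z \<in> G m" using G_mult[OF G_mult[OF e z0(1)] e] by (simp add: z_def)
      have zC: "z \<in> carrier R" using z by auto
      have eze: "e \<otimes> z = z" "z \<otimes> e = z"
      proof -
        have "e \<otimes> z = (e \<otimes> e) \<otimes> z0 \<otimes> e" "z \<otimes> e = e \<otimes> z0 \<otimes> (e \<otimes> e)"
          unfolding z_def using eC z0C by algebra+
        then show "e \<otimes> z = z" "z \<otimes> e = z" by (simp_all only: ee z_def)
      qed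
      have tzt: "\<theta> \<otimes> z \<otimes> \<theta> = \<theta>"
      proof -
        have "\<theta> \<otimes> z \<otimes> \<theta> = (\<theta> \<otimes> e) \<otimes> z0 \<otimes> (e \<otimes> \<theta>)" unfolding z_def using eC z0C \<theta>(3) by algebra
        then show ?thesis by (simp only: \<theta> z0)
      qed
      \<comment> \<open>The commutator of \<open>z\<close> and \<open>b\<close> has fewer components than \<open>b\<close>, hence is zero.\<close>
      define c where "c = z \<otimes> b \<ominus> b \<otimes> z"
      have cpc: "cp c k = z \<otimes> cp b (k - m) \<ominus> cp b (k - m) \<otimes> z" for k
        unfolding c_def using bC zC cp_mult_homogeneous_left[OF bC z] cp_mult_homogeneous_right[OF bC z]
        by (simp add: cp_minus)
      have "c \<in> jacobson_radical R"
        unfolding c_def minus_eq using b zC by (intro J.a_closed J.a_inv_closed J_mult)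
      moreover have "card (supp c) < card (supp a)"
      proof -
        have "supp c \<subseteq> (\<lambda>k. k + m) ` (supp b - {0})"
        proof
          fix k assume k: "k \<in> supp c"
          have "cp b (k - m) \<noteq> \<zero>" using k zC by (auto simp: cpc minus_eq r_neg minus_zero_group)
          moreover have "k - m \<noteq> 0" using k zC by (auto simp: cpc b0 eze minus_eq r_neg)
          ultimately show "k \<in> (\<lambda>k. k + m) ` (supp b - {0})" by (intro image_eqI[of _ _ "k - m"]) auto
        qed
        then have "card (supp c) \<le> card (supp b - {0})"
          using bC by (intro order_trans[OF card_mono card_image_le]) auto
        also have "\<dots> < card (supp b)" using z_b bC by (intro card_Diff1_less) auto
        finally show ?thesis using card_b by simp
      qed
      ultimately have "c = \<zero>" by (rule minimal)
      then have "cp c 0 = \<zero>" by simp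
      then have zt: "z \<otimes> \<theta> = \<theta> \<otimes> z"
        unfolding cpc using zC \<theta>(3) by (simp add: \<theta>_def[symmetric] minus_eq_zero_iff)
      define g where "g = \<theta> \<otimes> z"
      have gC: "g \<in> carrier R" using zC \<theta> by (simp add: g_def)
      have g: "g \<in> G 0" using G_mult[OF \<theta>(1) z] by (simp add: g_def)
      have gt: "g \<otimes> \<theta> = \<theta>" by (simp add: g_def tzt)
      have ztg: "z \<otimes> \<theta> = g" by (simp add: g_def zt)
      have gg: "g \<otimes> g = g"
      proof -
        have "g \<otimes> g = (g \<otimes> \<theta>) \<otimes> z" unfolding g_def using zC \<theta>(3) by algebra
        then show ?thesis by (simp only: gt g_def[symmetric])
      qed
      have g0: "g \<noteq> \<zero>" using gt \<theta> by auto
      have "\<ominus> (\<theta> \<otimes> b) \<in> jacobson_radical R"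
        using b \<theta>(3) by (intro J.a_inv_closed J_mult)
      then obtain r where r: "r \<in> carrier R" and r_eq: "\<ominus> (\<theta> \<otimes> b) = r \<ominus> \<ominus> (\<theta> \<otimes> b) \<otimes> r"
        using jacobson_radical_quasi_regular by blast
      have rr: "r = \<ominus> (\<theta> \<otimes> b) \<ominus> \<theta> \<otimes> b \<otimes> r"
      proof -
        have "r = (r \<ominus> \<ominus> (\<theta> \<otimes> b) \<otimes> r) \<ominus> \<theta> \<otimes> b \<otimes> r" using r \<theta>(3) bC by algebra
        then show ?thesis by (simp only: r_eq[symmetric])
      qed
      have gr: "g \<otimes> r = r"
      proof -
        have "g \<otimes> (\<ominus> (\<theta> \<otimes> b) \<ominus> \<theta> \<otimes> b \<otimes> r) = \<ominus> ((g \<otimes> \<theta>) \<otimes> b) \<ominus> (g \<otimes> \<theta>) \<otimes> b \<otimes> r"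
          using gC \<theta>(3) bC r by algebra
        then show ?thesis by (simp only: gt rr[symmetric])
      qed
      define U where "U = g \<oplus> r \<otimes> g"
      have UC: "U \<in> carrier R" using gC r by (simp add: U_def)
      have gU: "g \<otimes> U = U"
      proof -
        have "g \<otimes> U = g \<otimes> g \<oplus> (g \<otimes> r) \<otimes> g" unfolding U_def using gC r by algebra
        then show ?thesis by (simp only: gg gr U_def)
      qed
      have WU: "U \<oplus> \<theta> \<otimes> (b \<otimes> U) = g"
      proof -
        have "U \<oplus> \<theta> \<otimes> (b \<otimes> U) = g \<oplus> (r \<oplus> (\<theta> \<otimes> b \<oplus> \<theta> \<otimes> b \<otimes> r)) \<otimes> g"
          unfolding U_def using gC r \<theta>(3) bC by algebra
        moreover have "r \<oplus> (\<theta> \<otimes> b \<oplus> \<theta> \<otimes> b \<otimes> r) = \<zero>"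
        proof -
          have "(\<ominus> (\<theta> \<otimes> b) \<ominus> \<theta> \<otimes> b \<otimes> r) \<oplus> (\<theta> \<otimes> b \<oplus> \<theta> \<otimes> b \<otimes> r) = \<zero>"
            using r \<theta>(3) bC by algebra
          then show ?thesis by (simp only: rr[symmetric])
        qed
        ultimately show ?thesis using gC by simp
      qed
      have cpWU: "cp U k \<oplus> \<theta> \<otimes> finsum R (\<lambda>i. cp b i \<otimes> cp U (k + m - i)) (supp b) = cp g k" for k
      proof -
        have "cp (U \<oplus> \<theta> \<otimes> (b \<otimes> U)) k = cp U k \<oplus> \<theta> \<otimes> cp (b \<otimes> U) (k + m)"
          using UC bC \<theta>(3) cp_mult_homogeneous_left[OF _ \<theta>(1), of "b \<otimes> U"] by (simp add: cp_add)
        then show ?thesis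
          unfolding WU using cp_mult[OF bC UC finite_supp[OF bC] subset_refl] by simp
      qed
      have "U \<noteq> \<zero>" using WU g0 \<theta>(3) bC by auto
      then have "supp U \<noteq> {}" using UC eq_zero_if_cp by blast
      define t where "t = Max (supp U)"
      define s where "s = Min (supp U)"
      note finU = finite_supp[OF UC]
      have t: "cp U t \<noteq> \<zero>" "\<And>k. k > t \<Longrightarrow> cp U k = \<zero>"
        using Max_in[OF finU \<open>supp U \<noteq> {}\<close>] Max_ge[OF finU] by (fastforce simp: t_def)+
      have s: "cp U s \<noteq> \<zero>" "\<And>k. k < s \<Longrightarrow> cp U k = \<zero>"
        using Min_in[OF finU \<open>supp U \<noteq> {}\<close>] Min_le[OF finU] by (fastforce simp: s_def)+
      have "s \<le> t"
      proof (rule ccontr)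
        assume "\<not> s \<le> t"
        then have "cp U s = \<zero>" by (intro t(2)) simp
        then show False using s(1) by simp
      qed
      have "t = 0"
      proof (rule ccontr)
        assume "t \<noteq> 0"
        have "finsum R (\<lambda>i. cp b i \<otimes> cp U (t + m - i)) (supp b) = \<zero>"
        proof (intro add.finprod_one_eqI)
          fix i assume "i \<in> supp b"
          then have "cp U (t + m - i) = \<zero>" using b_le[of i] m_pos by (intro t(2)) simp
          then show "cp b i \<otimes> cp U (t + m - i) = \<zero>" using bC by simp
        qed
        then have "cp U t = cp g t" using cpWU[of t] UC \<theta>(3) by simp
        then show False using \<open>t \<noteq> 0\<close> t(1) cp_homogeneous[OF g, of t] by simp
      qed
      moreover have "s = 2 * m"
      proof (rule ccontr)
        assume "s \<noteq> 2 * m"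
        let ?f = "\<lambda>i. cp b i \<otimes> cp U (s - 2 * m + m - i)"
        have "finsum R ?f (supp b) = ?f (- m) \<oplus> finsum R ?f (supp b - {- m})"
          using m_in bC UC by (intro finsum_remove) auto
        also have "finsum R ?f (supp b - {- m}) = \<zero>"
        proof (intro add.finprod_one_eqI)
          fix i assume "i \<in> supp b - {- m}"
          then have "- m \<le> i" "i \<noteq> - m" using m_min[of i] by auto
          then have "cp U (s - 2 * m + m - i) = \<zero>" by (intro s(2)) simp
          then show "?f i = \<zero>" using bC by simp
        qed
        finally have "finsum R ?f (supp b) = \<theta> \<otimes> cp U s" using bC UC by (simp add: \<theta>_def)
        moreover have "cp U (s - 2 * m) = \<zero>" using m_pos by (intro s(2)) simp
        ultimately have "\<theta> \<otimes> (\<theta> \<otimes> cp U s) = \<zero>"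
          using cpWU[of "s - 2 * m"] \<open>s \<noteq> 2 * m\<close> cp_homogeneous[OF g, of "s - 2 * m"] \<theta>(3) UC by simp
        then have "z \<otimes> (z \<otimes> (\<theta> \<otimes> (\<theta> \<otimes> cp U s))) = \<zero>" using zC by simp
        moreover have "z \<otimes> (z \<otimes> (\<theta> \<otimes> (\<theta> \<otimes> cp U s))) = cp U s"
        proof -
          have "z \<otimes> (z \<otimes> (\<theta> \<otimes> (\<theta> \<otimes> cp U s))) = z \<otimes> ((z \<otimes> \<theta>) \<otimes> \<theta> \<otimes> cp U s)"
            using zC \<theta>(3) UC by (simp add: m_assoc)
          also have "\<dots> = (z \<otimes> \<theta>) \<otimes> cp U s"
            unfolding ztg gt using zC \<theta>(3) UC by (simp add: m_assoc[symmetric] ztg)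
          also have "\<dots> = cp (g \<otimes> U) s"
            unfolding ztg using cp_mult_homogeneous_left[OF UC g] by simp
          finally show ?thesis by (simp only: gU)
        qed
        ultimately show False using s(1) by simp
      qed
      ultimately show False using \<open>s \<le> t\<close> m_pos by simp
    qed
  qed
  then show ?thesis using J.zero_closed by blast
qed

end


section \<open>Tensor products\<close>

text \<open>A right module \<open>M\<close> and a left module \<open>N\<close>, with the subgroup \<open>K\<close> by which the free abelian group \<open>F\<close>
  on \<open>M \<times> N\<close> is factored to form the tensor product.\<close>

locale tensor_modules = M: right_module R M + N: left_module R N
  for R :: "('a, 'r) ring_scheme" and M :: "('a, 'm) module" and N :: "('a, 'n) module"
begin

abbreviation K where "K \<equiv> tensor_kernel R M N"
abbreviation F where "F \<equiv> free_Abelian_group (carrier M \<times> carrier N)"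

lemma relators_carrier: "tensor_relators R M N \<subseteq> carrier F"
proof -
  have diff: "a - b \<in> carrier F" if "a \<in> carrier F" "b \<in> carrier F" for a b
    using that keys_diff[of a b] by auto
  have one: "frag_of (x, y) \<in> carrier F" if "x \<in> carrier M" "y \<in> carrier N" for x y
    using that by simp
  show ?thesis
    unfolding tensor_relators_def
    by (auto simp del: carrier_free_Abelian_group_iff
        intro!: diff one M.smult_closed N.smult_closed)
qed

lemma subgroup_K: "subgroup K F"
  unfolding tensor_kernel_def by (rule group.generate_is_subgroup[OF _ relators_carrier]) simp

lemma K_keys: "z \<in> K \<Longrightarrow> Poly_Mapping.keys z \<subseteq> carrier M \<times> carrier N"
  using subsetD[OF subgroup.subset[OF subgroup_K]] by simp

lemma K_zero [simp]: "0 \<in> K"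
  using subgroup.one_closed[OF subgroup_K] by simp

lemma K_add: "x \<in> K \<Longrightarrow> y \<in> K \<Longrightarrow> x + y \<in> K"
  using subgroup.m_closed[OF subgroup_K, of x y] by simp

lemma K_uminus: "x \<in> K \<Longrightarrow> - x \<in> K"
  using subgroup.m_inv_closed[OF subgroup_K, of x] K_keys[of x] by simp

lemma K_diff: "x \<in> K \<Longrightarrow> y \<in> K \<Longrightarrow> x - y \<in> K"
  using K_add[of x "- y"] K_uminus[of y] by simp

lemma K_sum: "(\<And>i. i \<in> S \<Longrightarrow> f i \<in> K) \<Longrightarrow> sum f S \<in> K"
  by (induction S rule: infinite_finite_induct) (auto intro: K_add)

lemma K_relator: "z \<in> tensor_relators R M N \<Longrightarrow> z \<in> K"
  unfolding tensor_kernel_def by (rule generate.incl)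

lemma K_add_left:
  "\<lbrakk>x \<in> carrier M; x' \<in> carrier M; y \<in> carrier N\<rbrakk> \<Longrightarrow>
     frag_of (x \<oplus>\<^bsub>M\<^esub> x', y) - frag_of (x, y) - frag_of (x', y) \<in> K"
  by (rule K_relator) (auto simp: tensor_relators_def)

lemma K_add_right:
  "\<lbrakk>x \<in> carrier M; y \<in> carrier N; y' \<in> carrier N\<rbrakk> \<Longrightarrow>
     frag_of (x, y \<oplus>\<^bsub>N\<^esub> y') - frag_of (x, y) - frag_of (x, y') \<in> K"
  by (rule K_relator) (auto simp: tensor_relators_def)

lemma K_middle:
  "\<lbrakk>a \<in> carrier R; x \<in> carrier M; y \<in> carrier N\<rbrakk> \<Longrightarrow>
     frag_of (a \<odot>\<^bsub>M\<^esub> x, y) - frag_of (x, a \<odot>\<^bsub>N\<^esub> y) \<in> K"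
  by (rule K_relator) (auto simp: tensor_relators_def)

lemma K_zero_left: "y \<in> carrier N \<Longrightarrow> frag_of (\<zero>\<^bsub>M\<^esub>, y) \<in> K"
  using K_uminus[OF K_add_left[of "\<zero>\<^bsub>M\<^esub>" "\<zero>\<^bsub>M\<^esub>" y]] by simp

lemma K_zero_right: "x \<in> carrier M \<Longrightarrow> frag_of (x, \<zero>\<^bsub>N\<^esub>) \<in> K"
  using K_uminus[OF K_add_right[of x "\<zero>\<^bsub>N\<^esub>" "\<zero>\<^bsub>N\<^esub>"]] by simp

lemma K_diff_right:
  assumes "x \<in> carrier M" "y \<in> carrier N" "y' \<in> carrier N"
  shows "frag_of (x, y \<ominus>\<^bsub>N\<^esub> y') - (frag_of (x, y) - frag_of (x, y')) \<in> K"
proof -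
  have "(y \<ominus>\<^bsub>N\<^esub> y') \<oplus>\<^bsub>N\<^esub> y' = y"
    using assms by (simp add: N.M.minus_eq N.M.a_assoc N.M.l_neg)
  then show ?thesis
    using K_uminus[OF K_add_right[of x "y \<ominus>\<^bsub>N\<^esub> y'" y']] assms by (simp add: algebra_simps)
qed

lemma K_finsum_left:
  assumes "finite S" "\<And>i. i \<in> S \<Longrightarrow> g i \<in> carrier M" "y \<in> carrier N"
  shows "frag_of (finsum M g S, y) - (\<Sum>i\<in>S. frag_of (g i, y)) \<in> K"
  using assms(1,2)
proof (induction S rule: finite_induct)
  case empty
  then show ?case using assms(3) by (simp add: K_zero_left)
next
  case (insert i S)
  then have S: "g \<in> S \<rightarrow> carrier M" "finsum M g S \<in> carrier M" by (auto intro: M.M.finsum_closed)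
  have "frag_of (g i \<oplus>\<^bsub>M\<^esub> finsum M g S, y) - frag_of (g i, y) - frag_of (finsum M g S, y) \<in> K"
    using insert.prems S assms(3) by (intro K_add_left) auto
  from K_add[OF this insert.IH] show ?case
    using insert S by (simp add: algebra_simps)
qed

end

text \<open>
  A map between tensor products is injective if only elements of the one kernel are mapped into the
  other.
\<close>

lemma inj_on_tensor_map:
  assumes "tensor_modules R M N" "tensor_modules R M' N'"
    and fg: "f \<in> carrier M \<rightarrow> carrier M'" "g \<in> carrier N \<rightarrow> carrier N'"
    and reflects: "\<And>z. \<lbrakk>Poly_Mapping.keys z \<subseteq> carrier M \<times> carrier N;
       frag_extend (\<lambda>(x, y). frag_of (f x, g y)) z \<in> tensor_kernel R M' N'\<rbrakk> \<Longrightarrow> z \<in> tensor_kernel R M N"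
  shows "inj_on (tensor_map R M' N' f g) (carrier (tensor_product R M N))"
proof (rule inj_onI)
  interpret T: tensor_modules R M N by fact
  interpret T': tensor_modules R M' N' by fact
  let ?ext = "frag_extend (\<lambda>(x, y). frag_of (f x, g y))"
  fix C C' assume C: "C \<in> carrier (tensor_product R M N)" "C' \<in> carrier (tensor_product R M N)"
    and eq: "tensor_map R M' N' f g C = tensor_map R M' N' f g C'"
  obtain c where c: "c \<in> carrier T.F" "C = T.K #>\<^bsub>T.F\<^esub> c"
    using C(1) by (auto simp: tensor_product_def FactGroup_def RCOSETS_def)
  obtain c' where c': "c' \<in> carrier T.F" "C' = T.K #>\<^bsub>T.F\<^esub> c'"
    using C(2) by (auto simp: tensor_product_def FactGroup_def RCOSETS_def)
  have "c \<in> C" unfolding c(2) r_coset_def using T.K_zero by force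
  moreover have "?ext c \<in> T'.K #>\<^bsub>T'.F\<^esub> ?ext c" unfolding r_coset_def using T'.K_zero by force
  ultimately have "?ext c \<in> tensor_map R M' N' f g C" unfolding tensor_map_def by blast
  then obtain d where d: "d \<in> C'" "?ext c \<in> T'.K #>\<^bsub>T'.F\<^esub> ?ext d"
    unfolding eq unfolding tensor_map_def by blast
  from d(1) obtain k where k: "k \<in> T.K" "d = k + c'" unfolding c'(2) r_coset_def by auto
  from d(2) obtain l where l: "l \<in> T'.K" "?ext c = l + ?ext d" unfolding r_coset_def by auto
  have "Poly_Mapping.keys d \<subseteq> carrier M \<times> carrier N"
    using k T.K_keys[OF k(1)] c'(1) keys_add[of k c'] by auto
  then have "Poly_Mapping.keys (c - d) \<subseteq> carrier M \<times> carrier N"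
    using c(1) keys_diff[of c d] by auto
  moreover have "?ext (c - d) \<in> T'.K" using l by (simp add: frag_extend_diff)
  ultimately have "c - d \<in> T.K" by (rule reflects)
  then have "(c - d) + k \<in> T.K" using k(1) by (rule T.K_add)
  then have cc': "c - c' \<in> T.K" using k(2) by simp
  have "h \<in> C'" if "h \<in> C" for h
  proof -
    obtain u where "u \<in> T.K" "h = u + c" using \<open>h \<in> C\<close> unfolding c(2) r_coset_def by auto
    then show ?thesis
      using T.K_add[OF _ cc', of u] unfolding c'(2) r_coset_def by (auto intro!: bexI[of _ "u + (c - c')"])
  qed
  moreover have "h \<in> C" if "h \<in> C'" for h
  proof -
    obtain u where "u \<in> T.K" "h = u + c'" using \<open>h \<in> C'\<close> unfolding c'(2) r_coset_def by auto
    then show ?thesis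
      using T.K_diff[OF _ cc', of u] unfolding c(2) r_coset_def by (auto intro!: bexI[of _ "u - (c - c')"])
  qed
  ultimately show "C = C'" by blast
qed

text \<open>Exchanging the two factors identifies tensor products over a ring and over its opposite.\<close>

definition frag_swap :: "('m \<times> 'n \<Rightarrow>\<^sub>0 int) \<Rightarrow> ('n \<times> 'm \<Rightarrow>\<^sub>0 int)" where
  "frag_swap = frag_extend (\<lambda>(x, y). frag_of (y, x))"

lemma frag_swap_simps [simp]:
  "frag_swap (a + b) = frag_swap a + frag_swap b"
  "frag_swap (a - b) = frag_swap a - frag_swap b"
  "frag_swap (- a) = - frag_swap a"
  "frag_swap (frag_of (x, y)) = frag_of (y, x)"
  "frag_swap 0 = 0"
  by (simp_all add: frag_swap_def frag_extend_add frag_extend_diff frag_extend_minus)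

lemma keys_frag_swap: "Poly_Mapping.keys z \<subseteq> U \<times> V \<Longrightarrow> Poly_Mapping.keys (frag_swap z) \<subseteq> V \<times> U"
  using keys_frag_extend[of "\<lambda>(x, y). frag_of (y, x)" z] by (fastforce simp: frag_swap_def keys_frag_of)

lemma frag_swap_swap [simp]: "frag_swap (frag_swap z) = z"
proof -
  have "frag_swap (frag_swap z) = frag_extend frag_of z"
  proof -
    have eq: "frag_swap = frag_extend (frag_of \<circ> prod.swap)"
      unfolding frag_swap_def by (intro arg_cong[where f = frag_extend]) auto
    have "frag_swap (frag_swap z) = frag_extend ((frag_of \<circ> prod.swap) \<circ> prod.swap) z"
      unfolding eq by (rule frag_extend_compose)
    then show ?thesis by (simp add: comp_assoc)
  qed
  then show ?thesis by (simp add: frag_expansion[symmetric])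
qed

lemma frag_swap_tensor_kernel:
  assumes "tensor_modules R N M" "z \<in> tensor_kernel R N M"
  shows "frag_swap z \<in> tensor_kernel (opposite_ring R) M N"
proof -
  interpret T: tensor_modules R N M by fact
  have "right_module (opposite_ring R) M" "left_module (opposite_ring R) N"
    by (simp_all add: T.N.left_module_axioms T.M.right_module_axioms)
  then interpret T': tensor_modules "opposite_ring R" M N by (rule tensor_modules.intro)
  have rel: "frag_swap z \<in> T'.K" if "z \<in> tensor_relators R N M" for z
    using that unfolding tensor_relators_def
  proof (elim UnE CollectE exE conjE)
    fix a x y assume "z = frag_of (a \<odot>\<^bsub>N\<^esub> x, y) - frag_of (x, a \<odot>\<^bsub>M\<^esub> y)"
      "a \<in> carrier R" "x \<in> carrier N" "y \<in> carrier M"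
    then show ?thesis using T'.K_uminus[OF T'.K_middle[of a y x]] by simp
  qed (auto intro: T'.K_add_left T'.K_add_right)
  from assms(2) have "z \<in> generate T.F (tensor_relators R N M)" by (simp add: tensor_kernel_def)
  then show ?thesis
  proof (induction rule: generate.induct)
    case (inv h)
    then have "Poly_Mapping.keys h \<subseteq> carrier N \<times> carrier M" using subsetD[OF T.relators_carrier] by simp
    then show ?case using rel[OF inv] by (simp add: T'.K_uminus)
  qed (auto simp: rel T'.K_add)
qed


section \<open>Flatness of graded modules\<close>

locale graded_unital_module = graded_regular_ring R G + Mod: unital_right_module R M + Md: graded_group M D
  for R :: "('a, 'r) ring_scheme" (structure) and G and M :: "('a, 'm) module" and D +
  assumes D_smult: "\<lbrakk>a \<in> G i; x \<in> D j\<rbrakk> \<Longrightarrow> a \<odot>\<^bsub>M\<^esub> x \<in> D (j + i)"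
begin

lemma smult_cp:
  assumes "x \<in> D j" "a \<in> carrier R"
  shows "Md.cp (a \<odot>\<^bsub>M\<^esub> x) k = cp a (k - j) \<odot>\<^bsub>M\<^esub> x"
  using assms(2)
proof (induction a rule: homogeneous_induct)
  case (homogeneous i a)
  have "\<zero> \<odot>\<^bsub>M\<^esub> x = \<zero>\<^bsub>M\<^esub>"
    using Mod.smult_l_distr[of \<zero> \<zero> x] Mod.smult_closed[of \<zero> x] assms(1) by simp
  then show ?case
    using D_smult[OF homogeneous assms(1)] homogeneous assms(1)
    by (simp add: cp_homogeneous Md.cp_homogeneous)
next
  case (add b c)
  then show ?case
    using assms(1) by (simp add: cp_add Mod.smult_l_distr Mod.smult_closed Md.cp_add)
qed

lemma zero_smult [simp]: "x \<in> carrier M \<Longrightarrow> \<zero> \<odot>\<^bsub>M\<^esub> x = \<zero>\<^bsub>M\<^esub>"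
  using Mod.smult_l_distr[of \<zero> \<zero> x] Mod.smult_closed[of \<zero> x] by simp

lemma smult_zero [simp]: "a \<in> carrier R \<Longrightarrow> a \<odot>\<^bsub>M\<^esub> \<zero>\<^bsub>M\<^esub> = \<zero>\<^bsub>M\<^esub>"
  using Mod.smult_r_distr[of a "\<zero>\<^bsub>M\<^esub>" "\<zero>\<^bsub>M\<^esub>"] Mod.smult_closed[of a "\<zero>\<^bsub>M\<^esub>"] by simp

lemma minus_smult: "a \<in> carrier R \<Longrightarrow> x \<in> carrier M \<Longrightarrow> \<ominus> a \<odot>\<^bsub>M\<^esub> x = \<ominus>\<^bsub>M\<^esub> (a \<odot>\<^bsub>M\<^esub> x)"
  using Mod.smult_l_distr[of "\<ominus> a" a x] Mod.smult_closed
  by (intro Mod.M.minus_equality[symmetric]) (simp_all add: l_neg)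

text \<open>
  Finitely supported families of ring elements, indexed by homogeneous elements of \<open>M\<close> together
  with a degree, form the free graded right module on the homogeneous elements of \<open>M\<close>; \<open>famsum\<close> is
  its projection onto \<open>M\<close>, and \<open>hsplit\<close> is a section that decomposes elements into components.
\<close>

definition vec :: "(int \<times> 'm \<Rightarrow> 'a) \<Rightarrow> bool" where
  "vec n \<longleftrightarrow> (\<forall>p. n p \<in> carrier R) \<and> finite {p. n p \<noteq> \<zero>} \<and> (\<forall>p. n p \<noteq> \<zero> \<longrightarrow> snd p \<in> D (fst p))"

definition famsum :: "(int \<times> 'm \<Rightarrow> 'a) \<Rightarrow> 'm" where
  "famsum n = finsum M (\<lambda>p. n p \<odot>\<^bsub>M\<^esub> snd p) {p. n p \<noteq> \<zero>}"

definition hsplit :: "'m \<Rightarrow> int \<times> 'm \<Rightarrow> 'a" where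
  "hsplit m p = (if snd p \<noteq> \<zero>\<^bsub>M\<^esub> \<and> Md.cp m (fst p) = snd p then \<one> else \<zero>)"

definition idx :: "(int \<times> 'm) set" where
  "idx = {p. snd p \<in> D (fst p)}"

lemma idx_carrier: "p \<in> idx \<Longrightarrow> snd p \<in> carrier M"
  by (auto simp: idx_def)

lemma vec_carrier: "vec n \<Longrightarrow> n p \<in> carrier R"
  unfolding vec_def by blast

lemma vec_idx: "vec n \<Longrightarrow> n p \<noteq> \<zero> \<Longrightarrow> p \<in> idx"
  unfolding vec_def idx_def by blast

lemma famsum_superset:
  assumes "vec n" "finite S" "S \<subseteq> idx" "{p. n p \<noteq> \<zero>} \<subseteq> S"
  shows "famsum n = finsum M (\<lambda>p. n p \<odot>\<^bsub>M\<^esub> snd p) S"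
  unfolding famsum_def
proof (rule Mod.M.finsum_mono_neutral[OF assms(2,4)])
  show "(\<lambda>p. n p \<odot>\<^bsub>M\<^esub> snd p) \<in> {p. n p \<noteq> \<zero>} \<rightarrow> carrier M"
    using assms(1) by (intro funcsetI Mod.smult_closed) (auto intro: idx_carrier vec_idx vec_carrier)
  show "n p \<odot>\<^bsub>M\<^esub> snd p = \<zero>\<^bsub>M\<^esub>" if "p \<in> S - {p. n p \<noteq> \<zero>}" for p
    using that assms(3) idx_carrier[of p] by auto
qed

lemma vecI:
  assumes "\<And>p. n p \<in> carrier R" "finite S" "S \<subseteq> idx" "{p. n p \<noteq> \<zero>} \<subseteq> S"
  shows "vec n"
  using assms finite_subset[OF assms(4,2)] by (auto simp: vec_def idx_def)

lemma vec_supp_idx: "vec n \<Longrightarrow> {p. n p \<noteq> \<zero>} \<subseteq> idx"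
  by (auto simp: vec_def idx_def)

lemma
  assumes "vec n" "vec n'"
  shows vec_minus: "vec (\<lambda>p. n p \<ominus> n' p)"
    and famsum_minus: "famsum (\<lambda>p. n p \<ominus> n' p) = famsum n \<ominus>\<^bsub>M\<^esub> famsum n'"
proof -
  let ?S = "{p. n p \<noteq> \<zero>} \<union> {p. n' p \<noteq> \<zero>}"
  have S: "finite ?S" "?S \<subseteq> idx" using assms vec_supp_idx by (auto simp: vec_def)
  have sub: "{p. n p \<ominus> n' p \<noteq> \<zero>} \<subseteq> ?S" using assms by (auto simp: vec_def minus_eq minus_zero_group)
  have C: "\<And>p. n p \<in> carrier R" "\<And>p. n' p \<in> carrier R" using assms by (auto simp: vec_def)
  show v: "vec (\<lambda>p. n p \<ominus> n' p)"
    using C by (intro vecI[OF _ S sub]) simp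
  have "famsum (\<lambda>p. n p \<ominus> n' p) = finsum M (\<lambda>p. (n p \<ominus> n' p) \<odot>\<^bsub>M\<^esub> snd p) ?S"
    by (rule famsum_superset[OF v S sub])
  also have "\<dots> = finsum M (\<lambda>p. n p \<odot>\<^bsub>M\<^esub> snd p \<oplus>\<^bsub>M\<^esub> \<ominus>\<^bsub>M\<^esub> (n' p \<odot>\<^bsub>M\<^esub> snd p)) ?S"
  proof (intro Mod.M.finsum_cong' funcsetI refl)
    fix p assume "p \<in> ?S"
    then have p: "snd p \<in> carrier M" using S(2) idx_carrier by blast
    then show "n p \<odot>\<^bsub>M\<^esub> snd p \<oplus>\<^bsub>M\<^esub> \<ominus>\<^bsub>M\<^esub> (n' p \<odot>\<^bsub>M\<^esub> snd p) \<in> carrier M"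
      using C by (simp add: Mod.smult_closed)
    show "(n p \<ominus> n' p) \<odot>\<^bsub>M\<^esub> snd p = n p \<odot>\<^bsub>M\<^esub> snd p \<oplus>\<^bsub>M\<^esub> \<ominus>\<^bsub>M\<^esub> (n' p \<odot>\<^bsub>M\<^esub> snd p)"
      using C p by (simp add: minus_eq Mod.smult_l_distr minus_smult)
  qed
  also have "\<dots> = finsum M (\<lambda>p. n p \<odot>\<^bsub>M\<^esub> snd p) ?S \<oplus>\<^bsub>M\<^esub> finsum M (\<lambda>p. \<ominus>\<^bsub>M\<^esub> (n' p \<odot>\<^bsub>M\<^esub> snd p)) ?S"
    using C S(2) idx_carrier
    by (intro Mod.M.finsum_addf funcsetI Mod.M.a_inv_closed Mod.smult_closed) blast+
  also have "\<dots> = famsum n \<ominus>\<^bsub>M\<^esub> famsum n'"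
    using C S idx_carrier famsum_superset[OF assms(1) S] famsum_superset[OF assms(2) S]
    by (subst Mod.M.finsum_minus) (auto intro!: Mod.smult_closed simp: Mod.M.minus_eq)
  finally show "famsum (\<lambda>p. n p \<ominus> n' p) = famsum n \<ominus>\<^bsub>M\<^esub> famsum n'" .
qed

lemma finsum_smult:
  "\<lbrakk>finite S; a \<in> carrier R; g \<in> S \<rightarrow> carrier M\<rbrakk> \<Longrightarrow>
     a \<odot>\<^bsub>M\<^esub> finsum M g S = finsum M (\<lambda>p. a \<odot>\<^bsub>M\<^esub> g p) S"
proof (induction S rule: finite_induct)
  case (insert i S)
  then show ?case
    by (simp add: Mod.smult_r_distr Mod.smult_closed Pi_def)
qed simp

lemma
  assumes "vec n" "a \<in> carrier R"
  shows vec_mult: "vec (\<lambda>p. n p \<otimes> a)"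
    and famsum_mult: "famsum (\<lambda>p. n p \<otimes> a) = a \<odot>\<^bsub>M\<^esub> famsum n"
proof -
  let ?S = "{p. n p \<noteq> \<zero>}"
  have S: "finite ?S" "?S \<subseteq> idx" using assms vec_supp_idx by (auto simp: vec_def)
  have sub: "{p. n p \<otimes> a \<noteq> \<zero>} \<subseteq> ?S" using assms by auto
  have C: "\<And>p. n p \<in> carrier R" using assms by (auto simp: vec_def)
  show v: "vec (\<lambda>p. n p \<otimes> a)"
    using C assms(2) by (intro vecI[OF _ S sub]) simp
  have "famsum (\<lambda>p. n p \<otimes> a) = finsum M (\<lambda>p. (n p \<otimes> a) \<odot>\<^bsub>M\<^esub> snd p) ?S"
    by (rule famsum_superset[OF v S sub])
  also have "\<dots> = finsum M (\<lambda>p. a \<odot>\<^bsub>M\<^esub> (n p \<odot>\<^bsub>M\<^esub> snd p)) ?S"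
    using C S(2) idx_carrier assms(2)
    by (intro Mod.M.finsum_cong') (auto simp: Mod.smult_assoc intro!: Mod.smult_closed)
  also have "\<dots> = a \<odot>\<^bsub>M\<^esub> famsum n"
    unfolding famsum_def using C S idx_carrier assms(2)
    by (intro finsum_smult[symmetric]) (auto intro!: Mod.smult_closed)
  finally show "famsum (\<lambda>p. n p \<otimes> a) = a \<odot>\<^bsub>M\<^esub> famsum n" .
qed

text \<open>The set where \<^term>\<open>hsplit m\<close> is nonzero, if the ring is not trivial.\<close>

definition split_supp :: "'m \<Rightarrow> (int \<times> 'm) set" where
  "split_supp m = (\<lambda>i. (i, Md.cp m i)) ` Md.supp m"

lemma split_eq: "m \<in> carrier M \<Longrightarrow> hsplit m p = (if p \<in> split_supp m then \<one> else \<zero>)"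
  by (cases p) (auto simp: hsplit_def split_supp_def)

lemma
  assumes m: "m \<in> carrier M"
  shows finite_split_supp: "finite (split_supp m)"
    and split_supp_idx: "split_supp m \<subseteq> idx"
    and sum_split_supp: "finsum M snd (split_supp m) = m"
    and vec_split: "vec (hsplit m)"
    and famsum_split: "famsum (hsplit m) = m"
proof -
  show fin: "finite (split_supp m)" and sub: "split_supp m \<subseteq> idx"
    using m by (auto simp: split_supp_def idx_def)
  have "finsum M snd (split_supp m) = finsum M (\<lambda>i. snd (i, Md.cp m i)) (Md.supp m)"
    unfolding split_supp_def using m by (intro Mod.M.finsum_reindex) (auto simp: inj_on_def)
  then show sum: "finsum M snd (split_supp m) = m" using m by (simp add: Md.sum_cp_superset)
  have supp: "{p. hsplit m p \<noteq> \<zero>} \<subseteq> split_supp m" by (auto simp: split_eq[OF m])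
  show v: "vec (hsplit m)"
    by (rule vecI[OF _ fin sub supp]) (simp add: hsplit_def)
  have "famsum (hsplit m) = finsum M (\<lambda>p. hsplit m p \<odot>\<^bsub>M\<^esub> snd p) (split_supp m)"
    by (rule famsum_superset[OF v fin sub supp])
  also have "\<dots> = finsum M snd (split_supp m)"
    using sub idx_carrier by (intro Mod.M.finsum_cong') (auto simp: split_eq[OF m] Mod.smult_one)
  finally show "famsum (hsplit m) = m" by (simp only: sum)
qed

text \<open>Homogeneous components of a family.\<close>

definition hvec :: "int \<Rightarrow> (int \<times> 'm \<Rightarrow> 'a) \<Rightarrow> int \<times> 'm \<Rightarrow> 'a" where
  "hvec d n p = cp (n p) (d - fst p)"

lemma
  assumes "vec n"
  shows vec_hvec: "vec (hvec d n)"
    and famsum_hvec: "famsum (hvec d n) = Md.cp (famsum n) d"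
proof -
  let ?S = "{p. n p \<noteq> \<zero>}"
  have S: "finite ?S" "?S \<subseteq> idx" using assms vec_supp_idx by (auto simp: vec_def)
  have sub: "{p. hvec d n p \<noteq> \<zero>} \<subseteq> ?S" by (auto simp: hvec_def)
  have C: "\<And>p. n p \<in> carrier R" using assms by (auto simp: vec_def)
  show v: "vec (hvec d n)"
    using C by (intro vecI[OF _ S sub]) (simp add: hvec_def)
  have "famsum (hvec d n) = finsum M (\<lambda>p. hvec d n p \<odot>\<^bsub>M\<^esub> snd p) ?S"
    by (rule famsum_superset[OF v S sub])
  also have "\<dots> = finsum M (\<lambda>p. Md.cp (n p \<odot>\<^bsub>M\<^esub> snd p) d) ?S"
    using C S(2) idx_carrier
    by (intro Mod.M.finsum_cong') (auto simp: hvec_def smult_cp idx_def intro!: Md.cp_carrier Mod.smult_closed)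
  also have "\<dots> = Md.cp (famsum n) d"
    unfolding famsum_def using C S idx_carrier
    by (intro Md.cp_finsum[symmetric]) (auto intro!: Mod.smult_closed)
  finally show "famsum (hvec d n) = Md.cp (famsum n) d" .
qed

end


text \<open>The tensor product of the graded right module \<open>M\<close> with a left module \<open>N\<close>.\<close>

locale flat_test = graded_unital_module R G M D + N: unital_left_module R N
  for R :: "('a, 'r) ring_scheme" (structure) and G and M :: "('a, 'm) module" and D
    and N :: "('a, 'n) module"
begin

sublocale tensor_modules R M N ..

lemma N_zero_smult [simp]: "x \<in> carrier N \<Longrightarrow> \<zero> \<odot>\<^bsub>N\<^esub> x = \<zero>\<^bsub>N\<^esub>"
  using N.smult_l_distr[of \<zero> \<zero> x] N.smult_closed[of \<zero> x] by simp

lemma N_smult_zero [simp]: "a \<in> carrier R \<Longrightarrow> a \<odot>\<^bsub>N\<^esub> \<zero>\<^bsub>N\<^esub> = \<zero>\<^bsub>N\<^esub>"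
  using N.smult_r_distr[of a "\<zero>\<^bsub>N\<^esub>" "\<zero>\<^bsub>N\<^esub>"] N.smult_closed[of a "\<zero>\<^bsub>N\<^esub>"] by simp

lemma N_minus_smult:
  "a \<in> carrier R \<Longrightarrow> x \<in> carrier N \<Longrightarrow> \<ominus> a \<odot>\<^bsub>N\<^esub> x = \<ominus>\<^bsub>N\<^esub> (a \<odot>\<^bsub>N\<^esub> x)"
  using N.smult_l_distr[of "\<ominus> a" a x] N.smult_closed
  by (intro N.M.minus_equality[symmetric]) (simp_all add: l_neg)

lemma N_smult_minus:
  "a \<in> carrier R \<Longrightarrow> x \<in> carrier N \<Longrightarrow> a \<odot>\<^bsub>N\<^esub> \<ominus>\<^bsub>N\<^esub> x = \<ominus>\<^bsub>N\<^esub> (a \<odot>\<^bsub>N\<^esub> x)"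
  using N.smult_r_distr[of a "\<ominus>\<^bsub>N\<^esub> x" x] N.smult_closed
  by (intro N.M.minus_equality[symmetric]) (simp_all add: N.M.l_neg)

text \<open>
  The coordinates in \<open>N\<close> of an element of the free abelian group on \<open>M \<times> N\<close>, obtained by splitting
  the elements of \<open>M\<close> into homogeneous components.
\<close>

definition coord :: "int \<times> 'm \<Rightarrow> ('m \<times> 'n \<Rightarrow>\<^sub>0 int) \<Rightarrow> 'n" where
  "coord p = (SOME h. h \<in> hom F (add_monoid N) \<and>
     (\<forall>x\<in>carrier M \<times> carrier N. h (frag_of x) = hsplit (fst x) p \<odot>\<^bsub>N\<^esub> snd x))"

lemma hsplit_closed [simp]: "hsplit m p \<in> carrier R"
  by (simp add: hsplit_def)

lemma coord_spec:
  "coord p \<in> hom F (add_monoid N) \<and>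
     (\<forall>x\<in>carrier M \<times> carrier N. coord p (frag_of x) = hsplit (fst x) p \<odot>\<^bsub>N\<^esub> snd x)"
proof -
  let ?f = "\<lambda>x. hsplit (fst x) p \<odot>\<^bsub>N\<^esub> snd x"
  have sub: "?f ` (carrier M \<times> carrier N) \<subseteq> carrier (add_monoid N)"
    by (auto intro!: N.smult_closed)
  have "\<exists>h. h \<in> hom F (add_monoid N) \<and> (\<forall>x\<in>carrier M \<times> carrier N. h (frag_of x) = ?f x)"
    by (rule comm_group.free_Abelian_group_universal[OF N.M.a_comm_group sub]) blast
  then show ?thesis unfolding coord_def by (rule someI_ex)
qed

lemma coord_frag_of [simp]:
  "\<lbrakk>x \<in> carrier M; y \<in> carrier N\<rbrakk> \<Longrightarrow> coord p (frag_of (x, y)) = hsplit x p \<odot>\<^bsub>N\<^esub> y"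
  using coord_spec[of p] by auto

lemma group_hom_coord: "group_hom F (add_monoid N) (coord p)"
  using coord_spec[of p] N.M.a_group by (simp add: group_hom_def group_hom_axioms_def)

lemma coord_closed: "z \<in> carrier F \<Longrightarrow> coord p z \<in> carrier N"
  using group_hom.hom_closed[OF group_hom_coord, of z p] by simp

lemma coord_zero [simp]: "coord p 0 = \<zero>\<^bsub>N\<^esub>"
  using group_hom.hom_one[OF group_hom_coord, of p] by simp

lemma coord_add:
  "\<lbrakk>z \<in> carrier F; z' \<in> carrier F\<rbrakk> \<Longrightarrow> coord p (z + z') = coord p z \<oplus>\<^bsub>N\<^esub> coord p z'"
  using group_hom.hom_mult[OF group_hom_coord, of z z' p] by simp

lemma coord_uminus: "z \<in> carrier F \<Longrightarrow> coord p (- z) = \<ominus>\<^bsub>N\<^esub> coord p z"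
  using group_hom.hom_inv[OF group_hom_coord, of z p] by (simp add: a_inv_def)

lemma F_uminus: "z \<in> carrier F \<Longrightarrow> - z \<in> carrier F" by simp

lemma F_diff: "z \<in> carrier F \<Longrightarrow> z' \<in> carrier F \<Longrightarrow> z - z' \<in> carrier F"
  using keys_diff[of z z'] by auto

lemma coord_diff:
  "\<lbrakk>z \<in> carrier F; z' \<in> carrier F\<rbrakk> \<Longrightarrow> coord p (z - z') = coord p z \<ominus>\<^bsub>N\<^esub> coord p z'"
  using coord_add[of z "- z'" p] F_uminus[of z'] coord_uminus[of z' p]
  by (simp add: N.M.minus_eq del: carrier_free_Abelian_group_iff)

text \<open>Sums of families of the form \<open>p \<mapsto> n(p)\<cdot>q\<close>.\<close>

primrec comb :: "((int \<times> 'm \<Rightarrow> 'a) \<times> 'n) list \<Rightarrow> int \<times> 'm \<Rightarrow> 'n" where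
  "comb [] p = \<zero>\<^bsub>N\<^esub>"
| "comb (x # L) p = fst x p \<odot>\<^bsub>N\<^esub> snd x \<oplus>\<^bsub>N\<^esub> comb L p"

text \<open>Each such family is a relation between homogeneous elements of \<open>M\<close>.\<close>

definition relations :: "((int \<times> 'm \<Rightarrow> 'a) \<times> 'n) list \<Rightarrow> bool" where
  "relations L \<longleftrightarrow> (\<forall>x\<in>set L. vec (fst x) \<and> famsum (fst x) = \<zero>\<^bsub>M\<^esub> \<and> snd x \<in> carrier N)"

definition homogeneous_relations :: "((int \<times> 'm \<Rightarrow> 'a) \<times> 'n) list \<Rightarrow> bool" where
  "homogeneous_relations L \<longleftrightarrow>
     relations L \<and> (\<forall>x\<in>set L. \<exists>d. \<forall>p. fst x p \<in> G (d - fst p))"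

lemma comb_closed: "relations L \<Longrightarrow> comb L p \<in> carrier N"
  by (induction L) (auto simp: relations_def vec_carrier intro!: N.smult_closed)

lemma comb_append:
  "relations L \<Longrightarrow> relations L' \<Longrightarrow> comb (L @ L') p = comb L p \<oplus>\<^bsub>N\<^esub> comb L' p"
  by (induction L)
    (auto simp: relations_def vec_carrier N.smult_closed comb_closed N.M.a_assoc)

lemma comb_uminus:
  "relations L \<Longrightarrow> comb (map (\<lambda>x. (fst x, \<ominus>\<^bsub>N\<^esub> snd x)) L) p = \<ominus>\<^bsub>N\<^esub> comb L p"
proof (induction L)
  case (Cons x L)
  then have "relations L" "snd x \<in> carrier N" "fst x p \<in> carrier R"
    by (auto simp: relations_def vec_carrier)
  then show ?case
    using Cons.IH by (simp add: N_smult_minus N.smult_closed comb_closed N.M.minus_add)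
qed (simp add: N.M.minus_zero_group)

text \<open>Elements of the kernel have coordinates that come from relations.\<close>

lemma coord_kernel:
  assumes "z \<in> K"
  shows "\<exists>L. relations L \<and> (\<forall>p. coord p z = comb L p)"
proof -
  have one: "\<exists>L. relations L \<and> (\<forall>p. coord p z = comb L p)"
    if "vec n" "famsum n = \<zero>\<^bsub>M\<^esub>" "q \<in> carrier N" "\<And>p. coord p z = n p \<odot>\<^bsub>N\<^esub> q" for n q z
    using that by (intro exI[of _ "[(n, q)]"]) (simp add: relations_def vec_carrier N.smult_closed)
  have Fc: "frag_of (x, y) \<in> carrier F" if "x \<in> carrier M" "y \<in> carrier N" for x y
    using that by simp
  have rel: "\<exists>L. relations L \<and> (\<forall>p. coord p z = comb L p)" if "z \<in> tensor_relators R M N" for z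
    using that unfolding tensor_relators_def
  proof (elim UnE CollectE exE conjE)
    fix x x' y assume z: "z = frag_of (x \<oplus>\<^bsub>M\<^esub> x', y) - frag_of (x, y) - frag_of (x', y)"
      and C: "x \<in> carrier M" "x' \<in> carrier M" "y \<in> carrier N"
    let ?n = "\<lambda>p. hsplit (x \<oplus>\<^bsub>M\<^esub> x') p \<ominus> hsplit x p \<ominus> hsplit x' p"
    have "vec ?n" using C by (intro vec_minus vec_split) auto
    moreover have "famsum ?n = \<zero>\<^bsub>M\<^esub>"
      using C by (simp add: famsum_minus vec_minus vec_split famsum_split Mod.M.minus_eq Mod.M.a_ac
          Mod.M.r_neg Mod.M.r_neg2)
    moreover have "coord p z = ?n p \<odot>\<^bsub>N\<^esub> y" for p
    proof -
      have "coord p z = hsplit (x \<oplus>\<^bsub>M\<^esub> x') p \<odot>\<^bsub>N\<^esub> y \<ominus>\<^bsub>N\<^esub> hsplit x p \<odot>\<^bsub>N\<^esub> y \<ominus>\<^bsub>N\<^esub> hsplit x' p \<odot>\<^bsub>N\<^esub> y"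
        unfolding z using C by (simp add: coord_diff F_diff Fc del: carrier_free_Abelian_group_iff)
      then show ?thesis using C by (simp add: minus_eq N.M.minus_eq N.smult_l_distr N_minus_smult)
    qed
    ultimately show ?thesis using C by (intro one)
  next
    fix x y y' assume z: "z = frag_of (x, y \<oplus>\<^bsub>N\<^esub> y') - frag_of (x, y) - frag_of (x, y')"
      and C: "x \<in> carrier M" "y \<in> carrier N" "y' \<in> carrier N"
    have "coord p z = \<zero>\<^bsub>N\<^esub>" for p
    proof -
      have "coord p z = hsplit x p \<odot>\<^bsub>N\<^esub> (y \<oplus>\<^bsub>N\<^esub> y') \<ominus>\<^bsub>N\<^esub> hsplit x p \<odot>\<^bsub>N\<^esub> y \<ominus>\<^bsub>N\<^esub> hsplit x p \<odot>\<^bsub>N\<^esub> y'"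
        unfolding z using C by (simp add: coord_diff F_diff Fc del: carrier_free_Abelian_group_iff)
      then show ?thesis
        using C by (simp add: N.M.minus_eq N.smult_r_distr N.smult_closed N.M.a_ac N.M.r_neg N.M.r_neg2)
    qed
    then show ?thesis by (intro exI[of _ "[]"]) (simp add: relations_def)
  next
    fix a x y assume z: "z = frag_of (a \<odot>\<^bsub>M\<^esub> x, y) - frag_of (x, a \<odot>\<^bsub>N\<^esub> y)"
      and C: "a \<in> carrier R" "x \<in> carrier M" "y \<in> carrier N"
    have C': "a \<odot>\<^bsub>M\<^esub> x \<in> carrier M" "a \<odot>\<^bsub>N\<^esub> y \<in> carrier N"
      using C by (simp_all add: Mod.smult_closed N.smult_closed)
    let ?n = "\<lambda>p. hsplit (a \<odot>\<^bsub>M\<^esub> x) p \<ominus> hsplit x p \<otimes> a"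
    have "vec ?n" using C C' by (intro vec_minus vec_split vec_mult) auto
    moreover have "famsum ?n = \<zero>\<^bsub>M\<^esub>"
      using C C' by (simp add: famsum_minus vec_mult vec_split famsum_mult famsum_split Mod.M.minus_eq
          Mod.M.r_neg)
    moreover have "coord p z = ?n p \<odot>\<^bsub>N\<^esub> y" for p
    proof -
      have "coord p z = hsplit (a \<odot>\<^bsub>M\<^esub> x) p \<odot>\<^bsub>N\<^esub> y \<ominus>\<^bsub>N\<^esub> hsplit x p \<odot>\<^bsub>N\<^esub> (a \<odot>\<^bsub>N\<^esub> y)"
        unfolding z using C C' by (simp add: coord_diff Fc del: carrier_free_Abelian_group_iff)
      then show ?thesis
        using C by (simp add: minus_eq N.M.minus_eq N.smult_l_distr N_minus_smult N.smult_assoc)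
    qed
    ultimately show ?thesis using C by (intro one)
  qed
  have "z \<in> generate F (tensor_relators R M N)" using assms by (simp add: tensor_kernel_def)
  then have "z \<in> carrier F \<and> (\<exists>L. relations L \<and> (\<forall>p. coord p z = comb L p))"
  proof (induction rule: generate.induct)
    case one
    then show ?case by (auto intro!: exI[of _ "[]"] simp: relations_def)
  next
    case (incl h)
    then show ?case using rel relators_carrier by blast
  next
    case (inv h)
    then have h: "h \<in> carrier F" using relators_carrier by blast
    obtain L where L: "relations L" "\<forall>p. coord p h = comb L p" using rel[OF inv] by blast
    have "inv\<^bsub>F\<^esub> h = - h" using h by simp
    moreover have "relations (map (\<lambda>x. (fst x, \<ominus>\<^bsub>N\<^esub> snd x)) L)" using L(1) by (auto simp: relations_def)
    ultimately show ?case
      using L h F_uminus[OF h] coord_uminus[OF h] comb_uminus[OF L(1)]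
      by (auto simp del: carrier_free_Abelian_group_iff)
  next
    case (eng h1 h2)
    then obtain L L' where L: "relations L" "\<forall>p. coord p h1 = comb L p"
      "relations L'" "\<forall>p. coord p h2 = comb L' p" by blast
    have "relations (L @ L')" using L by (auto simp: relations_def)
    moreover have "h1 + h2 \<in> carrier F"
      using eng by (metis group.subgroup_self group_free_Abelian_group mult_free_Abelian_group subgroup.m_closed)
    ultimately show ?case
      using eng L comb_append[OF L(1,3)] coord_add[of h1 h2]
      by (auto simp del: carrier_free_Abelian_group_iff)
  qed
  then show ?thesis by blast
qed

lemma homogeneous_relations_exist:
  assumes "relations L"
  shows "\<exists>L'. homogeneous_relations L' \<and> (\<forall>p. comb L' p = comb L p)"
  using assms
proof (induction L)
  case Nil
  then show ?case by (intro exI[of _ "[]"]) (simp add: homogeneous_relations_def relations_def)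
next
  case (Cons x L)
  then have L: "relations L" and x: "vec (fst x)" "famsum (fst x) = \<zero>\<^bsub>M\<^esub>" "snd x \<in> carrier N"
    by (auto simp: relations_def)
  then obtain L' where L': "homogeneous_relations L'" "\<forall>p. comb L' p = comb L p"
    using Cons.IH by blast
  let ?n = "fst x"
  have C: "?n p \<in> carrier R" for p using x by (simp add: vec_carrier)
  define S where "S = (\<Union>p\<in>{p. ?n p \<noteq> \<zero>}. (\<lambda>i. i + fst p) ` supp (?n p))"
  have S: "finite S" unfolding S_def using x C by (auto simp: vec_def)
  obtain ds where ds: "set ds = S" "distinct ds" using finite_distinct_list[OF S] by blast
  define L1 where "L1 = map (\<lambda>d. (hvec d ?n, snd x)) ds"
  have hr: "homogeneous_relations L1"
  proof -
    have "\<forall>p. hvec d ?n p \<in> G (d - fst p)" for d using C by (simp add: hvec_def)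
    then have "\<exists>d'. \<forall>p. hvec d ?n p \<in> G (d' - fst p)" for d by blast
    moreover have "relations L1"
      using x by (auto simp: L1_def relations_def vec_hvec famsum_hvec)
    ultimately show ?thesis by (auto simp: L1_def homogeneous_relations_def)
  qed
  have "comb (map (\<lambda>d. (hvec d ?n, snd x)) es) p = finsum R (\<lambda>d. hvec d ?n p) (set es) \<odot>\<^bsub>N\<^esub> snd x"
    if "distinct es" for es p
    using that x C by (induction es) (simp_all add: N.smult_l_distr hvec_def Pi_def)
  then have "comb L1 p = finsum R (\<lambda>d. hvec d ?n p) S \<odot>\<^bsub>N\<^esub> snd x" for p
    using ds by (simp add: L1_def)
  moreover have "finsum R (\<lambda>d. hvec d ?n p) S = ?n p" for p
  proof -
    have sub: "supp (?n p) \<subseteq> (\<lambda>d. d - fst p) ` S"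
    proof
      fix i assume "i \<in> supp (?n p)"
      moreover from this have "?n p \<noteq> \<zero>" by auto
      ultimately have "i + fst p \<in> S" unfolding S_def by blast
      then show "i \<in> (\<lambda>d. d - fst p) ` S" by (intro image_eqI[of _ _ "i + fst p"]) simp_all
    qed
    have "finsum R (cp (?n p)) ((\<lambda>d. d - fst p) ` S) = finsum R (\<lambda>d. cp (?n p) (d - fst p)) S"
      using C by (intro finsum_reindex) (auto simp: inj_on_def)
    then show ?thesis
      using sum_cp_superset[OF C _ sub] S by (simp add: hvec_def)
  qed
  ultimately have "comb L1 p = ?n p \<odot>\<^bsub>N\<^esub> snd x" for p by simp
  moreover have "homogeneous_relations (L1 @ L')"
    using hr L' by (auto simp: homogeneous_relations_def relations_def)
  moreover have "comb (L1 @ L') p = comb L1 p \<oplus>\<^bsub>N\<^esub> comb L' p" for p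
    using hr L' by (intro comb_append) (auto simp: homogeneous_relations_def)
  ultimately show ?case using L' by (intro exI[of _ "L1 @ L'"]) simp
qed

text \<open>Rebuilding an element of the free abelian group from its coordinates.\<close>

definition rebuild :: "(int \<times> 'm) set \<Rightarrow> (int \<times> 'm \<Rightarrow> 'n) \<Rightarrow> ('m \<times> 'n \<Rightarrow>\<^sub>0 int)" where
  "rebuild S v = (\<Sum>p\<in>S. frag_of (snd p, v p))"

lemma rebuild_diff:
  assumes "S \<subseteq> idx" "\<And>p. v p \<in> carrier N" "\<And>p. w p \<in> carrier N"
  shows "rebuild S (\<lambda>p. v p \<ominus>\<^bsub>N\<^esub> w p) - (rebuild S v - rebuild S w) \<in> K"
proof -
  have "rebuild S (\<lambda>p. v p \<ominus>\<^bsub>N\<^esub> w p) - (rebuild S v - rebuild S w) =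
     (\<Sum>p\<in>S. frag_of (snd p, v p \<ominus>\<^bsub>N\<^esub> w p) - (frag_of (snd p, v p) - frag_of (snd p, w p)))"
    by (simp add: rebuild_def sum_subtractf)
  also have "\<dots> \<in> K"
    using assms idx_carrier by (intro K_sum K_diff_right) auto
  finally show ?thesis .
qed

text \<open>Families \<open>p \<mapsto> n(p)\<cdot>w\<close> with a relation \<open>n\<close> contribute nothing to the tensor product.\<close>

lemma rebuild_relation:
  assumes "finite S" "S \<subseteq> idx" "vec n" "{p. n p \<noteq> \<zero>} \<subseteq> S" "famsum n = \<zero>\<^bsub>M\<^esub>" "w \<in> carrier N"
  shows "rebuild S (\<lambda>p. n p \<odot>\<^bsub>N\<^esub> w) \<in> K"
proof -
  have C: "n p \<in> carrier R" for p using assms(3) by (rule vec_carrier)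
  have sC: "snd p \<in> carrier M" if "p \<in> S" for p using assms(2) idx_carrier that by blast
  have "(\<Sum>p\<in>S. frag_of (n p \<odot>\<^bsub>M\<^esub> snd p, w) - frag_of (snd p, n p \<odot>\<^bsub>N\<^esub> w)) \<in> K"
    using C sC assms(6) by (intro K_sum K_middle) auto
  then have 1: "(\<Sum>p\<in>S. frag_of (n p \<odot>\<^bsub>M\<^esub> snd p, w)) - rebuild S (\<lambda>p. n p \<odot>\<^bsub>N\<^esub> w) \<in> K"
    by (simp add: rebuild_def sum_subtractf)
  have "frag_of (finsum M (\<lambda>p. n p \<odot>\<^bsub>M\<^esub> snd p) S, w) - (\<Sum>p\<in>S. frag_of (n p \<odot>\<^bsub>M\<^esub> snd p, w)) \<in> K"
    using C sC assms(1,6) by (intro K_finsum_left) (auto intro!: Mod.smult_closed)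
  then have 2: "frag_of (\<zero>\<^bsub>M\<^esub>, w) - (\<Sum>p\<in>S. frag_of (n p \<odot>\<^bsub>M\<^esub> snd p, w)) \<in> K"
    using assms(5) famsum_superset[OF assms(3,1,2,4)] by simp
  have "frag_of (\<zero>\<^bsub>M\<^esub>, w) - rebuild S (\<lambda>p. n p \<odot>\<^bsub>N\<^esub> w) \<in> K"
    using K_add[OF 1 2] by simp
  from K_diff[OF K_zero_left[OF assms(6)] this] show ?thesis by simp
qed

lemma rebuild_coord:
  assumes "Poly_Mapping.keys z \<subseteq> carrier M \<times> carrier N"
  shows "\<exists>S0. finite S0 \<and> S0 \<subseteq> idx \<and> (\<forall>p. p \<notin> S0 \<longrightarrow> coord p z = \<zero>\<^bsub>N\<^esub>) \<and>
    (\<forall>S. finite S \<and> S0 \<subseteq> S \<and> S \<subseteq> idx \<longrightarrow> z - rebuild S (\<lambda>p. coord p z) \<in> K)"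
  using assms
proof (induction z rule: free_Abelian_group_induct[consumes 1, case_names zero diff single])
  case zero
  then show ?case
    using idx_carrier by (intro exI[of _ "{}"]) (auto simp: rebuild_def intro!: K_uminus K_sum K_zero_right)
next
  case (diff x y)
  obtain S where S: "finite S" "S \<subseteq> idx" "\<forall>p. p \<notin> S \<longrightarrow> coord p x = \<zero>\<^bsub>N\<^esub>"
    "\<forall>U. finite U \<and> S \<subseteq> U \<and> U \<subseteq> idx \<longrightarrow> x - rebuild U (\<lambda>p. coord p x) \<in> K"
    using diff.IH(1) by (elim exE conjE) (rule that)
  obtain T where T: "finite T" "T \<subseteq> idx" "\<forall>p. p \<notin> T \<longrightarrow> coord p y = \<zero>\<^bsub>N\<^esub>"
    "\<forall>U. finite U \<and> T \<subseteq> U \<and> U \<subseteq> idx \<longrightarrow> y - rebuild U (\<lambda>p. coord p y) \<in> K"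
    using diff.IH(2) by (elim exE conjE) (rule that)
  have F: "x \<in> carrier F" "y \<in> carrier F" using diff by simp_all
  have coord: "coord p (x - y) = coord p x \<ominus>\<^bsub>N\<^esub> coord p y" for p using F by (rule coord_diff)
  have "(x - y) - rebuild U (\<lambda>p. coord p (x - y)) \<in> K" if U: "finite U" "S \<union> T \<subseteq> U" "U \<subseteq> idx" for U
  proof -
    have "(x - rebuild U (\<lambda>p. coord p x)) - (y - rebuild U (\<lambda>p. coord p y)) \<in> K"
    proof (rule K_diff)
      show "x - rebuild U (\<lambda>p. coord p x) \<in> K" using U S(4) by simp
      show "y - rebuild U (\<lambda>p. coord p y) \<in> K" using U T(4) by simp
    qed
    moreover have "rebuild U (\<lambda>p. coord p (x - y)) - (rebuild U (\<lambda>p. coord p x) - rebuild U (\<lambda>p. coord p y)) \<in> K"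
      unfolding coord using U F by (intro rebuild_diff coord_closed)
    ultimately have "(x - rebuild U (\<lambda>p. coord p x)) - (y - rebuild U (\<lambda>p. coord p y)) -
      (rebuild U (\<lambda>p. coord p (x - y)) - (rebuild U (\<lambda>p. coord p x) - rebuild U (\<lambda>p. coord p y))) \<in> K"
      by (rule K_diff)
    then show ?thesis by (simp add: algebra_simps)
  qed
  moreover have "\<forall>p. p \<notin> S \<union> T \<longrightarrow> coord p (x - y) = \<zero>\<^bsub>N\<^esub>"
    using S(3) T(3) by (simp add: coord N.M.minus_eq N.M.minus_zero_group)
  ultimately show ?case using S(1,2) T(1,2) by (intro exI[of _ "S \<union> T"]) auto
next
  case (single a)
  then obtain x y where a: "a = (x, y)" "x \<in> carrier M" "y \<in> carrier N" by auto
  let ?S0 = "split_supp x"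
  have co: "coord p (frag_of a) = (if p \<in> ?S0 then y else \<zero>\<^bsub>N\<^esub>)" for p
    using a by (simp add: split_eq N.smult_one)
  have "frag_of a - rebuild S (\<lambda>p. coord p (frag_of a)) \<in> K"
    if S: "finite S" "?S0 \<subseteq> S" "S \<subseteq> idx" for S
  proof -
    have "rebuild S (\<lambda>p. coord p (frag_of a)) =
        (\<Sum>p\<in>?S0. frag_of (snd p, coord p (frag_of a))) + (\<Sum>p\<in>S - ?S0. frag_of (snd p, coord p (frag_of a)))"
      unfolding rebuild_def using S by (simp add: sum.subset_diff add.commute)
    also have "(\<Sum>p\<in>?S0. frag_of (snd p, coord p (frag_of a))) = (\<Sum>p\<in>?S0. frag_of (snd p, y))"
      by (intro sum.cong) (simp_all add: co)
    finally have eq: "rebuild S (\<lambda>p. coord p (frag_of a)) =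
        (\<Sum>p\<in>?S0. frag_of (snd p, y)) + (\<Sum>p\<in>S - ?S0. frag_of (snd p, coord p (frag_of a)))" .
    have rest: "(\<Sum>p\<in>S - ?S0. frag_of (snd p, coord p (frag_of a))) \<in> K"
      using S idx_carrier by (intro K_sum) (auto simp: co intro!: K_zero_right)
    have "frag_of (finsum M snd ?S0, y) - (\<Sum>p\<in>?S0. frag_of (snd p, y)) \<in> K"
      using a S idx_carrier by (intro K_finsum_left finite_split_supp) auto
    then have "(frag_of (finsum M snd ?S0, y) - (\<Sum>p\<in>?S0. frag_of (snd p, y))) -
       (\<Sum>p\<in>S - ?S0. frag_of (snd p, coord p (frag_of a))) \<in> K"
      using rest by (rule K_diff)
    then show ?thesis
      unfolding eq sum_split_supp[OF a(2)] by (simp add: a(1) algebra_simps)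
  qed
  then show ?case
    using a by (intro exI[of _ "?S0"]) (simp add: finite_split_supp split_supp_idx split_eq)
qed


text \<open>
  The crucial point: the tensor product with a graded module preserves injectivity.  If the images
  under an injective map \<open>f\<close> of the coordinates of an element come from homogeneous relations, then
  these relations can be eliminated one by one.  A relation \<open>n\<close> is removed by subtracting \<open>n\<cdot>w\<close> from
  the coordinates, where \<open>w = \<Sum> y(p) v(p)\<close> and \<open>e = \<Sum> y(p) n(p)\<close> fixes all \<open>n(p)\<close>.
\<close>

lemma rebuild_in_kernel:
  assumes P: "flat_test R G M D P" and f: "f \<in> module_hom R P N" "inj_on f (carrier P)"
    and S: "finite S" "S \<subseteq> idx"
    and L: "homogeneous_relations L" "\<And>x p. x \<in> set L \<Longrightarrow> p \<notin> S \<Longrightarrow> fst x p = \<zero>"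
    and v: "\<And>p. v p \<in> carrier P" "\<And>p. p \<in> S \<Longrightarrow> f (v p) = comb L p"
  shows "flat_test.rebuild S v \<in> tensor_kernel R M P"
proof -
  interpret P: flat_test R G M D P by fact
  have f_hom: "f \<in> hom (add_monoid P) (add_monoid N)"
    and f_smult: "\<And>a x. a \<in> carrier R \<Longrightarrow> x \<in> carrier P \<Longrightarrow> f (a \<odot>\<^bsub>P\<^esub> x) = a \<odot>\<^bsub>N\<^esub> f x"
    using f(1) by (auto simp: module_hom_def)
  have fC: "f x \<in> carrier N" if "x \<in> carrier P" for x
    using f_hom that by (auto simp: hom_def)
  have f_add: "f (x \<oplus>\<^bsub>P\<^esub> y) = f x \<oplus>\<^bsub>N\<^esub> f y" if "x \<in> carrier P" "y \<in> carrier P" for x y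
    using f_hom that by (auto simp: hom_def)
  have f_zero: "f \<zero>\<^bsub>P\<^esub> = \<zero>\<^bsub>N\<^esub>"
    using f_smult[of \<zero> "\<zero>\<^bsub>P\<^esub>"] fC[of "\<zero>\<^bsub>P\<^esub>"] by simp
  have f_uminus: "f (\<ominus>\<^bsub>P\<^esub> x) = \<ominus>\<^bsub>N\<^esub> f x" if "x \<in> carrier P" for x
    using f_add[of "\<ominus>\<^bsub>P\<^esub> x" x] that fC f_zero
    by (intro N.M.minus_equality[symmetric]) (simp_all add: P.N.M.l_neg)
  show ?thesis
    using L v
  proof (induction "length L" arbitrary: L v)
    case 0
    then have "v p = \<zero>\<^bsub>P\<^esub>" if "p \<in> S" for p
      using that f_zero inj_onD[OF f(2), of "v p" "\<zero>\<^bsub>P\<^esub>"] by simp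
    then show ?case
      unfolding P.rebuild_def using S idx_carrier by (intro P.K_sum) (auto intro!: P.K_zero_right)
  next
    case (Suc k)
    then obtain n q L' where L: "L = (n, q) # L'" by (cases L) auto
    have L': "homogeneous_relations L'" "length L' = k" "relations L'"
      using Suc.hyps(2) Suc.prems(1) by (auto simp: L homogeneous_relations_def relations_def)
    have n: "vec n" "famsum n = \<zero>\<^bsub>M\<^esub>" "q \<in> carrier N"
      using Suc.prems(1) by (auto simp: L homogeneous_relations_def relations_def)
    have nC: "n p \<in> carrier R" for p using n(1) by (rule vec_carrier)
    have "\<exists>d. \<forall>p. n p \<in> G (d - fst p)"
      using Suc.prems(1) by (simp add: L homogeneous_relations_def)
    then obtain d where d: "\<And>p. n p \<in> G (d - fst p)" by blast
    have n_S: "n p = \<zero>" if "p \<notin> S" for p using Suc.prems(2)[of "(n, q)" p] that by (simp add: L)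
    have "\<exists>e y. e \<in> G 0 \<and> (\<forall>h\<in>S. y h \<in> G (- (d - fst h))) \<and> e = finsum R (\<lambda>h. y h \<otimes> n h) S \<and>
        (\<forall>h\<in>S. n h \<otimes> e = n h)"
      by (rule homogeneous_right_identity[OF S(1)]) (rule d)
    then obtain e y where e: "e \<in> G 0" and y: "\<And>h. h \<in> S \<Longrightarrow> y h \<in> G (- (d - fst h))"
      and e_eq: "e = finsum R (\<lambda>h. y h \<otimes> n h) S" and ne: "\<And>h. h \<in> S \<Longrightarrow> n h \<otimes> e = n h"
      by blast
    have eC: "e \<in> carrier R" using e by simp
    have yC: "y h \<in> carrier R" if "h \<in> S" for h using y[OF that] by simp
    define w where "w = finsum P (\<lambda>h. y h \<odot>\<^bsub>P\<^esub> v h) S"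
    define v' where "v' p = v p \<ominus>\<^bsub>P\<^esub> n p \<odot>\<^bsub>P\<^esub> w" for p
    define b where "b n' = finsum R (\<lambda>h. y h \<otimes> n' h) S" for n' :: "int \<times> 'm \<Rightarrow> 'a"
    define L'' where "L'' = map (\<lambda>x. (\<lambda>p. fst x p \<ominus> n p \<otimes> b (fst x), snd x)) L'"
    have wC: "w \<in> carrier P"
      unfolding w_def using yC Suc.prems(3) by (intro P.N.M.finsum_closed) (auto intro!: P.N.smult_closed)
    have v'C: "v' p \<in> carrier P" for p
      unfolding v'_def using wC nC Suc.prems(3) by (simp add: P.N.smult_closed)
    have bC: "b (fst x) \<in> carrier R" if "x \<in> set L'" for x
      unfolding b_def using that yC L'(3) by (intro finsum_closed) (auto simp: relations_def vec_carrier)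
    \<comment> \<open>The value of \<open>f\<close> at \<open>w\<close>.\<close>
    have fw: "f w = e \<odot>\<^bsub>N\<^esub> q \<oplus>\<^bsub>N\<^esub> finsum N (\<lambda>h. y h \<odot>\<^bsub>N\<^esub> comb L' h) S"
    proof -
      have "f (finsum P (\<lambda>h. y h \<odot>\<^bsub>P\<^esub> v h) T) =
          finsum R (\<lambda>h. y h \<otimes> n h) T \<odot>\<^bsub>N\<^esub> q \<oplus>\<^bsub>N\<^esub> finsum N (\<lambda>h. y h \<odot>\<^bsub>N\<^esub> comb L' h) T"
        if "T \<subseteq> S" for T
        using finite_subset[OF that S(1)] that
      proof (induction T rule: finite_induct)
        case empty
        then show ?case using n(3) f_zero by simp
      next
        case (insert h T)
        have C: "y i \<in> carrier R" "v i \<in> carrier P" "comb L' i \<in> carrier N" if "i \<in> insert h T" for i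
          using yC[of i] that insert.prems Suc.prems(3)[of i] comb_closed[OF L'(3), of i] by blast+
        have P: "(\<lambda>h. y h \<odot>\<^bsub>P\<^esub> v h) \<in> T \<rightarrow> carrier P" using C by (auto intro!: P.N.smult_closed)
        have N: "(\<lambda>h. y h \<odot>\<^bsub>N\<^esub> comb L' h) \<in> T \<rightarrow> carrier N" using C by (auto intro!: N.smult_closed)
        have R: "(\<lambda>h. y h \<otimes> n h) \<in> T \<rightarrow> carrier R" using C nC by auto
        have "f (v h) = n h \<odot>\<^bsub>N\<^esub> q \<oplus>\<^bsub>N\<^esub> comb L' h"
          using Suc.prems(4)[of h] insert.prems by (simp add: L)
        then have fy: "f (y h \<odot>\<^bsub>P\<^esub> v h) = (y h \<otimes> n h) \<odot>\<^bsub>N\<^esub> q \<oplus>\<^bsub>N\<^esub> y h \<odot>\<^bsub>N\<^esub> comb L' h"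
          using C[of h] nC n(3)
          by (simp add: f_smult N.smult_r_distr N.smult_assoc N.smult_closed)
        have cl: "finsum P (\<lambda>h. y h \<odot>\<^bsub>P\<^esub> v h) T \<in> carrier P" "finsum R (\<lambda>h. y h \<otimes> n h) T \<in> carrier R"
          "finsum N (\<lambda>h. y h \<odot>\<^bsub>N\<^esub> comb L' h) T \<in> carrier N"
          using P N R by (auto intro: P.N.M.finsum_closed N.M.finsum_closed finsum_closed)
        have "f (finsum P (\<lambda>h. y h \<odot>\<^bsub>P\<^esub> v h) (insert h T)) =
            f (y h \<odot>\<^bsub>P\<^esub> v h) \<oplus>\<^bsub>N\<^esub> f (finsum P (\<lambda>h. y h \<odot>\<^bsub>P\<^esub> v h) T)"
          using insert.hyps P C[of h] cl by (simp add: f_add P.N.smult_closed)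
        also have "\<dots> = ((y h \<otimes> n h) \<odot>\<^bsub>N\<^esub> q \<oplus>\<^bsub>N\<^esub> y h \<odot>\<^bsub>N\<^esub> comb L' h) \<oplus>\<^bsub>N\<^esub>
            (finsum R (\<lambda>h. y h \<otimes> n h) T \<odot>\<^bsub>N\<^esub> q \<oplus>\<^bsub>N\<^esub> finsum N (\<lambda>h. y h \<odot>\<^bsub>N\<^esub> comb L' h) T)"
          using insert by (simp add: fy)
        also have "\<dots> = (y h \<otimes> n h \<oplus> finsum R (\<lambda>h. y h \<otimes> n h) T) \<odot>\<^bsub>N\<^esub> q \<oplus>\<^bsub>N\<^esub>
            (y h \<odot>\<^bsub>N\<^esub> comb L' h \<oplus>\<^bsub>N\<^esub> finsum N (\<lambda>h. y h \<odot>\<^bsub>N\<^esub> comb L' h) T)"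
          using C[of h] nC n(3) cl by (simp add: N.smult_l_distr N.smult_closed N.M.a_ac)
        finally show ?case
          using insert.hyps R N C[of h] nC by (simp add: N.smult_closed)
      qed
      from this[of S] show ?thesis by (simp add: w_def e_eq)
    qed
    have sums: "finsum N (\<lambda>h. y h \<odot>\<^bsub>N\<^esub> comb K h) S \<in> carrier N \<and>
        comb K p \<ominus>\<^bsub>N\<^esub> n p \<odot>\<^bsub>N\<^esub> finsum N (\<lambda>h. y h \<odot>\<^bsub>N\<^esub> comb K h) S =
        comb (map (\<lambda>x. (\<lambda>p. fst x p \<ominus> n p \<otimes> b (fst x), snd x)) K) p"
      if "relations K" for K p
      using that
    proof (induction K)
      case Nil
      have "finsum N (\<lambda>h. y h \<odot>\<^bsub>N\<^esub> \<zero>\<^bsub>N\<^esub>) S = \<zero>\<^bsub>N\<^esub>"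
        using yC by (intro N.M.add.finprod_one_eqI) simp
      then show ?case using nC by (simp add: N.M.minus_eq N.M.minus_zero_group)
    next
      case (Cons x K)
      have K: "relations K" and x: "snd x \<in> carrier N" "\<And>p. fst x p \<in> carrier R"
        using Cons.prems by (auto simp: relations_def vec_carrier)
      note IH = Cons.IH[OF K]
      let ?s = "finsum N (\<lambda>h. y h \<odot>\<^bsub>N\<^esub> comb K h) S"
      have bx: "b (fst x) \<in> carrier R" unfolding b_def using yC x by (intro finsum_closed) auto
      have "finsum N (\<lambda>h. y h \<odot>\<^bsub>N\<^esub> (fst x h \<odot>\<^bsub>N\<^esub> snd x)) T = finsum R (\<lambda>h. y h \<otimes> fst x h) T \<odot>\<^bsub>N\<^esub> snd x"
        if "T \<subseteq> S" for T
        using finite_subset[OF that S(1)] that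
      proof (induction T rule: finite_induct)
        case (insert h T)
        have "(\<lambda>h. y h \<odot>\<^bsub>N\<^esub> (fst x h \<odot>\<^bsub>N\<^esub> snd x)) \<in> T \<rightarrow> carrier N"
          "(\<lambda>h. y h \<otimes> fst x h) \<in> T \<rightarrow> carrier R" "y h \<in> carrier R"
          using insert.prems yC x by (auto intro!: N.smult_closed)
        then show ?case
          using insert x by (simp add: N.smult_closed N.smult_l_distr N.smult_assoc finsum_closed)
      qed (use x in simp)
      then have bq: "finsum N (\<lambda>h. y h \<odot>\<^bsub>N\<^esub> (fst x h \<odot>\<^bsub>N\<^esub> snd x)) S = b (fst x) \<odot>\<^bsub>N\<^esub> snd x"
        by (simp add: b_def)
      have "finsum N (\<lambda>h. y h \<odot>\<^bsub>N\<^esub> comb (x # K) h) S =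
          finsum N (\<lambda>h. y h \<odot>\<^bsub>N\<^esub> (fst x h \<odot>\<^bsub>N\<^esub> snd x) \<oplus>\<^bsub>N\<^esub> y h \<odot>\<^bsub>N\<^esub> comb K h) S"
        using yC x comb_closed[OF K]
        by (intro N.M.finsum_cong') (auto simp: N.smult_r_distr N.smult_closed)
      also have "\<dots> = b (fst x) \<odot>\<^bsub>N\<^esub> snd x \<oplus>\<^bsub>N\<^esub> ?s"
        unfolding bq[symmetric] using yC x comb_closed[OF K]
        by (intro N.M.finsum_addf) (auto intro!: N.smult_closed)
      finally have eq: "finsum N (\<lambda>h. y h \<odot>\<^bsub>N\<^esub> comb (x # K) h) S = b (fst x) \<odot>\<^bsub>N\<^esub> snd x \<oplus>\<^bsub>N\<^esub> ?s" .
      have "comb (x # K) p \<ominus>\<^bsub>N\<^esub> n p \<odot>\<^bsub>N\<^esub> (b (fst x) \<odot>\<^bsub>N\<^esub> snd x \<oplus>\<^bsub>N\<^esub> ?s) =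
          (fst x p \<odot>\<^bsub>N\<^esub> snd x \<ominus>\<^bsub>N\<^esub> (n p \<otimes> b (fst x)) \<odot>\<^bsub>N\<^esub> snd x) \<oplus>\<^bsub>N\<^esub> (comb K p \<ominus>\<^bsub>N\<^esub> n p \<odot>\<^bsub>N\<^esub> ?s)"
        using nC x bx IH comb_closed[OF K]
        by (simp add: N.smult_r_distr N.smult_assoc N.smult_closed N.M.add_diff_add)
      also have "fst x p \<odot>\<^bsub>N\<^esub> snd x \<ominus>\<^bsub>N\<^esub> (n p \<otimes> b (fst x)) \<odot>\<^bsub>N\<^esub> snd x =
          (fst x p \<ominus> n p \<otimes> b (fst x)) \<odot>\<^bsub>N\<^esub> snd x"
        using nC x bx by (simp add: minus_eq N.M.minus_eq N.smult_l_distr N_minus_smult)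
      also have "comb K p \<ominus>\<^bsub>N\<^esub> n p \<odot>\<^bsub>N\<^esub> ?s =
          comb (map (\<lambda>x. (\<lambda>p. fst x p \<ominus> n p \<otimes> b (fst x), snd x)) K) p"
        using IH by blast
      finally show ?case
        unfolding eq using IH x bx by (simp add: N.smult_closed)
    qed
    have fv': "f (v' p) = comb L'' p" if p: "p \<in> S" for p
    proof -
      let ?s = "finsum N (\<lambda>h. y h \<odot>\<^bsub>N\<^esub> comb L' h) S"
      have C: "?s \<in> carrier N" "comb L' p \<in> carrier N" "n p \<odot>\<^bsub>N\<^esub> ?s \<in> carrier N" "n p \<odot>\<^bsub>N\<^esub> q \<in> carrier N"
        using sums[OF L'(3), of p] comb_closed[OF L'(3), of p] nC[of p] n(3) N.smult_closed by blast+
      have "f (v' p) = f (v p) \<ominus>\<^bsub>N\<^esub> n p \<odot>\<^bsub>N\<^esub> f w"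
        unfolding v'_def using Suc.prems(3) wC nC
        by (simp add: P.N.M.minus_eq N.M.minus_eq f_add f_uminus f_smult P.N.smult_closed)
      also have "\<dots> = (n p \<odot>\<^bsub>N\<^esub> q \<oplus>\<^bsub>N\<^esub> comb L' p) \<ominus>\<^bsub>N\<^esub> ((n p \<otimes> e) \<odot>\<^bsub>N\<^esub> q \<oplus>\<^bsub>N\<^esub> n p \<odot>\<^bsub>N\<^esub> ?s)"
        using Suc.prems(4)[OF p] C nC eC n(3)
        by (simp add: L fw N.smult_r_distr N.smult_assoc N.smult_closed)
      also have "\<dots> = comb L' p \<ominus>\<^bsub>N\<^esub> n p \<odot>\<^bsub>N\<^esub> ?s"
        unfolding ne[OF p] using C
        by (simp add: N.M.minus_eq N.M.minus_add N.M.a_ac N.M.r_neg2 N.M.r_neg1)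
      also have "\<dots> = comb L'' p" using sums[OF L'(3)] by (simp add: L''_def)
      finally show ?thesis .
    qed
    have "P.rebuild S v' \<in> P.K"
    proof (rule Suc.hyps(1))
      show "k = length L''" by (simp add: L''_def L')
      have "vec (fst x) \<and> famsum (fst x) = \<zero>\<^bsub>M\<^esub> \<and> snd x \<in> carrier N \<and> (\<exists>d. \<forall>p. fst x p \<in> G (d - fst p))"
        if x'': "x \<in> set L''" for x
      proof -
        obtain x' where x': "x' \<in> set L'" "x = (\<lambda>p. fst x' p \<ominus> n p \<otimes> b (fst x'), snd x')"
          using x'' by (auto simp: L''_def)
        have rel: "vec (fst x')" "famsum (fst x') = \<zero>\<^bsub>M\<^esub>" "snd x' \<in> carrier N"
          using L'(3) x'(1) by (auto simp: relations_def)
        have "\<exists>d. \<forall>p. fst x' p \<in> G (d - fst p)"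
          using L'(1) x'(1) by (simp add: homogeneous_relations_def)
        then obtain d' where d': "\<And>p. fst x' p \<in> G (d' - fst p)" by blast
        have "b (fst x') \<in> G (d' - d)"
          unfolding b_def
        proof (rule finsum_in_subgroup[OF subgroup_D])
          fix h assume "h \<in> S"
          from G_mult[OF y[OF this] d'[of h]] show "y h \<otimes> fst x' h \<in> G (d' - d)" by simp
        qed
        then have "fst x p \<in> G (d' - fst p)" for p
          using d'[of p] G_mult[OF d[of p], of "b (fst x')" "d' - d"] by (auto simp: x'(2))
        then have "\<exists>d. \<forall>p. fst x p \<in> G (d - fst p)" by blast
        moreover have "vec (fst x)"
          using rel n bC[OF x'(1)] by (simp add: x'(2) vec_minus vec_mult)
        moreover have "famsum (fst x) = \<zero>\<^bsub>M\<^esub>"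
          using rel n bC[OF x'(1)]
          by (simp add: x'(2) famsum_minus vec_mult famsum_mult Mod.M.minus_eq Mod.M.minus_zero_group)
        moreover have "snd x \<in> carrier N" using rel by (simp add: x'(2))
        ultimately show ?thesis by blast
      qed
      then show "homogeneous_relations L''"
        by (simp add: homogeneous_relations_def relations_def)
      show "fst x p = \<zero>" if x'': "x \<in> set L''" and p: "p \<notin> S" for x p
      proof -
        obtain x' where x': "x' \<in> set L'" "x = (\<lambda>p. fst x' p \<ominus> n p \<otimes> b (fst x'), snd x')"
          using x'' by (auto simp: L''_def)
        then show ?thesis
          using Suc.prems(2)[of x' p] n_S[OF p] p bC[OF x'(1)] by (simp add: L minus_eq minus_zero_group)
      qed
    qed (use v'C fv' in auto)
    moreover have "P.rebuild S (\<lambda>p. n p \<odot>\<^bsub>P\<^esub> w) \<in> P.K"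
      using S n wC n_S by (intro P.rebuild_relation) auto
    moreover have "P.rebuild S v' - (P.rebuild S v - P.rebuild S (\<lambda>p. n p \<odot>\<^bsub>P\<^esub> w)) \<in> P.K"
      unfolding v'_def using S(2) Suc.prems(3) wC nC by (intro P.rebuild_diff) (auto intro!: P.N.smult_closed)
    ultimately have "P.rebuild S v' + P.rebuild S (\<lambda>p. n p \<odot>\<^bsub>P\<^esub> w) -
        (P.rebuild S v' - (P.rebuild S v - P.rebuild S (\<lambda>p. n p \<odot>\<^bsub>P\<^esub> w))) \<in> P.K"
      by (rule P.K_diff[OF P.K_add])
    then show ?case by (simp add: algebra_simps)
  qed
qed

text \<open>The kernel form of injectivity of \<open>M \<otimes> P \<rightarrow> M \<otimes> N\<close>.\<close>

lemma kernel_reflect: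
  assumes P: "flat_test R G M D P" and f: "f \<in> module_hom R P N" "inj_on f (carrier P)"
    and z: "Poly_Mapping.keys z \<subseteq> carrier M \<times> carrier P"
    and ext: "frag_extend (\<lambda>(x, y). frag_of (x, f y)) z \<in> K"
  shows "z \<in> tensor_kernel R M P"
proof -
  interpret P: flat_test R G M D P by fact
  let ?ext = "frag_extend (\<lambda>(x, y). frag_of (x, f y))"
  have f_hom: "f \<in> hom (add_monoid P) (add_monoid N)"
    and f_smult: "\<And>a x. a \<in> carrier R \<Longrightarrow> x \<in> carrier P \<Longrightarrow> f (a \<odot>\<^bsub>P\<^esub> x) = a \<odot>\<^bsub>N\<^esub> f x"
    using f(1) by (auto simp: module_hom_def)
  interpret f: group_hom "add_monoid P" "add_monoid N" f
    using f_hom P.N.M.a_group N.M.a_group by (simp add: group_hom_def group_hom_axioms_def)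
  have fC: "f x \<in> carrier N" if "x \<in> carrier P" for x
    using f.hom_closed[of x] that by simp
  have coord: "?ext z \<in> carrier F \<and> (\<forall>p. coord p (?ext z) = f (P.coord p z))"
    using z
  proof (induction z rule: free_Abelian_group_induct[consumes 1, case_names zero diff single])
    case zero
    then show ?case using f.hom_one by simp
  next
    case (diff x y)
    have xy: "x \<in> carrier P.F" "y \<in> carrier P.F" using diff.hyps by simp_all
    have "f (P.coord p x \<ominus>\<^bsub>P\<^esub> P.coord p y) = f (P.coord p x) \<ominus>\<^bsub>N\<^esub> f (P.coord p y)" for p
      using f.hom_mult[of "P.coord p x" "\<ominus>\<^bsub>P\<^esub> P.coord p y"] f.hom_inv[of "P.coord p y"]
        P.coord_closed[OF xy(1)] P.coord_closed[OF xy(2)]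
      by (simp add: P.N.M.minus_eq N.M.minus_eq flip: a_inv_def)
    then show ?case
      using diff.IH F_diff[of "?ext x" "?ext y"] coord_diff[of "?ext x" "?ext y"] P.coord_diff[OF xy]
      by (simp add: frag_extend_diff del: carrier_free_Abelian_group_iff)
  next
    case (single a)
    then show ?case by (auto simp: fC f_smult)
  qed
  obtain L0 where "relations L0" "\<forall>p. coord p (?ext z) = comb L0 p"
    using coord_kernel[OF ext] by blast
  then obtain L where L: "homogeneous_relations L" "\<And>p. coord p (?ext z) = comb L p"
    using homogeneous_relations_exist by metis
  obtain S0 where S0: "finite S0" "S0 \<subseteq> idx"
    "\<forall>S. finite S \<and> S0 \<subseteq> S \<and> S \<subseteq> idx \<longrightarrow> z - P.rebuild S (\<lambda>p. P.coord p z) \<in> P.K"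
    using P.rebuild_coord[OF z] by blast
  define S where "S = S0 \<union> (\<Union>x\<in>set L. {p. fst x p \<noteq> \<zero>})"
  have vec: "vec (fst x)" if "x \<in> set L" for x
    using L(1) that by (simp add: homogeneous_relations_def relations_def)
  have "finite {p. fst x p \<noteq> \<zero>}" if "x \<in> set L" for x
    using vec[OF that] by (simp add: vec_def)
  then have "finite S" using S0(1) by (simp add: S_def)
  moreover have "S \<subseteq> idx" unfolding S_def using S0(2) vec_supp_idx[OF vec] by blast
  ultimately have S: "finite S" "S0 \<subseteq> S" "S \<subseteq> idx" by (simp_all add: S_def)
  have "P.rebuild S (\<lambda>p. P.coord p z) \<in> P.K"
  proof (rule rebuild_in_kernel[OF P f S(1,3) L(1)])
    show "fst x p = \<zero>" if "x \<in> set L" "p \<notin> S" for x p using that unfolding S_def by blast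
    show "P.coord p z \<in> carrier P" for p using z by (intro P.coord_closed) simp
    show "f (P.coord p z) = comb L p" for p using coord L(2) by metis
  qed
  then have "(z - P.rebuild S (\<lambda>p. P.coord p z)) + P.rebuild S (\<lambda>p. P.coord p z) \<in> P.K"
    using S0(3) S by (intro P.K_add) simp_all
  then show ?thesis by simp
qed

end

lemma module_hom_carrier: "f \<in> module_hom R P N \<Longrightarrow> f \<in> carrier P \<rightarrow> carrier N"
  by (auto simp: module_hom_def hom_def)

context graded_unital_module
begin

lemma flat_test_left_module: "unital_left_module R N \<Longrightarrow> flat_test R G M D N"
  by (intro flat_test.intro graded_unital_module_axioms)

lemma graded_right_module_flat: "flat_right_module TYPE('p) TYPE('q) R M"
  unfolding flat_right_module_def
proof (intro conjI allI impI Mod.unital_right_module_axioms)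
  fix P :: "('a, 'p) module" and Q :: "('a, 'q) module" and f
  assume *: "unital_left_module R P \<and> unital_left_module R Q \<and> f \<in> module_hom R P Q \<and> inj_on f (carrier P)"
  then have PQ: "flat_test R G M D P" "flat_test R G M D Q"
    by (simp_all add: flat_test_left_module)
  interpret P: flat_test R G M D P by fact
  interpret Q: flat_test R G M D Q by fact
  show "inj_on (tensor_map R M Q (\<lambda>x. x) f) (carrier (tensor_product R M P))"
  proof (rule inj_on_tensor_map)
    show "f \<in> carrier P \<rightarrow> carrier Q" using * module_hom_carrier by blast
    fix z assume "Poly_Mapping.keys z \<subseteq> carrier M \<times> carrier P"
      "frag_extend (\<lambda>(x, y). frag_of (x, f y)) z \<in> tensor_kernel R M Q"
    then show "z \<in> tensor_kernel R M P" using * by (intro Q.kernel_reflect[OF PQ(1)]) simp_all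
  qed (auto intro: P.tensor_modules_axioms Q.tensor_modules_axioms)
qed

end

text \<open>Left modules are right modules over the opposite ring.\<close>

lemma opposite_unital_left_module:
  "unital_right_module R M \<Longrightarrow> unital_left_module (opposite_ring R) M"
  by (simp add: unital_left_module_def unital_right_module_def opposite_ring_unital
      unital_left_module_axioms_def unital_right_module_axioms_def)

lemma opposite_unital_right_module:
  "unital_left_module R M \<Longrightarrow> unital_right_module (opposite_ring R) M"
  by (simp add: unital_left_module_def unital_right_module_def opposite_ring_unital
      unital_left_module_axioms_def unital_right_module_axioms_def)

lemma graded_left_module_flat:
  assumes M: "unital_left_module R M" and op: "graded_unital_module (opposite_ring R) G M D"
  shows "flat_left_module TYPE('p) TYPE('q) R M"
  unfolding flat_left_module_def
proof (intro conjI allI impI M)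
  fix P :: "('a, 'p) module" and Q :: "('a, 'q) module" and f
  assume *: "unital_right_module R P \<and> unital_right_module R Q \<and> f \<in> module_hom R P Q \<and> inj_on f (carrier P)"
  interpret op: graded_unital_module "opposite_ring R" G M D by fact
  have PQ: "flat_test (opposite_ring R) G M D P" "flat_test (opposite_ring R) G M D Q"
    using * by (simp_all add: op.flat_test_left_module opposite_unital_left_module)
  interpret Q: flat_test "opposite_ring R" G M D Q by fact
  have T: "tensor_modules R P M" "tensor_modules R Q M"
    using * M by (simp_all add: tensor_modules_def unital_right_module_def unital_left_module_def)
  have T': "tensor_modules (opposite_ring R) M P"
    using PQ(1) flat_test.axioms(2) op.Mod.right_module_axioms
    by (simp add: tensor_modules_def flat_test_def unital_left_module_def)
  show "inj_on (tensor_map R Q M f (\<lambda>x. x)) (carrier (tensor_product R P M))"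
  proof (rule inj_on_tensor_map[OF T])
    show "f \<in> carrier P \<rightarrow> carrier Q" using * module_hom_carrier by blast
    fix z assume z: "Poly_Mapping.keys z \<subseteq> carrier P \<times> carrier M"
      and ext: "frag_extend (\<lambda>(x, y). frag_of (f x, y)) z \<in> tensor_kernel R Q M"
    have "frag_extend (\<lambda>(x, y). frag_of (x, f y)) (frag_swap z) =
        frag_swap (frag_extend (\<lambda>(x, y). frag_of (f x, y)) z)"
      using z by (induction z rule: free_Abelian_group_induct[consumes 1, case_names zero diff single])
        (auto simp: frag_extend_diff)
    then have "frag_extend (\<lambda>(x, y). frag_of (x, f y)) (frag_swap z) \<in> tensor_kernel (opposite_ring R) M Q"
      using frag_swap_tensor_kernel[OF T(2) ext] by simp
    then have "frag_swap z \<in> tensor_kernel (opposite_ring R) M P"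
      using * keys_frag_swap[OF z] by (intro Q.kernel_reflect[OF PQ(1)]) simp_all
    from frag_swap_tensor_kernel[OF T' this] show "z \<in> tensor_kernel R P M" by simp
  qed auto
qed


section \<open>Graded regularity from the relations of a Leavitt path algebra\<close>

text \<open>
  Families of vertices, edges and ghost edges that satisfy the defining relations, except that the one at
  regular vertices is omitted, as graded regularity does not depend on it.
\<close>

locale leavitt_family = graded_ring R G for R :: "('a, 'r) ring_scheme" (structure) and G +
  fixes E :: "('v, 'e) pre_digraph" and scale :: "'k :: field \<Rightarrow> 'a \<Rightarrow> 'a" (infixr \<open>\<star>\<close> 75)
    and V :: "'v \<Rightarrow> 'a" and Ed :: "'e \<Rightarrow> 'a" and Gh :: "'e \<Rightarrow> 'a"
  assumes wf: "wf_digraph E"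
    and scale_closed [simp]: "x \<in> carrier R \<Longrightarrow> k \<star> x \<in> carrier R"
    and scale_add_right: "\<lbrakk>x \<in> carrier R; y \<in> carrier R\<rbrakk> \<Longrightarrow> k \<star> (x \<oplus> y) = k \<star> x \<oplus> k \<star> y"
    and scale_add_left: "x \<in> carrier R \<Longrightarrow> (k + l) \<star> x = k \<star> x \<oplus> l \<star> x"
    and scale_scale: "x \<in> carrier R \<Longrightarrow> k \<star> l \<star> x = (k * l) \<star> x"
    and scale_one [simp]: "x \<in> carrier R \<Longrightarrow> 1 \<star> x = x"
    and scale_mult_left: "\<lbrakk>x \<in> carrier R; y \<in> carrier R\<rbrakk> \<Longrightarrow> (k \<star> x) \<otimes> y = k \<star> (x \<otimes> y)"
    and scale_mult_right: "\<lbrakk>x \<in> carrier R; y \<in> carrier R\<rbrakk> \<Longrightarrow> x \<otimes> k \<star> y = k \<star> (x \<otimes> y)"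
    and scale_G: "x \<in> G n \<Longrightarrow> k \<star> x \<in> G n"
    and V_G: "v \<in> verts E \<Longrightarrow> V v \<in> G 0"
    and Ed_G: "e \<in> arcs E \<Longrightarrow> Ed e \<in> G 1"
    and Gh_G: "e \<in> arcs E \<Longrightarrow> Gh e \<in> G (- 1)"
    and V_V: "\<lbrakk>v \<in> verts E; w \<in> verts E\<rbrakk> \<Longrightarrow> V v \<otimes> V w = (if v = w then V v else \<zero>)"
    and V_Ed: "e \<in> arcs E \<Longrightarrow> V (tail E e) \<otimes> Ed e = Ed e"
    and Ed_V: "e \<in> arcs E \<Longrightarrow> Ed e \<otimes> V (head E e) = Ed e"
    and V_Gh: "e \<in> arcs E \<Longrightarrow> V (head E e) \<otimes> Gh e = Gh e"
    and Gh_V: "e \<in> arcs E \<Longrightarrow> Gh e \<otimes> V (tail E e) = Gh e"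
    and Gh_Ed: "\<lbrakk>e \<in> arcs E; f \<in> arcs E\<rbrakk> \<Longrightarrow> Gh e \<otimes> Ed f = (if e = f then V (head E e) else \<zero>)"
begin

lemma verts [simp]: "e \<in> arcs E \<Longrightarrow> tail E e \<in> verts E" "e \<in> arcs E \<Longrightarrow> head E e \<in> verts E"
  using wf by (simp_all add: wf_digraph_def)

lemma generators_carrier [simp]:
  "v \<in> verts E \<Longrightarrow> V v \<in> carrier R" "e \<in> arcs E \<Longrightarrow> Ed e \<in> carrier R" "e \<in> arcs E \<Longrightarrow> Gh e \<in> carrier R"
  using V_G Ed_G Gh_G by (blast intro: D_carrier)+

lemma scale_zero_left [simp]: "x \<in> carrier R \<Longrightarrow> 0 \<star> x = \<zero>"
  using scale_add_left[of x 0 0] by simp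

lemma scale_zero_right [simp]: "k \<star> \<zero> = \<zero>"
  using scale_add_right[of \<zero> \<zero> k] by simp

lemma scale_uminus: "x \<in> carrier R \<Longrightarrow> (- k) \<star> x = \<ominus> (k \<star> x)"
  using scale_add_left[of x "- k" k] by (intro minus_equality[symmetric]) simp_all


subsection \<open>Linear spans\<close>

text \<open>The linear span of a set.\<close>

inductive_set kspan :: "'a set \<Rightarrow> 'a set" for S where
  zero: "\<zero> \<in> kspan S"
| step: "\<lbrakk>s \<in> S; x \<in> kspan S\<rbrakk> \<Longrightarrow> k \<star> s \<oplus> x \<in> kspan S"

lemma kspan_carrier: "\<lbrakk>x \<in> kspan S; S \<subseteq> carrier R\<rbrakk> \<Longrightarrow> x \<in> carrier R"
  by (induction rule: kspan.induct) auto

lemma kspan_add: "\<lbrakk>x \<in> kspan S; y \<in> kspan S; S \<subseteq> carrier R\<rbrakk> \<Longrightarrow> x \<oplus> y \<in> kspan S"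
proof (induction rule: kspan.induct)
  case zero
  then show ?case by (simp add: kspan_carrier)
next
  case (step s x k)
  then have "k \<star> s \<oplus> (x \<oplus> y) \<in> kspan S" by (intro kspan.step) auto
  moreover have "x \<in> carrier R" "y \<in> carrier R" "s \<in> carrier R"
    using step by (auto intro: kspan_carrier)
  ultimately show ?case by (simp add: a_assoc)
qed

lemma kspan_scale: "\<lbrakk>x \<in> kspan S; S \<subseteq> carrier R\<rbrakk> \<Longrightarrow> c \<star> x \<in> kspan S"
proof (induction rule: kspan.induct)
  case (step s x k)
  then have "(c * k) \<star> s \<oplus> c \<star> x \<in> kspan S" by (intro kspan.step) auto
  moreover have "x \<in> carrier R" "s \<in> carrier R" using step by (auto intro: kspan_carrier)
  ultimately show ?case by (simp add: scale_add_right scale_scale)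
qed (simp add: kspan.zero)

lemma kspan_minus:
  assumes "x \<in> kspan S" "y \<in> kspan S" "S \<subseteq> carrier R"
  shows "x \<ominus> y \<in> kspan S"
proof -
  have "x \<oplus> (- 1) \<star> y \<in> kspan S" using assms by (intro kspan_add kspan_scale)
  then show ?thesis using kspan_carrier[OF assms(2,3)] by (simp add: scale_uminus minus_eq)
qed

lemma kspan_incl: "s \<in> S \<Longrightarrow> S \<subseteq> carrier R \<Longrightarrow> s \<in> kspan S"
  using kspan.step[of s S \<zero> 1] kspan.zero[of S] by auto

lemma kspan_mono: "\<lbrakk>x \<in> kspan S; S \<subseteq> T\<rbrakk> \<Longrightarrow> x \<in> kspan T"
  by (induction rule: kspan.induct) (auto intro: kspan.intros)

lemma kspan_mult:
  assumes x: "x \<in> kspan S" and y: "y \<in> kspan T"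
    and C: "S \<subseteq> carrier R" "T \<subseteq> carrier R" "U \<subseteq> carrier R"
    and ST: "\<And>s t. s \<in> S \<Longrightarrow> t \<in> T \<Longrightarrow> s \<otimes> t \<in> kspan U"
  shows "x \<otimes> y \<in> kspan U"
  using x
proof (induction rule: kspan.induct)
  case zero
  then show ?case using kspan_carrier[OF y C(2)] by (simp add: kspan.zero)
next
  case (step s x k)
  have sC: "s \<in> carrier R" using step C by auto
  have "s \<otimes> y \<in> kspan U"
    using y
  proof (induction rule: kspan.induct)
    case zero
    then show ?case using sC by (simp add: kspan.zero)
  next
    case (step t y l)
    then have "l \<star> (s \<otimes> t) \<oplus> s \<otimes> y \<in> kspan U"
      by (intro kspan_add[OF kspan_scale[OF ST]] \<open>s \<in> S\<close> step.hyps(1) step.IH C(3))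
    moreover have "t \<in> carrier R" "y \<in> carrier R"
      using step.hyps(1) C(2) kspan_carrier[OF step.hyps(2) C(2)] by auto
    ultimately show ?case using sC by (simp add: r_distr scale_mult_right)
  qed
  then have "k \<star> (s \<otimes> y) \<oplus> x \<otimes> y \<in> kspan U"
    using step.IH C by (intro kspan_add kspan_scale)
  moreover have "x \<in> carrier R" "y \<in> carrier R"
    using kspan_carrier[OF step.hyps(2) C(1)] kspan_carrier[OF y C(2)] by auto
  ultimately show ?case using sC by (simp add: l_distr scale_mult_left)
qed


subsection \<open>Paths\<close>

text \<open>
  \<open>pth l a a' v\<close> means that \<open>a\<close> is the ring element of a path of length \<open>l\<close> with range \<open>v\<close>, and \<open>a'\<close>
  the element of the corresponding ghost path.
\<close>

inductive pth :: "nat \<Rightarrow> 'a \<Rightarrow> 'a \<Rightarrow> 'v \<Rightarrow> bool" where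
  vertex: "v \<in> verts E \<Longrightarrow> pth 0 (V v) (V v) v"
| edge: "\<lbrakk>pth l a a' (tail E e); e \<in> arcs E\<rbrakk> \<Longrightarrow> pth (Suc l) (a \<otimes> Ed e) (Gh e \<otimes> a') (head E e)"

lemma pth_G: "pth l a a' v \<Longrightarrow> a \<in> G (int l) \<and> a' \<in> G (- int l) \<and> v \<in> verts E"
proof (induction rule: pth.induct)
  case (edge l a a' e)
  then show ?case
    using G_mult[of a "int l" "Ed e" 1] G_mult[of "Gh e" "- 1" a' "- int l"] Ed_G[of e] Gh_G[of e]
    by (simp add: algebra_simps)
qed (simp add: V_G)

lemma pth_carrier: "pth l a a' v \<Longrightarrow> a \<in> carrier R \<and> a' \<in> carrier R \<and> v \<in> verts E \<and> V v \<in> carrier R"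
  using pth_G by (metis D_carrier V_G)

lemma pth_V: "pth l a a' v \<Longrightarrow> a \<otimes> V v = a \<and> V v \<otimes> a' = a'"
proof (induction rule: pth.induct)
  case (edge l a a' e)
  then have "a \<in> carrier R" "a' \<in> carrier R" by (auto dest: pth_carrier)
  then show ?case using edge.hyps(2) by (simp add: m_assoc Ed_V) (simp add: m_assoc[symmetric] V_Gh)
qed (simp add: V_V)

lemma pth_ghost_self: "pth l a a' v \<Longrightarrow> a' \<otimes> a = V v"
proof (induction rule: pth.induct)
  case (edge l a a' e)
  then have C: "a \<in> carrier R" "a' \<in> carrier R" by (auto dest: pth_carrier)
  have "(Gh e \<otimes> a') \<otimes> (a \<otimes> Ed e) = Gh e \<otimes> ((a' \<otimes> a) \<otimes> Ed e)"
    using C edge.hyps(2) by (simp add: m_assoc)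
  then show ?case using edge by (simp add: V_Ed Gh_Ed)
qed (simp add: V_V)

text \<open>Different paths of the same length are orthogonal.\<close>

lemma pth_ghost: "\<lbrakk>pth l a a' v; pth l b b' w; (a, a', v) \<noteq> (b, b', w)\<rbrakk> \<Longrightarrow> a' \<otimes> b = \<zero>"
proof (induction arbitrary: b b' w rule: pth.induct)
  case (vertex v)
  from vertex.prems(1) show ?case using vertex by cases (auto simp: V_V)
next
  case (edge l a a' e)
  have C: "a \<in> carrier R" "a' \<in> carrier R" using edge by (auto dest: pth_carrier)
  from edge.prems(1) show ?case
  proof cases
    case (edge c c' f)
    have C': "c \<in> carrier R" "c' \<in> carrier R" using edge by (auto dest: pth_carrier)
    have eq: "(Gh e \<otimes> a') \<otimes> b = Gh e \<otimes> ((a' \<otimes> c) \<otimes> Ed f)"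
      using C C' \<open>e \<in> arcs E\<close> edge by (simp add: m_assoc)
    show ?thesis
    proof (cases "(a, a', tail E e) = (c, c', tail E f)")
      case True
      then have "a' \<otimes> c = V (tail E f)" using pth_ghost_self edge.hyps(1) by auto
      moreover have "e \<noteq> f" using \<open>(a \<otimes> Ed e, Gh e \<otimes> a', head E e) \<noteq> (b, b', w)\<close> True edge by auto
      ultimately show ?thesis using eq edge \<open>e \<in> arcs E\<close> by (simp add: V_Ed Gh_Ed)
    next
      case False
      then have "a' \<otimes> c = \<zero>" using edge.IH local.edge by blast
      then show ?thesis using eq edge \<open>e \<in> arcs E\<close> by simp
    qed
  qed
qed

text \<open>A path that is longer than \<open>l\<close> consists of a path of length \<open>l\<close>, an edge and a further path.\<close>

lemma pth_split:
  "\<lbrakk>pth m b b' w; l < m\<rbrakk> \<Longrightarrow> \<exists>c c' f d d'. pth l c c' (tail E f) \<and> f \<in> arcs E \<and>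
     pth (m - l - 1) d d' w \<and> V (head E f) \<otimes> d = d \<and> d' \<otimes> V (head E f) = d' \<and>
     b = c \<otimes> (Ed f \<otimes> d) \<and> b' = (d' \<otimes> Gh f) \<otimes> c'"
proof (induction rule: pth.induct)
  case (edge m b b' e)
  show ?case
  proof (cases "l = m")
    case True
    with edge show ?thesis
      by (intro exI[of _ b] exI[of _ b'] exI[of _ e] exI[of _ "V (head E e)"])
        (auto simp: Ed_V V_Gh V_V intro: pth.vertex)
  next
    case False
    then have "l < m" using edge.prems by simp
    then obtain c c' f d d' where *: "pth l c c' (tail E f)" "f \<in> arcs E"
      "pth (m - l - 1) d d' (tail E e)" "V (head E f) \<otimes> d = d" "d' \<otimes> V (head E f) = d'"
      "b = c \<otimes> (Ed f \<otimes> d)" "b' = (d' \<otimes> Gh f) \<otimes> c'"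
      using edge.IH by blast
    have C: "c \<in> carrier R" "c' \<in> carrier R" "d \<in> carrier R" "d' \<in> carrier R"
      using *(1,3) by (auto dest: pth_carrier)
    have "pth (Suc m - l - 1) (d \<otimes> Ed e) (Gh e \<otimes> d') (head E e)"
      using pth.edge[OF *(3) edge.hyps(2)] \<open>l < m\<close> by (simp add: Suc_diff_Suc)
    moreover have "V (head E f) \<otimes> (d \<otimes> Ed e) = d \<otimes> Ed e" "Gh e \<otimes> d' \<otimes> V (head E f) = Gh e \<otimes> d'"
      using C *(2,4,5) edge.hyps(2) by (simp_all add: m_assoc[symmetric]) (simp add: m_assoc)
    moreover have "b \<otimes> Ed e = c \<otimes> (Ed f \<otimes> (d \<otimes> Ed e))" "Gh e \<otimes> b' = (Gh e \<otimes> d' \<otimes> Gh f) \<otimes> c'"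
      using C *(2,6,7) edge.hyps(2) by (simp_all add: m_assoc)
    ultimately show ?thesis using *(1,2) by blast
  qed
qed simp


subsection \<open>Rows\<close>

text \<open>The ghost paths and the paths of a given length with a given range.\<close>

definition Row :: "nat \<Rightarrow> 'v \<Rightarrow> 'a set" where
  "Row j v = {b'. \<exists>b. pth j b b' v}"

definition Col :: "nat \<Rightarrow> 'v \<Rightarrow> 'a set" where
  "Col l v = {a. \<exists>a'. pth l a a' v}"

lemma Row_carrier: "Row j v \<subseteq> carrier R" and Col_carrier: "Col l v \<subseteq> carrier R"
  by (auto simp: Row_def Col_def dest: pth_carrier)

lemmas row_carrier = kspan_carrier[OF _ Row_carrier]
lemmas col_carrier = kspan_carrier[OF _ Col_carrier]

lemma V_row: "\<lbrakk>\<rho> \<in> kspan (Row j v); v \<in> verts E\<rbrakk> \<Longrightarrow> V v \<otimes> \<rho> = \<rho>"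
proof (induction rule: kspan.induct)
  case (step s x k)
  then have "s \<in> carrier R" "x \<in> carrier R" "V v \<otimes> s = s"
    using row_carrier[OF step.hyps(2)] step.hyps(1) by (auto simp: Row_def dest: pth_V pth_carrier)
  then show ?case using step by (simp add: r_distr scale_mult_right)
qed simp

lemma row_mult_path:
  assumes "pth j b b' v" "\<rho> \<in> kspan (Row j v)"
  shows "\<exists>k. \<rho> \<otimes> b = k \<star> V v"
  using assms(2)
proof (induction rule: kspan.induct)
  case zero
  then show ?case using pth_carrier[OF assms(1)] by (intro exI[of _ 0]) simp
next
  case (step s x k)
  then obtain l where l: "x \<otimes> b = l \<star> V v" by blast
  obtain c where c: "pth j c s v" using step by (auto simp: Row_def)
  note C = pth_carrier[OF assms(1)] pth_carrier[OF c] row_carrier[OF step.hyps(2)]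
  have "\<exists>m. s \<otimes> b = m \<star> V v"
  proof (cases "(c, s, v) = (b, b', v)")
    case True
    then show ?thesis using pth_ghost_self[OF assms(1)] C by (intro exI[of _ 1]) simp
  next
    case False
    then show ?thesis using pth_ghost[OF c assms(1)] C by (intro exI[of _ 0]) simp
  qed
  then obtain m where "s \<otimes> b = m \<star> V v" by blast
  then have "(k \<star> s \<oplus> x) \<otimes> b = (k * m + l) \<star> V v"
    using C l by (simp add: l_distr scale_mult_left scale_scale scale_add_left)
  then show ?case by blast
qed

lemma row_mult_path_other:
  assumes "pth j b b' v" "u \<noteq> v" "\<rho> \<in> kspan (Row j u)"
  shows "\<rho> \<otimes> b = \<zero>"
  using assms(3)
proof (induction rule: kspan.induct)
  case zero
  then show ?case using pth_carrier[OF assms(1)] by simp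
next
  case (step s x k)
  then obtain c where c: "pth j c s u" by (auto simp: Row_def)
  then have "s \<otimes> b = \<zero>" using pth_ghost[OF c assms(1)] assms(2) by simp
  then show ?case
    using step pth_carrier[OF assms(1)] pth_carrier[OF c] row_carrier[OF step.hyps(2)]
    by (simp add: l_distr scale_mult_left)
qed

text \<open>Linear combinations of distinct ghost paths.\<close>

inductive row_comb :: "nat \<Rightarrow> 'v \<Rightarrow> ('a \<times> 'a) set \<Rightarrow> 'a \<Rightarrow> bool" for j v where
  empty: "row_comb j v {} \<zero>"
| insert: "\<lbrakk>row_comb j v B \<rho>; pth j b b' v; (b, b') \<notin> B\<rbrakk> \<Longrightarrow> row_comb j v (insert (b, b') B) (k \<star> b' \<oplus> \<rho>)"

lemma row_comb_carrier: "row_comb j v B \<rho> \<Longrightarrow> \<rho> \<in> carrier R"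
  by (induction rule: row_comb.induct) (auto dest: pth_carrier)

lemma row_comb_add:
  "\<lbrakk>row_comb j v B \<rho>; pth j b b' v\<rbrakk> \<Longrightarrow> row_comb j v (insert (b, b') B) (k \<star> b' \<oplus> \<rho>)"
proof (induction rule: row_comb.induct)
  case empty
  then show ?case using row_comb.insert[OF row_comb.empty] by simp
next
  case (insert B \<rho> c c' l)
  note C = pth_carrier[OF insert.hyps(2)] pth_carrier[OF insert.prems] row_comb_carrier[OF insert.hyps(1)]
  show ?case
  proof (cases "(b, b') = (c, c')")
    case True
    then have "k \<star> b' \<oplus> (l \<star> c' \<oplus> \<rho>) = (k + l) \<star> c' \<oplus> \<rho>"
      using C by (simp add: scale_add_left a_assoc)
    then show ?thesis using row_comb.insert[OF insert.hyps, of "k + l"] True by simp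
  next
    case False
    then have "row_comb j v (insert (c, c') (insert (b, b') B)) (l \<star> c' \<oplus> (k \<star> b' \<oplus> \<rho>))"
      using insert.hyps(3) by (intro row_comb.insert[OF insert.IH[OF insert.prems] insert.hyps(2)]) auto
    then show ?thesis using C by (simp add: insert_commute a_lcomm)
  qed
qed

lemma row_comb_exists: "\<rho> \<in> kspan (Row j v) \<Longrightarrow> \<exists>B. row_comb j v B \<rho>"
  by (induction rule: kspan.induct) (auto simp: Row_def intro: row_comb.empty row_comb_add)

lemma row_comb_mult_path:
  "\<lbrakk>row_comb j v B \<rho>; pth j b b' v; (b, b') \<notin> B\<rbrakk> \<Longrightarrow> \<rho> \<otimes> b = \<zero>"
proof (induction rule: row_comb.induct)
  case empty
  then show ?case by (auto dest: pth_carrier)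
next
  case (insert B \<rho> c c' l)
  then have "c' \<otimes> b = \<zero>" by (intro pth_ghost[OF insert.hyps(2) insert.prems(1)]) auto
  then show ?case
    using insert pth_carrier[OF insert.hyps(2)] pth_carrier[OF insert.prems(1)]
      row_comb_carrier[OF insert.hyps(1)]
    by (simp add: l_distr scale_mult_left)
qed

lemma row_nonzero:
  assumes "\<rho> \<in> kspan (Row j v)" "\<rho> \<noteq> \<zero>"
  shows "\<exists>b b' k. pth j b b' v \<and> k \<noteq> 0 \<and> \<rho> \<otimes> b = k \<star> V v"
proof -
  obtain B where "row_comb j v B \<rho>" using row_comb_exists[OF assms(1)] by blast
  then show ?thesis using assms(2)
  proof (induction rule: row_comb.induct)
    case (insert B \<rho> b b' k)
    note C = pth_carrier[OF insert.hyps(2)] row_comb_carrier[OF insert.hyps(1)]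
    show ?case
    proof (cases "k = 0")
      case True
      then have "k \<star> b' \<oplus> \<rho> = \<rho>" using C by simp
      then show ?thesis using insert.IH insert.prems by simp
    next
      case False
      have "(k \<star> b' \<oplus> \<rho>) \<otimes> b = k \<star> V v"
        using C row_comb_mult_path[OF insert.hyps(1,2,3)] pth_ghost_self[OF insert.hyps(2)]
        by (simp add: l_distr scale_mult_left)
      then show ?thesis using False insert.hyps(2) by blast
    qed
  qed simp
qed

text \<open>
  Linear combinations of monomials \<open>ab'\<close> with paths of fixed lengths, sorted by their left factors;
  the set records these left factors.
\<close>

inductive rows :: "nat \<Rightarrow> nat \<Rightarrow> ('a \<times> 'a \<times> 'v) set \<Rightarrow> 'a \<Rightarrow> bool" for l j where
  empty: "rows l j {} \<zero>"
| insert: "\<lbrakk>rows l j P y; pth l a a' v; (a, a', v) \<notin> P; \<rho> \<in> kspan (Row j v)\<rbrakk> \<Longrightarrow>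
     rows l j (insert (a, a', v) P) (a \<otimes> \<rho> \<oplus> y)"

lemma rows_carrier: "rows l j P y \<Longrightarrow> y \<in> carrier R"
  by (induction rule: rows.induct) (auto dest: pth_carrier row_carrier)

lemma rows_finite: "rows l j P y \<Longrightarrow> finite P"
  by (induction rule: rows.induct) auto

lemma rows_add:
  "\<lbrakk>rows l j P y; pth l a a' v; \<rho> \<in> kspan (Row j v)\<rbrakk> \<Longrightarrow> rows l j (insert (a, a', v) P) (a \<otimes> \<rho> \<oplus> y)"
proof (induction rule: rows.induct)
  case empty
  then show ?case using rows.insert[OF rows.empty] by simp
next
  case (insert P y c c' w \<sigma>)
  note C = pth_carrier[OF insert.hyps(2)] pth_carrier[OF insert.prems(1)] rows_carrier[OF insert.hyps(1)]
    row_carrier[OF insert.hyps(4)] row_carrier[OF insert.prems(2)]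
  show ?case
  proof (cases "(a, a', v) = (c, c', w)")
    case True
    then have "a \<otimes> \<rho> \<oplus> (c \<otimes> \<sigma> \<oplus> y) = c \<otimes> (\<rho> \<oplus> \<sigma>) \<oplus> y"
      using C by (simp add: r_distr a_assoc)
    moreover have "\<rho> \<oplus> \<sigma> \<in> kspan (Row j w)"
      using insert True by (intro kspan_add Row_carrier) auto
    ultimately show ?thesis using rows.insert[OF insert.hyps(1,2,3)] True by simp
  next
    case False
    then have "rows l j (insert (c, c', w) (insert (a, a', v) P)) (c \<otimes> \<sigma> \<oplus> (a \<otimes> \<rho> \<oplus> y))"
      using insert.hyps(3,4) by (intro rows.insert[OF insert.IH[OF insert.prems] insert.hyps(2)]) auto
    then show ?thesis using C by (simp add: insert_commute a_lcomm)
  qed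
qed

lemma ghost_rows: "\<lbrakk>rows l j P y; pth l a a' v; (a, a', v) \<notin> P\<rbrakk> \<Longrightarrow> a' \<otimes> y = \<zero>"
proof (induction rule: rows.induct)
  case empty
  then show ?case by (auto dest: pth_carrier)
next
  case (insert P y c c' w \<sigma>)
  note C = pth_carrier[OF insert.hyps(2)] pth_carrier[OF insert.prems(1)] rows_carrier[OF insert.hyps(1)]
    row_carrier[OF insert.hyps(4)]
  have "a' \<otimes> c = \<zero>" using insert by (intro pth_ghost[OF insert.prems(1) insert.hyps(2)]) auto
  then show ?case using C insert by (simp add: r_distr m_assoc[symmetric])
qed

lemma rows_mult_path:
  assumes b: "pth j b b' v" and "rows l j P y"
  shows "y \<otimes> b \<in> kspan (Col l v)"
  using assms(2)
proof (induction rule: rows.induct)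
  case empty
  then show ?case using pth_carrier[OF b] by (simp add: kspan.zero)
next
  case (insert P y a a' u \<rho>)
  note C = pth_carrier[OF insert.hyps(2)] pth_carrier[OF b] rows_carrier[OF insert.hyps(1)]
    row_carrier[OF insert.hyps(4)]
  have eq: "(a \<otimes> \<rho> \<oplus> y) \<otimes> b = a \<otimes> (\<rho> \<otimes> b) \<oplus> y \<otimes> b" using C by (simp add: l_distr m_assoc)
  show ?case
  proof (cases "u = v")
    case True
    then obtain k where "\<rho> \<otimes> b = k \<star> V v" using row_mult_path[OF b] insert.hyps(4) by blast
    then have "(a \<otimes> \<rho> \<oplus> y) \<otimes> b = k \<star> a \<oplus> y \<otimes> b"
      using C True pth_V[OF insert.hyps(2)] by (simp add: eq scale_mult_right)
    then show ?thesis
      using insert True by (auto simp: Col_def intro!: kspan.step)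
  next
    case False
    then have "\<rho> \<otimes> b = \<zero>" using row_mult_path_other[OF b] insert.hyps(4) by blast
    then show ?thesis using C insert.IH by (simp add: eq)
  qed
qed

text \<open>Subtracting multiples of a row from all rows does not introduce new left factors.\<close>

lemma rows_eliminate:
  assumes b: "pth j b b' v" and \<rho>: "\<rho> \<in> kspan (Row j v)" and "rows l j P y"
  shows "rows l j P (y \<ominus> c \<star> (y \<otimes> b) \<otimes> \<rho>)"
  using assms(3)
proof (induction rule: rows.induct)
  case empty
  then show ?case using pth_carrier[OF b] row_carrier[OF \<rho>] rows.empty by (simp add: minus_eq minus_zero_group)
next
  case (insert P y a a' u \<sigma>)
  note C = pth_carrier[OF insert.hyps(2)] pth_carrier[OF b] rows_carrier[OF insert.hyps(1)]
    row_carrier[OF insert.hyps(4)] row_carrier[OF \<rho>]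
  have "\<exists>\<tau>\<in>kspan (Row j u). a \<otimes> \<sigma> \<ominus> c \<star> (a \<otimes> (\<sigma> \<otimes> b)) \<otimes> \<rho> = a \<otimes> \<tau>"
  proof (cases "u = v")
    case True
    then obtain k where k: "\<sigma> \<otimes> b = k \<star> V v" using row_mult_path[OF b] insert.hyps(4) by blast
    have "c \<star> (a \<otimes> (\<sigma> \<otimes> b)) \<otimes> \<rho> = a \<otimes> ((c * k) \<star> \<rho>)"
      using C True pth_V[OF insert.hyps(2)]
      by (simp add: k scale_mult_right scale_mult_left scale_scale)
    then have "a \<otimes> \<sigma> \<ominus> c \<star> (a \<otimes> (\<sigma> \<otimes> b)) \<otimes> \<rho> = a \<otimes> (\<sigma> \<ominus> (c * k) \<star> \<rho>)"
      using C by (simp add: minus_eq r_distr r_minus)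
    moreover have "\<sigma> \<ominus> (c * k) \<star> \<rho> \<in> kspan (Row j u)"
      using insert.hyps(4) \<rho> True by (intro kspan_minus kspan_scale Row_carrier) auto
    ultimately show ?thesis by blast
  next
    case False
    then have "\<sigma> \<otimes> b = \<zero>" using row_mult_path_other[OF b] insert.hyps(4) by blast
    then show ?thesis using C insert.hyps(4) by (intro bexI[of _ \<sigma>]) (simp_all add: minus_eq minus_zero_group)
  qed
  then obtain \<tau> where \<tau>: "\<tau> \<in> kspan (Row j u)" "a \<otimes> \<sigma> \<ominus> c \<star> (a \<otimes> (\<sigma> \<otimes> b)) \<otimes> \<rho> = a \<otimes> \<tau>" by blast
  have "(a \<otimes> \<sigma> \<oplus> y) \<ominus> c \<star> ((a \<otimes> \<sigma> \<oplus> y) \<otimes> b) \<otimes> \<rho> =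
      (a \<otimes> \<sigma> \<oplus> y) \<ominus> (c \<star> (a \<otimes> (\<sigma> \<otimes> b)) \<otimes> \<rho> \<oplus> c \<star> (y \<otimes> b) \<otimes> \<rho>)"
    using C by (simp add: l_distr m_assoc scale_add_right)
  also have "\<dots> = (a \<otimes> \<sigma> \<ominus> c \<star> (a \<otimes> (\<sigma> \<otimes> b)) \<otimes> \<rho>) \<oplus> (y \<ominus> c \<star> (y \<otimes> b) \<otimes> \<rho>)"
    using C by (simp add: minus_eq minus_add a_ac)
  finally show ?case using rows.insert[OF insert.IH insert.hyps(2,3) \<tau>(1)] by (simp only: \<tau>(2))
qed


subsection \<open>Monomials\<close>

text \<open>The monomials of degree \<open>n\<close> whose left factor has a length between \<open>l\<close> and \<open>L\<close>.\<close>

definition Mon :: "int \<Rightarrow> nat \<Rightarrow> nat \<Rightarrow> 'a set" where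
  "Mon n L l = {a \<otimes> b' | a a' b b' v i j. pth i a a' v \<and> pth j b b' v \<and> l \<le> i \<and> i \<le> L \<and> int i - int j = n}"

lemma MonI:
  "\<lbrakk>pth i a a' v; pth j b b' v; l \<le> i; i \<le> L; int i - int j = n\<rbrakk> \<Longrightarrow> a \<otimes> b' \<in> Mon n L l"
  unfolding Mon_def by blast

lemma Mon_carrier: "Mon n L l \<subseteq> carrier R"
  by (auto simp: Mon_def dest: pth_carrier)

lemmas mon_carrier = kspan_carrier[OF _ Mon_carrier]

lemma Mon_G: "x \<in> Mon n L l \<Longrightarrow> x \<in> G n"
proof -
  assume "x \<in> Mon n L l"
  then obtain a a' b b' v i j where "x = a \<otimes> b'" "pth i a a' v" "pth j b b' v" "int i - int j = n"
    by (auto simp: Mon_def)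
  then show "x \<in> G n" using G_mult[of a "int i" b' "- int j"] pth_G by fastforce
qed

lemma kspan_Mon_G: "x \<in> kspan (Mon n L l) \<Longrightarrow> x \<in> G n"
  by (induction rule: kspan.induct) (auto intro: scale_G Mon_G)

lemma Mon_mono: "L \<le> L' \<Longrightarrow> l' \<le> l \<Longrightarrow> Mon n L l \<subseteq> Mon n L' l'"
  unfolding Mon_def by fastforce

lemma Mon_empty: "L < l \<Longrightarrow> Mon n L l = {}"
  by (auto simp: Mon_def)

lemma kspan_empty: "x \<in> kspan {} \<Longrightarrow> x = \<zero>"
  by (induction rule: kspan.induct) auto

text \<open>The edges with source \<open>v\<close>, and the idempotent \<open>\<Sum> ff'\<close> of a finite set of such edges.\<close>

definition out :: "'v \<Rightarrow> 'e set" where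
  "out v = {f \<in> arcs E. tail E f = v}"

definition edge_sum :: "'e set \<Rightarrow> 'a" where
  "edge_sum F = finsum R (\<lambda>f. Ed f \<otimes> Gh f) F"

lemma edge_sum_G: "F \<subseteq> out v \<Longrightarrow> edge_sum F \<in> G 0"
  unfolding edge_sum_def
  using G_mult[OF Ed_G Gh_G] by (intro finsum_in_subgroup[OF subgroup_D]) (auto simp: out_def)

lemma edge_sum_carrier: "F \<subseteq> out v \<Longrightarrow> edge_sum F \<in> carrier R"
  by (rule D_carrier[OF edge_sum_G])

lemma edge_sum_Ed:
  assumes F: "finite F" "F \<subseteq> out v" and f: "f \<in> F"
  shows "edge_sum F \<otimes> Ed f = Ed f"
proof -
  have C: "g \<in> arcs E" if "g \<in> F" for g using F that by (auto simp: out_def)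
  have "edge_sum F \<otimes> Ed f = finsum R (\<lambda>g. Ed g \<otimes> Gh g \<otimes> Ed f) F"
    unfolding edge_sum_def using F(1) f C by (intro finsum_ldistr) auto
  also have "\<dots> = finsum R (\<lambda>g. if f = g then Ed g else \<zero>) F"
    using f C by (intro finsum_cong') (auto simp: m_assoc Gh_Ed Ed_V)
  also have "\<dots> = Ed f" using F(1) f C by (intro finsum_singleton) auto
  finally show ?thesis .
qed

lemma Gh_edge_sum:
  assumes F: "finite F" "F \<subseteq> out v" and f: "f \<in> F"
  shows "Gh f \<otimes> edge_sum F = Gh f"
proof -
  have C: "g \<in> arcs E" if "g \<in> F" for g using F that by (auto simp: out_def)
  have "Gh f \<otimes> edge_sum F = finsum R (\<lambda>g. Gh f \<otimes> (Ed g \<otimes> Gh g)) F"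
    unfolding edge_sum_def using F(1) f C by (intro finsum_rdistr) auto
  also have "\<dots> = finsum R (\<lambda>g. if f = g then Gh g else \<zero>) F"
    using f C by (intro finsum_cong') (auto simp: m_assoc[symmetric] Gh_Ed V_Gh)
  also have "\<dots> = Gh f" using F(1) f C by (intro finsum_singleton) auto
  finally show ?thesis .
qed

text \<open>
  If all monomials of \<open>x\<close> have left factors longer than \<open>a\<close>, finitely many edges suffice to cover
  the first edges after \<open>a\<close> in these left factors; similarly for right factors.
\<close>

lemma cover_left:
  assumes a: "pth l a a' v" and x: "x \<in> kspan (Mon n L (Suc l))"
  shows "\<exists>F. finite F \<and> F \<subseteq> out v \<and> (\<forall>F'. finite F' \<and> F \<subseteq> F' \<and> F' \<subseteq> out v \<longrightarrow>
    edge_sum F' \<otimes> (a' \<otimes> x) = a' \<otimes> x)"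
  using x
proof (induction rule: kspan.induct)
  case zero
  have "edge_sum F' \<otimes> (a' \<otimes> \<zero>) = a' \<otimes> \<zero>" if "F' \<subseteq> out v" for F'
    using edge_sum_carrier[OF that] pth_carrier[OF a] by simp
  then show ?case by (intro exI[of _ "{}"]) auto
next
  case (step s x k)
  from step.hyps(1) obtain b b0 c c' w i j where s: "s = b \<otimes> c'" "pth i b b0 w" "pth j c c' w" "l < i"
    by (auto simp: Mon_def)
  obtain d d' f g g' where sp: "pth l d d' (tail E f)" "f \<in> arcs E" "pth (i - l - 1) g g' w"
    "b = d \<otimes> (Ed f \<otimes> g)"
    using pth_split[OF s(2,4)] by blast
  note C = pth_carrier[OF a] pth_carrier[OF s(2)] pth_carrier[OF s(3)] pth_carrier[OF sp(1)]
    pth_carrier[OF sp(3)]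
  have xC: "x \<in> carrier R" using step.hyps(2) by (rule mon_carrier)
  obtain F where F: "finite F" "F \<subseteq> out v"
    "\<forall>F'. finite F' \<and> F \<subseteq> F' \<and> F' \<subseteq> out v \<longrightarrow> edge_sum F' \<otimes> (a' \<otimes> x) = a' \<otimes> x"
    using step.IH by blast
  have as: "a' \<otimes> s = (a' \<otimes> d) \<otimes> (Ed f \<otimes> (g \<otimes> c'))" using C sp(2) by (simp add: s(1) sp(4) m_assoc)
  have "\<exists>F0. finite F0 \<and> F0 \<subseteq> out v \<and> (\<forall>F'. finite F' \<and> F0 \<subseteq> F' \<and> F' \<subseteq> out v \<longrightarrow>
      edge_sum F' \<otimes> (a' \<otimes> s) = a' \<otimes> s)"
  proof (cases "(a, a', v) = (d, d', tail E f)")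
    case True
    then have "a' \<otimes> d = V (tail E f)" using pth_ghost_self[OF a] by auto
    then have "a' \<otimes> s = V (tail E f) \<otimes> (Ed f \<otimes> (g \<otimes> c'))" by (simp only: as)
    then have "a' \<otimes> s = Ed f \<otimes> (g \<otimes> c')"
      using C sp(2) by (simp add: m_assoc[symmetric] V_Ed)
    moreover have "edge_sum F' \<otimes> (Ed f \<otimes> (g \<otimes> c')) = Ed f \<otimes> (g \<otimes> c')"
      if "finite F'" "F' \<subseteq> out v" "f \<in> F'" for F'
      using C sp(2) edge_sum_carrier[OF that(2)] edge_sum_Ed[OF that] by (simp add: m_assoc[symmetric])
    ultimately show ?thesis using True sp(2) by (intro exI[of _ "{f}"]) (simp add: out_def)
  next
    case False
    then have "a' \<otimes> s = \<zero>" using C sp(2) pth_ghost[OF a sp(1)] by (simp add: as)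
    then show ?thesis using edge_sum_carrier[of _ v] by (intro exI[of _ "{}"]) simp
  qed
  then obtain F0 where F0: "finite F0" "F0 \<subseteq> out v"
    "\<forall>F'. finite F' \<and> F0 \<subseteq> F' \<and> F' \<subseteq> out v \<longrightarrow> edge_sum F' \<otimes> (a' \<otimes> s) = a' \<otimes> s"
    by blast
  have sC: "s \<in> carrier R" using step.hyps(1) Mon_carrier by blast
  have "edge_sum F' \<otimes> (a' \<otimes> (k \<star> s \<oplus> x)) = a' \<otimes> (k \<star> s \<oplus> x)"
    if F': "finite F'" "F \<union> F0 \<subseteq> F'" "F' \<subseteq> out v" for F'
    using C sC xC edge_sum_carrier[OF F'(3)] F(3) F0(3) F'
    by (simp add: r_distr scale_mult_right)
  then show ?case using F F0 by (intro exI[of _ "F \<union> F0"]) auto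
qed

lemma cover_right:
  assumes b: "pth j b b' v" and x: "x \<in> kspan (Mon n L (Suc l))" and n: "n = int l - int j"
  shows "\<exists>F. finite F \<and> F \<subseteq> out v \<and> (\<forall>F'. finite F' \<and> F \<subseteq> F' \<and> F' \<subseteq> out v \<longrightarrow>
    (x \<otimes> b) \<otimes> edge_sum F' = x \<otimes> b)"
  using x
proof (induction rule: kspan.induct)
  case zero
  have "(\<zero> \<otimes> b) \<otimes> edge_sum F' = \<zero> \<otimes> b" if "F' \<subseteq> out v" for F'
    using edge_sum_carrier[OF that] pth_carrier[OF b] by simp
  then show ?case by (intro exI[of _ "{}"]) auto
next
  case (step s x k)
  from step.hyps(1) obtain a a' c c' w i i' where s: "s = a \<otimes> c'" "pth i a a' w" "pth i' c c' w" "j < i'"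
    using n by (auto simp: Mon_def)
  obtain d d' f g g' where sp: "pth j d d' (tail E f)" "f \<in> arcs E" "pth (i' - j - 1) g g' w"
    "c' = (g' \<otimes> Gh f) \<otimes> d'"
    using pth_split[OF s(3,4)] by blast
  note C = pth_carrier[OF b] pth_carrier[OF s(2)] pth_carrier[OF s(3)] pth_carrier[OF sp(1)]
    pth_carrier[OF sp(3)]
  have xC: "x \<in> carrier R" using step.hyps(2) by (rule mon_carrier)
  obtain F where F: "finite F" "F \<subseteq> out v"
    "\<forall>F'. finite F' \<and> F \<subseteq> F' \<and> F' \<subseteq> out v \<longrightarrow> (x \<otimes> b) \<otimes> edge_sum F' = x \<otimes> b"
    using step.IH by blast
  have sb: "s \<otimes> b = ((a \<otimes> g') \<otimes> Gh f) \<otimes> (d' \<otimes> b)" using C sp(2) by (simp add: s(1) sp(4) m_assoc)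
  have "\<exists>F0. finite F0 \<and> F0 \<subseteq> out v \<and> (\<forall>F'. finite F' \<and> F0 \<subseteq> F' \<and> F' \<subseteq> out v \<longrightarrow>
      (s \<otimes> b) \<otimes> edge_sum F' = s \<otimes> b)"
  proof (cases "(d, d', tail E f) = (b, b', v)")
    case True
    then have "d' \<otimes> b = V (tail E f)" using pth_ghost_self[OF b] by auto
    then have "s \<otimes> b = ((a \<otimes> g') \<otimes> Gh f) \<otimes> V (tail E f)" by (simp only: sb)
    then have "s \<otimes> b = (a \<otimes> g') \<otimes> Gh f"
      using C sp(2) by (simp add: m_assoc Gh_V)
    moreover have "((a \<otimes> g') \<otimes> Gh f) \<otimes> edge_sum F' = (a \<otimes> g') \<otimes> Gh f"
      if "finite F'" "F' \<subseteq> out v" "f \<in> F'" for F'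
      using C sp(2) edge_sum_carrier[OF that(2)] Gh_edge_sum[OF that] by (simp add: m_assoc)
    ultimately show ?thesis using True sp(2) by (intro exI[of _ "{f}"]) (simp add: out_def)
  next
    case False
    then have "s \<otimes> b = \<zero>" using C sp(2) pth_ghost[OF sp(1) b] by (simp add: sb)
    then show ?thesis using edge_sum_carrier[of _ v] by (intro exI[of _ "{}"]) simp
  qed
  then obtain F0 where F0: "finite F0" "F0 \<subseteq> out v"
    "\<forall>F'. finite F' \<and> F0 \<subseteq> F' \<and> F' \<subseteq> out v \<longrightarrow> (s \<otimes> b) \<otimes> edge_sum F' = s \<otimes> b"
    by blast
  have sC: "s \<in> carrier R" using step.hyps(1) Mon_carrier by blast
  have "((k \<star> s \<oplus> x) \<otimes> b) \<otimes> edge_sum F' = (k \<star> s \<oplus> x) \<otimes> b"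
    if F': "finite F'" "F \<union> F0 \<subseteq> F'" "F' \<subseteq> out v" for F'
    using C sC xC edge_sum_carrier[OF F'(3)] F(3) F0(3) F'
    by (simp add: l_distr scale_mult_left)
  then show ?case using F F0 by (intro exI[of _ "F \<union> F0"]) auto
qed

text \<open>Inserting \<open>\<Sum> ff'\<close> between paths and ghost paths makes both longer by one edge.\<close>

lemma extend_through_edges:
  assumes t: "t \<in> kspan (Col l v)" and \<rho>: "\<rho> \<in> kspan (Row j v)" and n: "n = int l - int j"
    and F: "finite F" "F \<subseteq> out v" and L: "l < L"
  shows "t \<otimes> edge_sum F \<otimes> \<rho> \<in> kspan (Mon n L (Suc l))"
  using F
proof (induction F rule: finite_induct)
  case empty
  then show ?case
    using col_carrier[OF t] row_carrier[OF \<rho>] by (simp add: edge_sum_def kspan.zero)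
next
  case (insert f F)
  have tC: "t \<in> carrier R" and \<rho>C: "\<rho> \<in> carrier R"
    using col_carrier[OF t] row_carrier[OF \<rho>] by auto
  have f: "f \<in> arcs E" "tail E f = v" using insert.prems by (auto simp: out_def)
  have FC: "(\<lambda>f. Ed f \<otimes> Gh f) \<in> F \<rightarrow> carrier R" using insert.prems by (auto simp: out_def)
  have eq: "edge_sum (insert f F) = Ed f \<otimes> Gh f \<oplus> edge_sum F"
    unfolding edge_sum_def using insert.hyps f FC by simp
  have "t \<otimes> Ed f \<in> kspan (Col (Suc l) (head E f))"
    using t
  proof (induction rule: kspan.induct)
    case zero
    then show ?case using f by (simp add: kspan.zero)
  next
    case (step s x k)
    then have "s \<in> carrier R" "x \<in> carrier R" "s \<otimes> Ed f \<in> Col (Suc l) (head E f)"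
      using col_carrier[OF step.hyps(2)] f pth.edge[of l s _ f] by (auto simp: Col_def dest: pth_carrier)
    then show ?case
      using step.IH kspan.step[of "s \<otimes> Ed f"] f by (simp add: l_distr scale_mult_left)
  qed
  moreover have "Gh f \<otimes> \<rho> \<in> kspan (Row (Suc j) (head E f))"
    using \<rho>
  proof (induction rule: kspan.induct)
    case zero
    then show ?case using f by (simp add: kspan.zero)
  next
    case (step s x k)
    then have "s \<in> carrier R" "x \<in> carrier R" "Gh f \<otimes> s \<in> Row (Suc j) (head E f)"
      using row_carrier[OF step.hyps(2)] f pth.edge[of j _ s f] by (auto simp: Row_def dest: pth_carrier)
    then show ?case
      using step.IH kspan.step[of "Gh f \<otimes> s"] f by (simp add: r_distr scale_mult_right)
  qed
  moreover have "a \<otimes> b' \<in> kspan (Mon n L (Suc l))"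
    if "a \<in> Col (Suc l) (head E f)" "b' \<in> Row (Suc j) (head E f)" for a b'
  proof (rule kspan_incl[OF _ Mon_carrier])
    from that obtain a' b where "pth (Suc l) a a' (head E f)" "pth (Suc j) b b' (head E f)"
      by (auto simp: Col_def Row_def)
    then show "a \<otimes> b' \<in> Mon n L (Suc l)"
      by (rule MonI) (use n L in simp_all)
  qed
  ultimately have "(t \<otimes> Ed f) \<otimes> (Gh f \<otimes> \<rho>) \<in> kspan (Mon n L (Suc l))"
    by (rule kspan_mult[OF _ _ Col_carrier Row_carrier Mon_carrier])
  moreover have "t \<otimes> edge_sum F \<otimes> \<rho> \<in> kspan (Mon n L (Suc l))"
    using insert by auto
  ultimately have "(t \<otimes> Ed f) \<otimes> (Gh f \<otimes> \<rho>) \<oplus> t \<otimes> edge_sum F \<otimes> \<rho> \<in> kspan (Mon n L (Suc l))"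
    by (intro kspan_add Mon_carrier)
  moreover have "edge_sum F \<in> carrier R" using insert.prems by (intro edge_sum_carrier[of _ v]) auto
  ultimately show ?case
    using tC \<rho>C f by (simp add: eq l_distr r_distr m_assoc)
qed


subsection \<open>Regularity\<close>

text \<open>Regularity of an element of degree \<open>n\<close>.\<close>

definition reg :: "int \<Rightarrow> 'a \<Rightarrow> bool" where
  "reg n x \<longleftrightarrow> (\<exists>y\<in>G (- n). x \<otimes> y \<otimes> x = x)"

text \<open>McCoy's lemma: it suffices that \<open>x - xzx\<close> is regular.\<close>

lemma mccoy:
  assumes x: "x \<in> G n" and z: "z \<in> G (- n)" and reg: "reg n (x \<ominus> x \<otimes> z \<otimes> x)"
  shows "reg n x"
proof -
  define w where "w = x \<ominus> x \<otimes> z \<otimes> x"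
  obtain y where y: "y \<in> G (- n)" "w \<otimes> y \<otimes> w = w" using reg by (auto simp: reg_def w_def)
  have C: "x \<in> carrier R" "y \<in> carrier R" "z \<in> carrier R" using x y z by auto
  define y' where "y' = z \<oplus> (y \<ominus> z \<otimes> x \<otimes> y \<ominus> y \<otimes> x \<otimes> z \<oplus> z \<otimes> x \<otimes> y \<otimes> x \<otimes> z)"
  have zxy: "z \<otimes> x \<otimes> y \<in> G (- n)" using G_mult[OF G_mult[OF z x] y(1)] by simp
  have "y \<otimes> x \<otimes> z \<in> G (- n)" "z \<otimes> x \<otimes> y \<otimes> x \<otimes> z \<in> G (- n)"
    using G_mult[OF G_mult[OF y(1) x] z] G_mult[OF G_mult[OF zxy x] z] by simp_all
  then have "y' \<in> G (- n)" unfolding y'_def using y(1) z zxy by (intro D_add D_minus)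
  moreover have "x \<otimes> y' \<otimes> x = x"
  proof -
    have "x \<otimes> y' \<otimes> x = x \<otimes> z \<otimes> x \<oplus> w \<otimes> y \<otimes> w"
      unfolding y'_def w_def using C by algebra
    also have "\<dots> = x \<otimes> z \<otimes> x \<oplus> w" by (simp only: y(2))
    also have "\<dots> = x" unfolding w_def using C by algebra
    finally show ?thesis .
  qed
  ultimately show ?thesis by (auto simp: reg_def)
qed

text \<open>
  Elimination of the left factor \<open>a\<close> of minimal length from \<open>x = a\<rho> + y + x'\<close>: if the ghost path \<open>b'\<close>
  occurs in the row \<open>\<rho>\<close> with coefficient \<open>k\<close>, take \<open>z = k\<^sup>-\<^sup>1 b q a'\<close>, where the idempotent \<open>q = v - \<Sum> ff'\<close>
  (a sum over finitely many edges \<open>f\<close>) kills the longer monomials in \<open>x'\<close>.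
\<close>

lemma eliminate_row:
  assumes a: "pth l a a' v" and P: "rows l j P y" "(a, a', v) \<notin> P"
    and \<rho>: "\<rho> \<in> kspan (Row j v)" "\<rho> \<noteq> \<zero>" and x': "x' \<in> kspan (Mon n L (Suc l))"
    and n: "n = int l - int j"
  defines "x \<equiv> a \<otimes> \<rho> \<oplus> y \<oplus> x'"
  shows "\<exists>z\<in>G (- n). \<exists>y' x''. x \<ominus> x \<otimes> z \<otimes> x = y' \<oplus> x'' \<and> rows l j P y' \<and> x'' \<in> kspan (Mon n L (Suc l))"
proof -
  obtain b b' k where b: "pth j b b' v" and k: "k \<noteq> 0" "\<rho> \<otimes> b = k \<star> V v"
    using row_nonzero[OF \<rho>] by blast
  have "\<exists>F. finite F \<and> F \<subseteq> out v \<and> (F = {} \<or> l < L) \<and>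
      edge_sum F \<otimes> (a' \<otimes> x') = a' \<otimes> x' \<and> (x' \<otimes> b) \<otimes> edge_sum F = x' \<otimes> b"
  proof (cases "l < L")
    case True
    obtain F1 F2 where F12: "finite F1" "F1 \<subseteq> out v" "finite F2" "F2 \<subseteq> out v"
      "\<forall>F'. finite F' \<and> F1 \<subseteq> F' \<and> F' \<subseteq> out v \<longrightarrow> edge_sum F' \<otimes> (a' \<otimes> x') = a' \<otimes> x'"
      "\<forall>F'. finite F' \<and> F2 \<subseteq> F' \<and> F' \<subseteq> out v \<longrightarrow> (x' \<otimes> b) \<otimes> edge_sum F' = x' \<otimes> b"
      using cover_left[OF a x'] cover_right[OF b x' n] by blast
    then show ?thesis using True by (intro exI[of _ "F1 \<union> F2"]) simp
  next
    case False
    then have "x' = \<zero>" using x' by (simp add: Mon_empty kspan_empty)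
    then show ?thesis
      using pth_carrier[OF a] pth_carrier[OF b] by (intro exI[of _ "{}"]) (simp add: edge_sum_def)
  qed
  then obtain F where F: "finite F" "F \<subseteq> out v" "F = {} \<or> l < L"
    "edge_sum F \<otimes> (a' \<otimes> x') = a' \<otimes> x'" "(x' \<otimes> b) \<otimes> edge_sum F = x' \<otimes> b" by blast
  define s where "s = edge_sum F"
  define q where "q = V v \<ominus> s"
  have C: "a \<in> carrier R" "a' \<in> carrier R" "b \<in> carrier R" "V v \<in> carrier R" "\<rho> \<in> carrier R"
    "y \<in> carrier R" "x' \<in> carrier R" "s \<in> carrier R"
    using pth_carrier[OF a] pth_carrier[OF b] row_carrier[OF \<rho>(1)] rows_carrier[OF P(1)]
      mon_carrier[OF x'] edge_sum_carrier[OF F(2)] by (simp_all add: s_def)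
  have qC: "q \<in> carrier R" using C by (simp add: q_def)
  have v: "v \<in> verts E" using pth_carrier[OF a] by blast
  have Vs: "V v \<otimes> \<rho> = \<rho>" "a \<otimes> V v = a" "V v \<otimes> a' = a'" "b \<otimes> V v = b"
    using V_row[OF \<rho>(1) v] pth_V[OF a] pth_V[OF b] by auto
  have xC: "x \<in> carrier R" using C by (simp add: x_def)
  have qx': "q \<otimes> (a' \<otimes> x') = \<zero>"
  proof -
    have "q \<otimes> (a' \<otimes> x') = (V v \<otimes> a') \<otimes> x' \<ominus> s \<otimes> (a' \<otimes> x')" unfolding q_def using C by algebra
    then show ?thesis using C F(4) by (simp add: Vs s_def minus_eq r_neg)
  qed
  have x'q: "(x' \<otimes> b) \<otimes> q = \<zero>"
  proof -
    have "(x' \<otimes> b) \<otimes> q = x' \<otimes> (b \<otimes> V v) \<ominus> (x' \<otimes> b) \<otimes> s" unfolding q_def using C by algebra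
    then show ?thesis using C F(5) by (simp add: Vs s_def minus_eq r_neg)
  qed
  have q\<rho>: "q \<otimes> \<rho> = \<rho> \<ominus> s \<otimes> \<rho>"
  proof -
    have "q \<otimes> \<rho> = V v \<otimes> \<rho> \<ominus> s \<otimes> \<rho>" unfolding q_def using C by algebra
    then show ?thesis by (simp only: Vs)
  qed
  have qax: "q \<otimes> (a' \<otimes> x) = q \<otimes> \<rho>"
  proof -
    have "q \<otimes> (a' \<otimes> x) = q \<otimes> ((a' \<otimes> a) \<otimes> \<rho>) \<oplus> q \<otimes> (a' \<otimes> y) \<oplus> q \<otimes> (a' \<otimes> x')"
      unfolding x_def using C qC by algebra
    then show ?thesis
      using C qC pth_ghost_self[OF a] ghost_rows[OF P(1) a P(2)] by (simp add: qx' Vs)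
  qed
  define z where "z = inverse k \<star> (b \<otimes> q \<otimes> a')"
  define t where "t = a \<oplus> inverse k \<star> (y \<otimes> b)"
  have tC: "t \<in> carrier R" using C by (simp add: t_def)
  have "b \<otimes> q \<otimes> a' \<in> G (int j + 0 + - int l)"
    using pth_G[OF a] pth_G[OF b] V_G[OF v] edge_sum_G[OF F(2)]
    by (intro G_mult) (auto simp: q_def s_def)
  then have z: "z \<in> G (- n)" unfolding z_def using n by (intro scale_G) simp
  have xb: "inverse k \<star> (x \<otimes> b) = t \<oplus> inverse k \<star> (x' \<otimes> b)"
  proof -
    have "x \<otimes> b = a \<otimes> (\<rho> \<otimes> b) \<oplus> y \<otimes> b \<oplus> x' \<otimes> b" unfolding x_def using C by algebra
    then show ?thesis
      unfolding t_def using C k by (simp add: scale_add_right scale_mult_right Vs scale_scale)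
  qed
  have xzx: "x \<otimes> z \<otimes> x = t \<otimes> \<rho> \<ominus> t \<otimes> s \<otimes> \<rho>"
  proof -
    have "x \<otimes> z \<otimes> x = (inverse k \<star> (x \<otimes> b)) \<otimes> (q \<otimes> (a' \<otimes> x))"
      unfolding z_def using xC C qC by (simp add: scale_mult_right scale_mult_left m_assoc)
    also have "\<dots> = t \<otimes> (q \<otimes> \<rho>) \<oplus> (inverse k \<star> (x' \<otimes> b \<otimes> q)) \<otimes> \<rho>"
      unfolding qax xb using C qC tC by (simp add: l_distr scale_mult_left m_assoc)
    also have "\<dots> = t \<otimes> (\<rho> \<ominus> s \<otimes> \<rho>)" unfolding x'q q\<rho> using C tC by simp
    also have "\<dots> = t \<otimes> \<rho> \<ominus> t \<otimes> s \<otimes> \<rho>" using C tC by algebra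
    finally show ?thesis .
  qed
  define y' where "y' = y \<ominus> inverse k \<star> (y \<otimes> b) \<otimes> \<rho>"
  define x'' where "x'' = x' \<oplus> t \<otimes> s \<otimes> \<rho>"
  have "x \<ominus> x \<otimes> z \<otimes> x = y' \<oplus> x''"
  proof -
    have "inverse k \<star> (y \<otimes> b) \<in> carrier R" using C by simp
    then show ?thesis unfolding xzx unfolding x_def y'_def x''_def t_def using C by algebra
  qed
  moreover have "rows l j P y'" unfolding y'_def by (rule rows_eliminate[OF b \<rho>(1) P(1)])
  moreover have "x'' \<in> kspan (Mon n L (Suc l))"
  proof -
    have "t \<in> kspan (Col l v)"
      unfolding t_def using a
      by (intro kspan_add kspan_scale rows_mult_path[OF b P(1)] Col_carrier kspan_incl) (auto simp: Col_def)
    then have "t \<otimes> s \<otimes> \<rho> \<in> kspan (Mon n L (Suc l))"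
      using extend_through_edges[OF _ \<rho>(1) n F(1,2)] F(3) C tC
      by (auto simp: s_def edge_sum_def kspan.zero)
    then show ?thesis unfolding x''_def using x' by (intro kspan_add Mon_carrier)
  qed
  ultimately show ?thesis using z by blast
qed

lemma rows_in_G: "\<lbrakk>rows l j P y; n = int l - int j\<rbrakk> \<Longrightarrow> y \<in> G n"
proof (induction rule: rows.induct)
  case (insert P y a a' v \<rho>)
  have "\<rho> \<in> G (- int j)"
    using insert.hyps(4)
    by (induction rule: kspan.induct) (auto simp: Row_def dest: pth_G intro!: scale_G)
  then have "a \<otimes> \<rho> \<in> G n" using G_mult[of a "int l" \<rho> "- int j"] pth_G[OF insert.hyps(2)] insert.prems by simp
  then show ?case using insert by auto
qed simp

text \<open>Induction on the number of left factors of minimal length.\<close>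

lemma regular_rows:
  assumes n: "n = int l - int j" and IH: "\<And>x. x \<in> kspan (Mon n L (Suc l)) \<Longrightarrow> reg n x"
  shows "\<lbrakk>rows l j P y; x' \<in> kspan (Mon n L (Suc l))\<rbrakk> \<Longrightarrow> reg n (y \<oplus> x')"
proof (induction "card P" arbitrary: P y x')
  case 0
  then have "P = {}" using rows_finite by auto
  with 0(2) have "y = \<zero>" by cases auto
  then show ?case using IH[OF 0(3)] mon_carrier[OF 0(3)] by simp
next
  case (Suc c)
  from Suc.prems(1) show ?case
  proof cases
    case empty
    then show ?thesis using Suc.hyps(2) by simp
  next
    case (insert P0 y0 a a' v \<rho>)
    then have card: "c = card P0" using Suc.hyps(2) rows_finite[of l j P0 y0] by simp
    note C = pth_carrier[OF insert(4)] rows_carrier[OF insert(3)] row_carrier[OF insert(6)]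
      mon_carrier[OF Suc.prems(2)]
    show ?thesis
    proof (cases "\<rho> = \<zero>")
      case True
      then show ?thesis using Suc.hyps(1)[OF card insert(3) Suc.prems(2)] C insert(2) by simp
    next
      case False
      obtain z y' x'' where z: "z \<in> G (- n)" and eq: "(y \<oplus> x') \<ominus> (y \<oplus> x') \<otimes> z \<otimes> (y \<oplus> x') = y' \<oplus> x''"
        and *: "rows l j P0 y'" "x'' \<in> kspan (Mon n L (Suc l))"
        using eliminate_row[OF insert(4,3,5,6) False Suc.prems(2) n] unfolding insert(2) by blast
      have "y \<oplus> x' \<in> G n" using rows_in_G[OF Suc.prems(1) n] kspan_Mon_G[OF Suc.prems(2)] by blast
      moreover have "reg n ((y \<oplus> x') \<ominus> (y \<oplus> x') \<otimes> z \<otimes> (y \<oplus> x'))"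
        unfolding eq by (rule Suc.hyps(1)[OF card *])
      ultimately show ?thesis by (rule mccoy[OF _ z])
    qed
  qed
qed

lemma kspan_Mon_decompose:
  assumes "n = int l - int j" "x \<in> kspan (Mon n L l)"
  shows "\<exists>P y x'. rows l j P y \<and> x' \<in> kspan (Mon n L (Suc l)) \<and> x = y \<oplus> x'"
  using assms(2)
proof (induction rule: kspan.induct)
  case zero
  then show ?case using rows.empty kspan.zero by force
next
  case (step s x k)
  then obtain P y x' where IH: "rows l j P y" "x' \<in> kspan (Mon n L (Suc l))" "x = y \<oplus> x'" by blast
  obtain a a' b b' v i i' where s: "s = a \<otimes> b'" "pth i a a' v" "pth i' b b' v" "l \<le> i" "i \<le> L"
    "int i - int i' = n"
    using step.hyps(1) by (auto simp: Mon_def)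
  note C = rows_carrier[OF IH(1)] mon_carrier[OF IH(2)] pth_carrier[OF s(2)] pth_carrier[OF s(3)]
  show ?case
  proof (cases "i = l")
    case True
    then have "i' = j" using s(6) assms(1) by simp
    then have "k \<star> b' \<in> kspan (Row j v)"
      using s(3) by (intro kspan_scale Row_carrier kspan_incl) (auto simp: Row_def)
    then have "rows l j (insert (a, a', v) P) (a \<otimes> k \<star> b' \<oplus> y)"
      using IH(1) s(2) True by (intro rows_add) auto
    moreover have "k \<star> s \<oplus> x = (a \<otimes> k \<star> b' \<oplus> y) \<oplus> x'"
      using C by (simp add: s(1) IH(3) scale_mult_right a_assoc)
    ultimately show ?thesis using IH(2) by blast
  next
    case False
    then have "s \<in> Mon n L (Suc l)" unfolding s(1) using s by (intro MonI[OF s(2,3)]) simp_all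
    then have "k \<star> s \<oplus> x' \<in> kspan (Mon n L (Suc l))" using IH(2) by (rule kspan.step)
    moreover have "k \<star> s \<oplus> x = y \<oplus> (k \<star> s \<oplus> x')"
      using C by (simp add: s(1) IH(3) a_lcomm)
    ultimately show ?thesis using IH(1) by blast
  qed
qed

text \<open>Induction on the difference between the maximal and the minimal length of left factors.\<close>

lemma regular_kspan_Mon: "x \<in> kspan (Mon n L l) \<Longrightarrow> reg n x"
proof (induction "Suc L - l" arbitrary: l x)
  case 0
  then have "x = \<zero>" by (simp add: Mon_empty kspan_empty)
  then show ?case unfolding reg_def by (intro bexI[of _ \<zero>]) auto
next
  case (Suc c)
  have IH: "reg n x" if "x \<in> kspan (Mon n L (Suc l))" for x
    using Suc.hyps(1)[of "Suc l" x] Suc.hyps(2) that by simp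
  show ?case
  proof (cases "int l \<ge> n")
    case True
    then have n: "n = int l - int (nat (int l - n))" by simp
    show ?thesis
      using kspan_Mon_decompose[OF n Suc.prems] regular_rows[OF n IH] by blast
  next
    case False
    then have "Mon n L l \<subseteq> Mon n L (Suc l)" by (fastforce simp: Mon_def)
    then show ?thesis using IH kspan_mono Suc.prems by blast
  qed
qed


subsection \<open>Monomials span\<close>

lemma pth_source: "pth l a a' v \<Longrightarrow> \<exists>u\<in>verts E. V u \<otimes> a = a \<and> a' \<otimes> V u = a'"
proof (induction rule: pth.induct)
  case (vertex v)
  then show ?case by (auto simp: V_V intro!: bexI[of _ v])
next
  case (edge l a a' e)
  then obtain u where u: "u \<in> verts E" "V u \<otimes> a = a" "a' \<otimes> V u = a'" by blast
  have "V u \<otimes> (a \<otimes> Ed e) = a \<otimes> Ed e" "(Gh e \<otimes> a') \<otimes> V u = Gh e \<otimes> a'"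
    using pth_carrier[OF edge.hyps(1)] edge.hyps(2) u by (simp_all add: m_assoc) (simp add: m_assoc[symmetric])
  then show ?case using u(1) by blast
qed

lemma pth_extend_left:
  assumes "pth l a a' v" "e \<in> arcs E"
  shows "Ed e \<otimes> a = \<zero> \<or> pth (Suc l) (Ed e \<otimes> a) (a' \<otimes> Gh e) v"
  using assms(1)
proof (induction rule: pth.induct)
  case (vertex v)
  have eq: "Ed e \<otimes> V v = Ed e \<otimes> (V (head E e) \<otimes> V v)"
    using assms(2) vertex by (simp add: m_assoc[symmetric] Ed_V)
  have "pth (Suc 0) (Ed e) (Gh e) (head E e)"
    using pth.edge[OF pth.vertex assms(2)] assms(2) by (simp add: V_Ed Gh_V)
  then have "pth (Suc 0) (Ed e \<otimes> V v) (V v \<otimes> Gh e) v" if "v = head E e"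
    using assms(2) that by (simp add: Ed_V V_Gh)
  moreover have "Ed e \<otimes> V v = \<zero>" if "v \<noteq> head E e"
  proof -
    have "V (head E e) \<otimes> V v = \<zero>" using assms(2) vertex that by (simp add: V_V)
    then have "Ed e \<otimes> V v = Ed e \<otimes> \<zero>" using eq by (simp only:)
    then show ?thesis using assms(2) by simp
  qed
  ultimately show ?case by blast
next
  case (edge l a a' f)
  note C = pth_carrier[OF edge.hyps(1)]
  from edge.IH show ?case
  proof
    assume "Ed e \<otimes> a = \<zero>"
    then have "Ed e \<otimes> (a \<otimes> Ed f) = \<zero>" using C edge.hyps(2) assms(2) by (simp add: m_assoc[symmetric])
    then show ?thesis by simp
  next
    assume "pth (Suc l) (Ed e \<otimes> a) (a' \<otimes> Gh e) (tail E f)"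
    from pth.edge[OF this edge.hyps(2)] show ?thesis
      using C edge.hyps(2) assms(2) by (simp add: m_assoc)
  qed
qed

text \<open>Products of generators are zero or monomials \<open>ab'\<close>.\<close>

definition monomial :: "int \<Rightarrow> 'a \<Rightarrow> bool" where
  "monomial n x \<longleftrightarrow> x = \<zero> \<or> (\<exists>a a' b b' v i j. x = a \<otimes> b' \<and> pth i a a' v \<and> pth j b b' v \<and> int i - int j = n)"

lemma monomialI: "\<lbrakk>pth i a a' v; pth j b b' v; int i - int j = n\<rbrakk> \<Longrightarrow> monomial n (a \<otimes> b')"
  unfolding monomial_def by blast

lemma monomial_kspan:
  assumes "monomial n x"
  shows "\<exists>L. x \<in> kspan (Mon n L 0)"
  using assms unfolding monomial_def
proof (elim disjE exE conjE)
  fix a a' b b' v i j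
  assume "x = a \<otimes> b'" "pth i a a' v" "pth j b b' v" "int i - int j = n"
  then have "x \<in> Mon n i 0" by (auto intro: MonI)
  then show ?thesis using kspan_incl[OF _ Mon_carrier] by blast
qed (auto intro: kspan.zero)

lemma monomial_V_self: "v \<in> verts E \<Longrightarrow> monomial 0 (V v)"
  using monomialI[OF pth.vertex[of v] pth.vertex[of v]] by (simp add: V_V)

lemma monomial_V:
  assumes "monomial n x" "w \<in> verts E"
  shows "monomial n (V w \<otimes> x)"
  using assms(1) unfolding monomial_def[of n x]
proof (elim disjE exE conjE)
  fix a a' b b' v i j
  assume x: "x = a \<otimes> b'" "pth i a a' v" "pth j b b' v" "int i - int j = n"
  obtain u where u: "u \<in> verts E" "V u \<otimes> a = a" using pth_source[OF x(2)] by blast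
  have "V w \<otimes> x = (V w \<otimes> V u) \<otimes> (a \<otimes> b')"
  proof -
    have "V w \<otimes> x = V w \<otimes> ((V u \<otimes> a) \<otimes> b')" by (simp only: u(2) x(1))
    then show ?thesis using assms(2) u(1) pth_carrier[OF x(2)] pth_carrier[OF x(3)] by (simp add: m_assoc)
  qed
  then have "V w \<otimes> x = a \<otimes> b' \<or> V w \<otimes> x = \<zero>"
    using assms(2) u pth_carrier[OF x(2)] pth_carrier[OF x(3)] by (simp add: V_V m_assoc[symmetric] split: if_splits)
  then show ?thesis
    using monomialI[OF x(2,3,4)] by (auto simp: monomial_def[of n \<zero>])
qed (use assms(2) in \<open>simp add: monomial_def\<close>)

lemma monomial_Ed:
  assumes "monomial n x" "e \<in> arcs E"
  shows "monomial (n + 1) (Ed e \<otimes> x)"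
  using assms(1) unfolding monomial_def[of n x]
proof (elim disjE exE conjE)
  fix a a' b b' v i j
  assume x: "x = a \<otimes> b'" "pth i a a' v" "pth j b b' v" "int i - int j = n"
  have eq: "Ed e \<otimes> x = (Ed e \<otimes> a) \<otimes> b'"
    using assms(2) pth_carrier[OF x(2)] pth_carrier[OF x(3)] by (simp add: x(1) m_assoc)
  from pth_extend_left[OF x(2) assms(2)] show ?thesis
  proof
    assume "Ed e \<otimes> a = \<zero>"
    then show ?thesis using pth_carrier[OF x(3)] by (simp add: eq monomial_def)
  next
    assume "pth (Suc i) (Ed e \<otimes> a) (a' \<otimes> Gh e) v"
    then show ?thesis unfolding eq using x(3,4) by (elim monomialI) simp_all
  qed
qed (use assms(2) in \<open>simp add: monomial_def\<close>)

lemma monomial_Gh: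
  assumes "monomial n x" "e \<in> arcs E"
  shows "monomial (n - 1) (Gh e \<otimes> x)"
  using assms(1) unfolding monomial_def[of n x]
proof (elim disjE exE conjE)
  fix a a' b b' v i j
  assume x: "x = a \<otimes> b'" "pth i a a' v" "pth j b b' v" "int i - int j = n"
  note C = pth_carrier[OF x(2)] pth_carrier[OF x(3)]
  show ?thesis
  proof (cases "i = 0")
    case True
    from x(2) have a: "a = V v" using True by cases auto
    show ?thesis
    proof (cases "v = tail E e")
      case True
      then have p: "pth (Suc j) (b \<otimes> Ed e) (Gh e \<otimes> b') (head E e)" using pth.edge[of j b b' e] x(3) assms(2) by simp
      have "Gh e \<otimes> x = V (head E e) \<otimes> (Gh e \<otimes> b')"
        using C assms(2) pth_V[OF x(3)] by (simp add: x(1) a m_assoc[symmetric] V_Gh True Gh_V)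
      also have "monomial (n - 1) \<dots>"
        by (rule monomialI[OF pth.vertex p]) (use x(4) \<open>i = 0\<close> assms(2) in simp_all)
      finally show ?thesis .
    next
      case False
      have "Gh e \<otimes> V v = Gh e \<otimes> (V (tail E e) \<otimes> V v)"
        using C assms(2) by (simp add: m_assoc[symmetric] Gh_V)
      moreover have "V (tail E e) \<otimes> V v = \<zero>" using C assms(2) False by (simp add: V_V)
      ultimately have "Gh e \<otimes> V v = Gh e \<otimes> \<zero>" by (simp only:)
      then have "Gh e \<otimes> V v = \<zero>" using assms(2) by simp
      then have "Gh e \<otimes> x = \<zero>" using C assms(2) by (simp add: x(1) a m_assoc[symmetric])
      then show ?thesis by (simp add: monomial_def)
    qed
  next
    case False
    then obtain c c' f d d' where sp: "pth 0 c c' (tail E f)" "f \<in> arcs E" "pth (i - 1) d d' v"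
      "V (head E f) \<otimes> d = d" "a = c \<otimes> (Ed f \<otimes> d)"
      using pth_split[OF x(2), of 0] by auto
    have c: "c = V (tail E f)" using sp(1) by cases auto
    note C' = pth_carrier[OF sp(3)]
    have a: "a = Ed f \<otimes> d" using C' sp(2) by (simp add: sp(5) c m_assoc[symmetric] V_Ed)
    have "Gh e \<otimes> x = (Gh e \<otimes> Ed f) \<otimes> d \<otimes> b'"
      using C C' sp(2) assms(2) by (simp add: x(1) a m_assoc)
    then have "Gh e \<otimes> x = d \<otimes> b' \<or> Gh e \<otimes> x = \<zero>"
      using C C' sp(2,4) assms(2) by (simp add: Gh_Ed split: if_splits)
    moreover have "monomial (n - 1) (d \<otimes> b')"
      by (rule monomialI[OF sp(3) x(3)]) (use x(4) False in simp)
    ultimately show ?thesis by (auto simp: monomial_def[of _ \<zero>])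
  qed
qed (use assms(2) in \<open>simp add: monomial_def\<close>)

lemma monomial_Ed_self: "e \<in> arcs E \<Longrightarrow> monomial 1 (Ed e)"
  using monomial_Ed[OF monomial_V_self, of "head E e" e] by (simp add: Ed_V)

lemma monomial_Gh_self: "e \<in> arcs E \<Longrightarrow> monomial (- 1) (Gh e)"
  using monomial_Gh[OF monomial_V_self, of "tail E e" e] by (simp add: Gh_V)

lemma kspan_Mon_add:
  assumes "\<exists>L. x \<in> kspan (Mon n L 0)" "\<exists>L. y \<in> kspan (Mon n L 0)"
  shows "\<exists>L. x \<oplus> y \<in> kspan (Mon n L 0)"
proof -
  obtain L L' where "x \<in> kspan (Mon n L 0)" "y \<in> kspan (Mon n L' 0)" using assms by blast
  then have "x \<in> kspan (Mon n (max L L') 0)" "y \<in> kspan (Mon n (max L L') 0)"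
    using kspan_mono[OF _ Mon_mono] by auto
  then have "x \<oplus> y \<in> kspan (Mon n (max L L') 0)" by (intro kspan_add Mon_carrier)
  then show ?thesis by blast
qed

lemma graded_regular:
  assumes "\<And>n x. x \<in> G n \<Longrightarrow> \<exists>L. x \<in> kspan (Mon n L 0)"
  shows "graded_regular_ring R G"
proof unfold_locales
  fix x n assume "x \<in> G n"
  then obtain L where "x \<in> kspan (Mon n L 0)" using assms by blast
  then show "\<exists>y\<in>G (- n). x \<otimes> y \<otimes> x = x" using regular_kspan_Mon unfolding reg_def by blast
qed

text \<open>If there are finitely many vertices, their sum is an identity.\<close>

lemma vertex_sum_identity:
  assumes span: "\<And>n x. x \<in> G n \<Longrightarrow> \<exists>L. x \<in> kspan (Mon n L 0)" and fin: "finite (verts E)"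
    and x: "x \<in> carrier R"
  shows "finsum R V (verts E) \<otimes> x = x \<and> x \<otimes> finsum R V (verts E) = x"
  using x
proof (induction x rule: homogeneous_induct)
  case (homogeneous n x)
  let ?u = "finsum R V (verts E)"
  have uC: "?u \<in> carrier R" by (intro finsum_closed) auto
  have uV: "?u \<otimes> V w = V w" "V w \<otimes> ?u = V w" if w: "w \<in> verts E" for w
  proof -
    have "?u \<otimes> V w = finsum R (\<lambda>v. V v \<otimes> V w) (verts E)"
      using fin w by (intro finsum_ldistr) auto
    also have "\<dots> = finsum R (\<lambda>v. if w = v then V v else \<zero>) (verts E)"
      using w by (intro finsum_cong') (auto simp: V_V)
    also have "\<dots> = V w" using fin w by (intro finsum_singleton) auto
    finally show "?u \<otimes> V w = V w" .
    have "V w \<otimes> ?u = finsum R (\<lambda>v. V w \<otimes> V v) (verts E)"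
      using fin w by (intro finsum_rdistr) auto
    also have "\<dots> = finsum R (\<lambda>v. if w = v then V v else \<zero>) (verts E)"
      using w by (intro finsum_cong') (auto simp: V_V)
    also have "\<dots> = V w" using fin w by (intro finsum_singleton) auto
    finally show "V w \<otimes> ?u = V w" .
  qed
  obtain L where "x \<in> kspan (Mon n L 0)" using span[OF homogeneous] by blast
  then show ?case
  proof (induction rule: kspan.induct)
    case zero
    then show ?case using uC by simp
  next
    case (step s x k)
    from step.hyps(1) obtain a a' b b' v i j where s: "s = a \<otimes> b'" "pth i a a' v" "pth j b b' v"
      by (auto simp: Mon_def)
    obtain u w where uw: "u \<in> verts E" "V u \<otimes> a = a" "w \<in> verts E" "b' \<otimes> V w = b'"
      using pth_source[OF s(2)] pth_source[OF s(3)] by blast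
    note C = pth_carrier[OF s(2)] pth_carrier[OF s(3)] mon_carrier[OF step.hyps(2)] uC
    have "?u \<otimes> (V u \<otimes> a) = V u \<otimes> a" "(b' \<otimes> V w) \<otimes> ?u = b' \<otimes> V w"
      using C uw(1,3) uV by (simp_all add: m_assoc) (simp add: m_assoc[symmetric] uV)
    then have "?u \<otimes> a = a" "b' \<otimes> ?u = b'" by (simp_all only: uw)
    then have "?u \<otimes> s = s" "s \<otimes> ?u = s" "s \<in> carrier R"
      using C by (simp_all add: s(1) m_assoc) (simp add: m_assoc[symmetric])
    then show ?case using step.IH C by (simp add: l_distr r_distr scale_mult_left scale_mult_right)
  qed
next
  case (add x y)
  have "finsum R V (verts E) \<in> carrier R" by (intro finsum_closed) auto
  then show ?case using add by (simp add: l_distr r_distr)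
qed

end


section \<open>The free algebra\<close>

lemma poly_mapping_expansion: "p = (\<Sum>w\<in>Poly_Mapping.keys p. Poly_Mapping.single w (Poly_Mapping.lookup p w))"
  by (rule poly_mapping_eqI)
    (simp add: lookup_sum lookup_single when_def sum.delta' in_keys_iff)

text \<open>Multiplication of an element of the free algebra by a scalar.\<close>

abbreviation scal :: "'k :: field \<Rightarrow> ('g free_word \<Rightarrow>\<^sub>0 'k) \<Rightarrow> ('g free_word \<Rightarrow>\<^sub>0 'k)" where
  "scal c \<equiv> Poly_Mapping.map ((*) c)"

lemma lookup_scal [simp]: "Poly_Mapping.lookup (scal c p) w = c * Poly_Mapping.lookup p w"
  by (simp add: map.rep_eq when_def)

lemma scal_simps:
  "scal c (p + q) = scal c p + scal c q"
  "scal (c + d) p = scal c p + scal d p"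
  "scal c (scal d p) = scal (c * d) p"
  "scal 1 p = p"
  "scal c (Poly_Mapping.single w d) = Poly_Mapping.single w (c * d)"
  by (auto intro!: poly_mapping_eqI simp: lookup_add algebra_simps lookup_single when_def)

lemma scal_mult_left: "scal c (p * q) = scal c p * q"
  by (simp add: mult_map_scale_conv_mult mult.assoc)

lemma single_zero_commute: "Poly_Mapping.single 0 c * p = p * Poly_Mapping.single 0 (c :: 'k :: field)"
proof -
  have "Poly_Mapping.single 0 c * (\<Sum>w\<in>Poly_Mapping.keys p. Poly_Mapping.single w (Poly_Mapping.lookup p w)) =
    (\<Sum>w\<in>Poly_Mapping.keys p. Poly_Mapping.single w (Poly_Mapping.lookup p w)) * Poly_Mapping.single 0 c"
    by (simp add: sum_distrib_left sum_distrib_right mult_single mult.commute)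
  then show ?thesis by (simp only: poly_mapping_expansion[symmetric])
qed

lemma scal_mult_right: "scal c (p * q) = p * scal c q"
  unfolding mult_map_scale_conv_mult by (metis mult.assoc single_zero_commute)

lemma keys_scal: "Poly_Mapping.keys (scal c p) \<subseteq> Poly_Mapping.keys p"
  by (auto simp: in_keys_iff)

lemma word_degree_add [simp]: "word_degree (u + w) = word_degree u + word_degree w"
  by (simp add: word_degree_def plus_free_word_def)

text \<open>The projection onto the span of the words of degree \<open>n\<close>.\<close>

definition proj :: "int \<Rightarrow> (('v, 'e) lpa_gen free_word \<Rightarrow>\<^sub>0 'k :: field) \<Rightarrow> (('v, 'e) lpa_gen free_word \<Rightarrow>\<^sub>0 'k)" where
  "proj n p = Abs_poly_mapping (\<lambda>w. if word_degree w = n then Poly_Mapping.lookup p w else 0)"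

lemma lookup_proj [simp]:
  "Poly_Mapping.lookup (proj n p) w = (if word_degree w = n then Poly_Mapping.lookup p w else 0)"
proof -
  have "finite {w. (if word_degree w = n then Poly_Mapping.lookup p w else 0) \<noteq> 0}"
    by (rule finite_subset[OF _ finite_lookup[of p]]) auto
  then show ?thesis by (simp add: proj_def)
qed

lemma proj_simps [simp]:
  "proj n 0 = 0" "proj n (p + q) = proj n p + proj n q" "proj n (p - q) = proj n p - proj n q"
  "proj n (scal c p) = scal c (proj n p)" "proj n (- p) = - proj n p"
  by (auto intro!: poly_mapping_eqI simp: lookup_add lookup_minus)

lemma proj_sum: "proj n (sum f S) = (\<Sum>i\<in>S. proj n (f i))"
  by (induction S rule: infinite_finite_induct) simp_all

lemma proj_single:
  "proj n (Poly_Mapping.single w c) = (if word_degree w = n then Poly_Mapping.single w c else 0)"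
  by (auto intro!: poly_mapping_eqI simp: lookup_single when_def)

lemma keys_proj: "Poly_Mapping.keys (proj n p) = {w \<in> Poly_Mapping.keys p. word_degree w = n}"
  by (auto simp: in_keys_iff split: if_splits)

lemma proj_single_mult:
  "proj n (Poly_Mapping.single u c * p) = Poly_Mapping.single u c * proj (n - word_degree u) p"
proof -
  let ?s = "\<lambda>w. Poly_Mapping.single w (Poly_Mapping.lookup p w)"
  have "proj n (Poly_Mapping.single u c * (\<Sum>w\<in>Poly_Mapping.keys p. ?s w)) =
    Poly_Mapping.single u c * proj (n - word_degree u) (\<Sum>w\<in>Poly_Mapping.keys p. ?s w)"
    by (simp add: sum_distrib_left proj_sum mult_single proj_single) (intro sum.cong, auto simp: mult_single)
  then show ?thesis by (simp only: poly_mapping_expansion[symmetric])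
qed

lemma proj_mult_single:
  "proj n (p * Poly_Mapping.single u c) = proj (n - word_degree u) p * Poly_Mapping.single u c"
proof -
  let ?s = "\<lambda>w. Poly_Mapping.single w (Poly_Mapping.lookup p w)"
  have "proj n ((\<Sum>w\<in>Poly_Mapping.keys p. ?s w) * Poly_Mapping.single u c) =
    proj (n - word_degree u) (\<Sum>w\<in>Poly_Mapping.keys p. ?s w) * Poly_Mapping.single u c"
    by (simp add: sum_distrib_right proj_sum mult_single proj_single) (intro sum.cong, auto simp: mult_single)
  then show ?thesis by (simp only: poly_mapping_expansion[symmetric])
qed

lemma proj_homogeneous:
  "\<forall>w\<in>Poly_Mapping.keys p. word_degree w = m \<Longrightarrow> proj n p = (if n = m then p else 0)"
  by (auto intro!: poly_mapping_eqI simp: in_keys_iff)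

lemma sum_proj:
  assumes "finite S" "word_degree ` Poly_Mapping.keys p \<subseteq> S"
  shows "(\<Sum>n\<in>S. proj n p) = p"
proof (rule poly_mapping_eqI)
  fix w
  have "Poly_Mapping.lookup (\<Sum>n\<in>S. proj n p) w = (\<Sum>n\<in>S. if word_degree w = n then Poly_Mapping.lookup p w else 0)"
    by (simp add: lookup_sum)
  also have "\<dots> = Poly_Mapping.lookup p w"
    using assms by (auto simp: sum.delta in_keys_iff image_subset_iff)
  finally show "Poly_Mapping.lookup (\<Sum>n\<in>S. proj n p) w = Poly_Mapping.lookup p w" .
qed


section \<open>The structure of a Leavitt path algebra\<close>

lemma direct_decomposition_cong:
  assumes "carrier M = carrier M'" "ring.add M = ring.add M'" "ring.zero M = ring.zero M'"
  shows "direct_decomposition M D \<longleftrightarrow> direct_decomposition M' D"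
proof -
  have "additive_subgroup S M \<longleftrightarrow> additive_subgroup S M'" for S
    by (simp add: additive_subgroup_def subgroup_def m_inv_def assms)
  moreover have "finsum M f S = finsum M' f S" for f :: "int \<Rightarrow> _" and S
    by (simp add: finsum_def finprod_def assms)
  ultimately show ?thesis by (simp add: direct_decomposition_def assms)
qed

text \<open>The type argument only serves to fix the field of coefficients.\<close>

locale lpa =
  fixes E :: "('v, 'e) pre_digraph" and TK :: "'k :: field itself"
  assumes E: "wf_digraph E"
begin

abbreviation F :: "('k, ('v, 'e) lpa_gen free_word \<Rightarrow>\<^sub>0 'k) module" where
  "F \<equiv> free_algebra (lpa_gens E)"

abbreviation I :: "(('v, 'e) lpa_gen free_word \<Rightarrow>\<^sub>0 'k) set" where
  "I \<equiv> lpa_ideal E"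

abbreviation A :: "('k, (('v, 'e) lpa_gen free_word \<Rightarrow>\<^sub>0 'k) set) module" where
  "A \<equiv> leavitt_path_algebra E"

abbreviation G :: "int \<Rightarrow> (('v, 'e) lpa_gen free_word \<Rightarrow>\<^sub>0 'k) set set" where
  "G \<equiv> lpa_component E"

abbreviation rels :: "(('v, 'e) lpa_gen free_word \<Rightarrow>\<^sub>0 'k) set" where
  "rels \<equiv> lpa_relators E"

lemma F_simps [simp]:
  "\<zero>\<^bsub>F\<^esub> = 0" "x \<oplus>\<^bsub>F\<^esub> y = x + y" "x \<otimes>\<^bsub>F\<^esub> y = x * y" "c \<odot>\<^bsub>F\<^esub> x = scal c x"
  by (simp_all add: free_algebra_def)

sublocale F: nonunital_ring F
  by (rule nonunital_ring_free_algebra)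

lemma F_uminus [simp]: "x \<in> carrier F \<Longrightarrow> \<ominus>\<^bsub>F\<^esub> x = - x"
  by (rule F.minus_equality) (auto simp: free_algebra_def)

lemma F_minus [simp]: "x \<in> carrier F \<Longrightarrow> y \<in> carrier F \<Longrightarrow> x \<ominus>\<^bsub>F\<^esub> y = x - y"
  by (simp add: F.minus_eq)

lemma F_scal: "x \<in> carrier F \<Longrightarrow> scal c x \<in> carrier F"
  using keys_scal[of c x] by (auto simp: free_algebra_def)

lemma F_mult: "x \<in> carrier F \<Longrightarrow> y \<in> carrier F \<Longrightarrow> x * y \<in> carrier F"
  using F.m_closed[of x y] by simp

lemma F_add: "x \<in> carrier F \<Longrightarrow> y \<in> carrier F \<Longrightarrow> x + y \<in> carrier F"
  using F.a_closed[of x y] by simp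

lemma F_diff: "x \<in> carrier F \<Longrightarrow> y \<in> carrier F \<Longrightarrow> x - y \<in> carrier F"
  using F.minus_closed[of x y] by simp

lemma F_zero: "0 \<in> carrier F"
  using F.zero_closed by simp

lemma F_sum: "(\<And>i. i \<in> S \<Longrightarrow> f i \<in> carrier F) \<Longrightarrow> sum f S \<in> carrier F"
  by (induction S rule: infinite_finite_induct) (auto intro: F_add F_zero)

lemma F_finsum: "f \<in> S \<rightarrow> carrier F \<Longrightarrow> finite S \<Longrightarrow> finsum F f S = sum f S"
  by (rotate_tac 1, induction S rule: finite_induct) (simp_all add: Pi_def)

lemma F_single: "x \<in> carrier F \<Longrightarrow> w \<in> Poly_Mapping.keys x \<Longrightarrow> Poly_Mapping.single w c \<in> carrier F"
  by (auto simp: free_algebra_def)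

lemma F_proj: "x \<in> carrier F \<Longrightarrow> proj n x \<in> carrier F"
  by (auto simp: free_algebra_def keys_proj)

lemma algebra_ideal_I: "algebra_ideal F I"
  unfolding lpa_ideal_def
  by (rule algebra_ideal_gen[OF nonunital_ring_free_algebra lpa_relators_subset[OF E]])
    (simp add: F_scal)

lemma relators_I: "lpa_relators E \<subseteq> I"
  by (auto simp: lpa_ideal_def algebra_ideal_gen_def)

lemma I_least: "algebra_ideal F J \<Longrightarrow> lpa_relators E \<subseteq> J \<Longrightarrow> I \<subseteq> J"
  by (auto simp: lpa_ideal_def algebra_ideal_gen_def)

sublocale Q: right_ideal_quotient F I
  using algebra_ideal_I by unfold_locales (simp add: algebra_ideal_def two_sided_ideal_def)

lemma I_mult_left: "x \<in> I \<Longrightarrow> a \<in> carrier F \<Longrightarrow> a * x \<in> I"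
  using algebra_ideal_I by (auto simp: algebra_ideal_def two_sided_ideal_def left_ideal_def)

lemma I_mult_right: "x \<in> I \<Longrightarrow> a \<in> carrier F \<Longrightarrow> x * a \<in> I"
  using Q.N_mult by simp

lemma I_scal: "x \<in> I \<Longrightarrow> scal c x \<in> I"
  using algebra_ideal_I by (auto simp: algebra_ideal_def)

lemma I_add: "x \<in> I \<Longrightarrow> y \<in> I \<Longrightarrow> x + y \<in> I"
  using Q.N.a_closed[of x y] by simp

lemma I_zero: "0 \<in> I"
  using Q.N.zero_closed by simp

lemma I_sum: "(\<And>i. i \<in> S \<Longrightarrow> f i \<in> I) \<Longrightarrow> sum f S \<in> I"
  by (induction S rule: infinite_finite_induct) (auto intro: I_add I_zero)

lemma I_uminus: "x \<in> I \<Longrightarrow> - x \<in> I"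
  using Q.N.a_inv_closed[of x] Q.N.a_Hcarr[of x] by simp

abbreviation cls :: "(('v, 'e) lpa_gen free_word \<Rightarrow>\<^sub>0 'k) \<Rightarrow> (('v, 'e) lpa_gen free_word \<Rightarrow>\<^sub>0 'k) set" where
  "cls p \<equiv> lpa_class E p"

lemma cls_def: "cls p = Q.cls p"
  by (simp add: lpa_class_def)

lemma cls_eq_iff: "x \<in> carrier F \<Longrightarrow> y \<in> carrier F \<Longrightarrow> cls x = cls y \<longleftrightarrow> x - y \<in> I"
  unfolding cls_def using Q.cls_eq_iff[of x y] by simp

lemma carrier_A: "carrier A = cls ` carrier F"
  using Q.carrier_M
  by (simp add: leavitt_path_algebra_def Let_def FactRing_def quotient_right_module_def cls_def)

lemma zero_A: "\<zero>\<^bsub>A\<^esub> = cls 0"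
  using Q.cls_zero by (simp add: leavitt_path_algebra_def Let_def FactRing_def cls_def)

lemma one_A: "\<one>\<^bsub>A\<^esub> = cls (\<Sum>v\<in>verts E. vtx v)"
  by (simp add: leavitt_path_algebra_def Let_def)

lemma add_A_set_add: "ring.add A = set_add F"
  by (simp add: leavitt_path_algebra_def Let_def FactRing_def)

lemma add_A [simp]: "x \<in> carrier F \<Longrightarrow> y \<in> carrier F \<Longrightarrow> cls x \<oplus>\<^bsub>A\<^esub> cls y = cls (x + y)"
  using Q.add_M[of x y] by (simp add: add_A_set_add quotient_right_module_def cls_def)

lemma mult_A [simp]:
  assumes x: "x \<in> carrier F" and y: "y \<in> carrier F"
  shows "cls x \<otimes>\<^bsub>A\<^esub> cls y = cls (x * y)"
proof -
  have *: "Q.cls (x' * y') = Q.cls (x * y)" if x': "x' \<in> Q.cls x" and y': "y' \<in> Q.cls y" for x' y'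
  proof -
    obtain h where h: "h \<in> I" "x' = h + x" using x' by (auto simp: a_r_coset_def r_coset_def)
    obtain k where k: "k \<in> I" "y' = k + y" using y' by (auto simp: a_r_coset_def r_coset_def)
    have hk: "h \<in> carrier F" "k \<in> carrier F" using h k Q.N.a_Hcarr by auto
    have "x' * y' - x * y = h * (k + y) + x * k" by (simp add: h k algebra_simps)
    moreover have "h * (k + y) + x * k \<in> I"
      using h k hk x y by (intro I_add I_mult_left I_mult_right F_add)
    ultimately have "cls (x' * y') = cls (x * y)"
      using hk x y by (subst cls_eq_iff) (auto simp: h k intro!: F_mult F_add)
    then show ?thesis by (simp add: cls_def)
  qed
  have "cls x \<otimes>\<^bsub>A\<^esub> cls y = rcoset_mult F I (Q.cls x) (Q.cls y)"
    by (simp add: leavitt_path_algebra_def Let_def FactRing_def cls_def)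
  also have "\<dots> = (\<Union>x'\<in>Q.cls x. \<Union>y'\<in>Q.cls y. Q.cls (x * y))"
    unfolding rcoset_mult_def F_simps by (intro SUP_cong refl) (rule *)
  also have "\<dots> = Q.cls (x * y)"
    using Q.N.a_rcos_self[OF x] Q.N.a_rcos_self[OF y] by blast
  finally show ?thesis by (simp add: cls_def)
qed

lemma smult_A [simp]:
  assumes x: "x \<in> carrier F"
  shows "c \<odot>\<^bsub>A\<^esub> cls x = cls (scal c x)"
proof -
  have *: "cls (scal c x') = cls (scal c x)" if x': "x' \<in> Q.cls x" for x'
  proof -
    obtain h where h: "h \<in> I" "x' = h + x" using x' by (auto simp: a_r_coset_def r_coset_def)
    have hC: "h \<in> carrier F" using h Q.N.a_Hcarr by auto
    show ?thesis
      using x hC I_scal[OF h(1)] by (subst cls_eq_iff) (auto simp: h scal_simps intro!: F_scal F_add)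
  qed
  have "c \<odot>\<^bsub>A\<^esub> cls x = (\<Union>x'\<in>Q.cls x. cls (scal c x'))"
    by (simp add: leavitt_path_algebra_def Let_def cls_def)
  also have "\<dots> = (\<Union>x'\<in>Q.cls x. cls (scal c x))" by (rule SUP_cong[OF refl]) (rule *)
  also have "\<dots> = cls (scal c x)" using Q.N.a_rcos_self[OF x] by blast
  finally show ?thesis .
qed


subsection \<open>The grading\<close>

text \<open>The homogeneous components of the free algebra.\<close>

definition H :: "int \<Rightarrow> (('v, 'e) lpa_gen free_word \<Rightarrow>\<^sub>0 'k) set" where
  "H n = {p \<in> carrier F. \<forall>w\<in>Poly_Mapping.keys p. word_degree w = n}"

lemma H_proj: "x \<in> carrier F \<Longrightarrow> proj n x \<in> H n"
  by (auto simp: H_def F_proj keys_proj)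

lemma proj_H: "x \<in> H m \<Longrightarrow> proj n x = (if n = m then x else 0)"
  by (rule proj_homogeneous) (simp add: H_def)

lemma H_decomposition:
  assumes x: "x \<in> carrier F"
  shows "(\<forall>n. f n \<in> H n) \<and> finite {n. f n \<noteq> 0} \<and> x = finsum F f {n. f n \<noteq> 0} \<longleftrightarrow> f = (\<lambda>n. proj n x)"
    (is "?L \<longleftrightarrow> ?R")
proof
  assume L: ?L
  let ?S = "{n. f n \<noteq> 0}"
  have fC: "f n \<in> carrier F" for n using L by (auto simp: H_def)
  have "finsum F f ?S = sum f ?S" using L fC by (intro F_finsum) auto
  then have x_eq: "x = sum f ?S" using L by simp
  show ?R
  proof
    fix n
    have "proj n x = (\<Sum>i\<in>?S. proj n (f i))" unfolding x_eq by (rule proj_sum)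
    also have "\<dots> = (\<Sum>i\<in>?S. if n = i then f i else 0)" using L by (intro sum.cong refl proj_H) blast
    also have "\<dots> = f n" using L by (simp add: sum.delta)
    finally show "f n = proj n x" by simp
  qed
next
  assume R: ?R
  have sub: "{n. f n \<noteq> 0} \<subseteq> word_degree ` Poly_Mapping.keys x"
  proof
    fix n assume "n \<in> {n. f n \<noteq> 0}"
    then have "Poly_Mapping.keys (proj n x) \<noteq> {}" by (simp add: R)
    then show "n \<in> word_degree ` Poly_Mapping.keys x" by (auto simp: keys_proj)
  qed
  have fin: "finite {n. f n \<noteq> 0}" by (rule finite_subset[OF sub]) simp
  have "finsum F f {n. f n \<noteq> 0} = (\<Sum>n\<in>{n. f n \<noteq> 0}. proj n x)"
    using fin x by (subst F_finsum) (auto simp: R F_proj)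
  also have "\<dots> = (\<Sum>n\<in>word_degree ` Poly_Mapping.keys x. proj n x)"
    by (rule sum.mono_neutral_left) (use sub in \<open>auto simp: R\<close>)
  also have "\<dots> = x" by (rule sum_proj) simp_all
  finally show ?L using fin x by (simp add: R H_proj)
qed

lemma H_subgroup: "additive_subgroup (H n) F"
  unfolding additive_subgroup_def
proof (rule F.add.subgroupI)
  show "H n \<noteq> {}" using F_zero by (auto simp: H_def intro!: exI[of _ 0])
  show "\<ominus>\<^bsub>F\<^esub> a \<in> H n" if "a \<in> H n" for a
  proof -
    have aC: "a \<in> carrier F" using that by (simp add: H_def)
    have "- a \<in> carrier F" using F.a_inv_closed[OF aC] aC by simp
    then show ?thesis using that aC by (simp add: H_def)
  qed
  show "a \<oplus>\<^bsub>F\<^esub> b \<in> H n" if "a \<in> H n" "b \<in> H n" for a b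
    using that F_add[of a b] keys_add[of a b] by (auto simp: H_def)
qed (auto simp: H_def)

lemma H_direct_decomposition: "direct_decomposition F H"
  unfolding direct_decomposition_def
proof (intro conjI allI ballI H_subgroup)
  fix x assume x: "x \<in> carrier F"
  show "\<exists>!f. (\<forall>n. f n \<in> H n) \<and> finite {n. f n \<noteq> \<zero>\<^bsub>F\<^esub>} \<and> x = finsum F f {n. f n \<noteq> \<zero>\<^bsub>F\<^esub>}"
    unfolding F_simps H_decomposition[OF x] by simp
qed

lemma H_mult: "x \<in> H i \<Longrightarrow> y \<in> H j \<Longrightarrow> x * y \<in> H (i + j)"
  using F_mult[of x y] keys_mult[of x y] by (fastforce simp: H_def)

lemma H_carrier: "x \<in> H n \<Longrightarrow> x \<in> carrier F"
  by (simp add: H_def)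

lemma H_degree: "x \<in> H n \<Longrightarrow> w \<in> Poly_Mapping.keys x \<Longrightarrow> word_degree w = n"
  by (simp add: H_def)

lemma H_I: "x \<in> carrier F \<Longrightarrow> (\<And>w. w \<in> Poly_Mapping.keys x \<Longrightarrow> word_degree w = n) \<Longrightarrow> x \<in> H n"
  by (simp add: H_def)

sublocale FG: graded_ring F H
  by unfold_locales (use H_direct_decomposition H_mult in auto)

lemma hcomp_F: "x \<in> carrier F \<Longrightarrow> hcomp F H x n = proj n x"
  unfolding hcomp_def F_simps H_decomposition by simp

lemma gen_degree_relators:
  fixes r :: "('v, 'e) lpa_gen free_word \<Rightarrow>\<^sub>0 'k"
  assumes "r \<in> rels"
  shows "\<exists>n. \<forall>w\<in>Poly_Mapping.keys r. word_degree w = n"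
proof -
  have hom: "\<forall>w\<in>Poly_Mapping.keys (p - q). word_degree w = n"
    if "\<forall>w\<in>Poly_Mapping.keys p. word_degree w = n" "\<forall>w\<in>Poly_Mapping.keys q. word_degree w = n"
    for p q :: "('v, 'e) lpa_gen free_word \<Rightarrow>\<^sub>0 'k" and n
    using that keys_diff[of p q] by blast
  have gv: "\<forall>w\<in>Poly_Mapping.keys (gen_var g :: ('v, 'e) lpa_gen free_word \<Rightarrow>\<^sub>0 'k). word_degree w = gen_degree g" for g
    by (simp add: gen_var_def word_degree_def)
  have gg: "\<forall>w\<in>Poly_Mapping.keys (gen_var g * gen_var h :: ('v, 'e) lpa_gen free_word \<Rightarrow>\<^sub>0 'k).
      word_degree w = gen_degree g + gen_degree h" for g h
    by (simp add: gen_var_def mult_single word_degree_def plus_free_word_def)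
  have ss: "\<forall>w\<in>Poly_Mapping.keys (\<Sum>\<alpha>\<in>S. edg \<alpha> * gho \<alpha> :: ('v, 'e) lpa_gen free_word \<Rightarrow>\<^sub>0 'k). word_degree w = 0" for S :: "'e set"
  proof
    fix w assume "w \<in> Poly_Mapping.keys (\<Sum>\<alpha>\<in>S. edg \<alpha> * gho \<alpha> :: ('v, 'e) lpa_gen free_word \<Rightarrow>\<^sub>0 'k)"
    then obtain \<alpha> where "w \<in> Poly_Mapping.keys (edg \<alpha> * gho \<alpha> :: ('v, 'e) lpa_gen free_word \<Rightarrow>\<^sub>0 'k)"
      using keys_sum[of "\<lambda>\<alpha>. edg \<alpha> * gho \<alpha> :: ('v, 'e) lpa_gen free_word \<Rightarrow>\<^sub>0 'k" S] by blast
    then show "word_degree w = 0" using gg[of "Edge \<alpha>" "Ghost \<alpha>"] by simp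
  qed
  have z: "\<forall>w\<in>Poly_Mapping.keys (if b then gen_var g else 0 :: ('v, 'e) lpa_gen free_word \<Rightarrow>\<^sub>0 'k). word_degree w = gen_degree g" for b g
    using gv[of g] by simp
  from assms show ?thesis
    unfolding lpa_relators_def
  proof (elim UnE CollectE exE conjE)
    fix v w assume r: "r = vtx v * vtx w - (if v = w then vtx v else 0)"
    show ?thesis unfolding r using gg[of "Vertex v" "Vertex w"] z[of "v = w" "Vertex v"] by (intro exI[of _ 0] hom) simp_all
  next
    fix \<alpha> assume r: "r = vtx (tail E \<alpha>) * edg \<alpha> - edg \<alpha>"
    show ?thesis unfolding r using gg[of "Vertex (tail E \<alpha>)" "Edge \<alpha>"] gv[of "Edge \<alpha>"] by (intro exI[of _ 1] hom) simp_all
  next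
    fix \<alpha> assume r: "r = edg \<alpha> * vtx (head E \<alpha>) - edg \<alpha>"
    show ?thesis unfolding r using gg[of "Edge \<alpha>" "Vertex (head E \<alpha>)"] gv[of "Edge \<alpha>"] by (intro exI[of _ 1] hom) simp_all
  next
    fix \<alpha> assume r: "r = vtx (head E \<alpha>) * gho \<alpha> - gho \<alpha>"
    show ?thesis unfolding r using gg[of "Vertex (head E \<alpha>)" "Ghost \<alpha>"] gv[of "Ghost \<alpha>"] by (intro exI[of _ "- 1"] hom) simp_all
  next
    fix \<alpha> assume r: "r = gho \<alpha> * vtx (tail E \<alpha>) - gho \<alpha>"
    show ?thesis unfolding r using gg[of "Ghost \<alpha>" "Vertex (tail E \<alpha>)"] gv[of "Ghost \<alpha>"] by (intro exI[of _ "- 1"] hom) simp_all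
  next
    fix \<alpha> \<beta> assume r: "r = gho \<alpha> * edg \<beta> - (if \<alpha> = \<beta> then vtx (head E \<alpha>) else 0)"
    show ?thesis unfolding r using gg[of "Ghost \<alpha>" "Edge \<beta>"] z[of "\<alpha> = \<beta>" "Vertex (head E \<alpha>)"] by (intro exI[of _ 0] hom) simp_all
  next
    fix v assume r: "r = (\<Sum>\<alpha>\<in>out_arcs E v. edg \<alpha> * gho \<alpha>) - vtx v"
    show ?thesis unfolding r using ss[of "out_arcs E v"] gv[of "Vertex v"] by (intro exI[of _ 0] hom) simp_all
  qed
qed

text \<open>As the relators are homogeneous, the ideal that they generate is graded.\<close>

lemma proj_I: "x \<in> I \<Longrightarrow> proj n x \<in> I"
proof -
  let ?J = "{x \<in> carrier F. \<forall>n. proj n x \<in> I}"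
  have mult_left: "proj n (a * x) \<in> I" if a: "a \<in> carrier F" and x: "\<And>n. proj n x \<in> I" for a x n
  proof -
    have "proj n ((\<Sum>w\<in>Poly_Mapping.keys a. Poly_Mapping.single w (Poly_Mapping.lookup a w)) * x) \<in> I"
      using a x by (auto simp: sum_distrib_right proj_sum proj_single_mult intro!: I_sum I_mult_left F_single)
    then show ?thesis by (simp only: poly_mapping_expansion[symmetric])
  qed
  have mult_right: "proj n (x * a) \<in> I" if a: "a \<in> carrier F" and x: "\<And>n. proj n x \<in> I" for a x n
  proof -
    have "proj n (x * (\<Sum>w\<in>Poly_Mapping.keys a. Poly_Mapping.single w (Poly_Mapping.lookup a w))) \<in> I"
      using a x by (auto simp: sum_distrib_left proj_sum proj_mult_single intro!: I_sum I_mult_right F_single)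
    then show ?thesis by (simp only: poly_mapping_expansion[symmetric])
  qed
  have "additive_subgroup ?J F"
    unfolding additive_subgroup_def
  proof (rule F.add.subgroupI)
    show "?J \<noteq> {}" using F_zero I_zero by (auto intro!: exI[of _ 0])
    show "\<ominus>\<^bsub>F\<^esub> a \<in> ?J" if "a \<in> ?J" for a
      using that F.a_inv_closed[of a] by (auto simp: I_uminus)
  qed (auto simp: F_add I_add)
  then have "algebra_ideal F ?J"
    by (auto simp: algebra_ideal_def two_sided_ideal_def right_ideal_def left_ideal_def
        F_mult F_scal I_scal mult_left mult_right)
  moreover have "lpa_relators E \<subseteq> ?J"
  proof
    fix r :: "('v, 'e) lpa_gen free_word \<Rightarrow>\<^sub>0 'k" assume r: "r \<in> rels"
    then obtain m where "\<forall>w\<in>Poly_Mapping.keys r. word_degree w = m" using gen_degree_relators by blast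
    then have "proj n r \<in> I" for n using proj_homogeneous[of r m n] r relators_I I_zero by auto
    then show "r \<in> ?J" using r lpa_relators_subset[OF E] by blast
  qed
  ultimately have "I \<subseteq> ?J" by (rule I_least)
  then show "x \<in> I \<Longrightarrow> proj n x \<in> I" by blast
qed

lemma graded_I: "graded_subgroup F H I"
  unfolding FG.graded_subgroup_iff
  using Q.N.additive_subgroup_axioms proj_I Q.N.a_Hcarr by (simp add: hcomp_F)

lemma lpa_component_H: "G n = cls ` H n"
  by (simp only: lpa_component_def H_def)

lemma direct_decomposition_A: "direct_decomposition A G"
proof -
  have "direct_decomposition Q.M (\<lambda>n. Q.cls ` H n)"
    using FG.graded_quotient(1)[OF Q.right_ideal_N graded_I] by (simp add: graded_right_module_def)
  moreover have "(\<lambda>n. Q.cls ` H n) = G"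
    by (simp add: fun_eq_iff lpa_component_H cls_def)
  moreover have "carrier Q.M = carrier A" "ring.add Q.M = ring.add A" "ring.zero Q.M = ring.zero A"
    by (simp_all add: quotient_right_module_def leavitt_path_algebra_def Let_def FactRing_def)
  ultimately show ?thesis
    by (simp only: direct_decomposition_cong[of Q.M A])
qed

lemma component_cls: "a \<in> G i \<Longrightarrow> \<exists>x\<in>H i. a = cls x"
  by (simp only: lpa_component_H image_iff)

sublocale A: nonunital_ring A
  by (rule nonunital_ring_leavitt_path_algebra[OF E])

sublocale AG: graded_ring A G
proof unfold_locales
  show "direct_decomposition A G" by (rule direct_decomposition_A)
  fix a b i j assume "a \<in> G i" "b \<in> G j"
  from component_cls[OF this(1)] obtain x where x: "x \<in> H i" "a = cls x" by (elim bexE) (rule that)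
  from component_cls[OF \<open>b \<in> G j\<close>] obtain y where y: "y \<in> H j" "b = cls y" by (elim bexE) (rule that)
  note xy = x y
  have "x \<in> carrier F" "y \<in> carrier F" using x y by (simp_all add: H_carrier)
  then have "a \<otimes>\<^bsub>A\<^esub> b = cls (x * y)" unfolding xy by (rule mult_A)
  then show "a \<otimes>\<^bsub>A\<^esub> b \<in> G (i + j)"
    unfolding lpa_component_H using H_mult[OF xy(1,3)] by (rule image_eqI)
qed


subsection \<open>Relations and regularity\<close>

lemma gen_var_H: "g \<in> lpa_gens E \<Longrightarrow> gen_var g \<in> H (gen_degree g)"
  by (rule H_I) (simp_all add: free_algebra_def gen_var_def word_degree_def)

lemma gen_var_F: "g \<in> lpa_gens E \<Longrightarrow> gen_var g \<in> carrier F"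
  by (rule H_carrier[OF gen_var_H])

lemma gens:
  "v \<in> verts E \<Longrightarrow> Vertex v \<in> lpa_gens E" "e \<in> arcs E \<Longrightarrow> Edge e \<in> lpa_gens E"
  "e \<in> arcs E \<Longrightarrow> Ghost e \<in> lpa_gens E"
  by (auto simp: lpa_gens_def)

lemma cls_relator: "x - y \<in> rels \<Longrightarrow> x \<in> carrier F \<Longrightarrow> y \<in> carrier F \<Longrightarrow> cls x = cls y"
  using relators_I by (auto simp: cls_eq_iff)

lemma leavitt_family_A:
  "leavitt_family A G E (\<lambda>c x. c \<odot>\<^bsub>A\<^esub> x)
     (\<lambda>v. cls (vtx v)) (\<lambda>e. cls (edg e)) (\<lambda>e. cls (gho e))"
proof (intro leavitt_family.intro leavitt_family_axioms.intro AG.graded_ring_axioms)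
  have head_tail: "tail E e \<in> verts E" "head E e \<in> verts E" if "e \<in> arcs E" for e
    using E that by (simp_all add: wf_digraph_def)
  note gF = gen_var_F[OF gens(1)] gen_var_F[OF gens(2)] gen_var_F[OF gens(3)]
  show "wf_digraph E" by (rule E)
  show "cls (vtx v) \<otimes>\<^bsub>A\<^esub> cls (vtx w) = (if v = w then cls (vtx v) else \<zero>\<^bsub>A\<^esub>)"
    if "v \<in> verts E" "w \<in> verts E" for v w
  proof -
    have "vtx v * vtx w - (if v = w then vtx v else 0) \<in> rels"
      using that unfolding lpa_relators_def by blast
    then have "cls (vtx v * vtx w) = cls (if v = w then vtx v else 0)"
      using that by (intro cls_relator) (auto intro: F_mult gF F_zero)
    then show ?thesis using that by (simp add: gF zero_A)
  qed
  show "cls (vtx (tail E e)) \<otimes>\<^bsub>A\<^esub> cls (edg e) = cls (edg e)" if "e \<in> arcs E" for e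
  proof -
    have "vtx (tail E e) * edg e - edg e \<in> rels" using that unfolding lpa_relators_def by blast
    then have "cls (vtx (tail E e) * edg e) = cls (edg e)"
      using that by (intro cls_relator) (auto intro: F_mult gF head_tail)
    then show ?thesis using that by (simp add: gF head_tail)
  qed
  show "cls (edg e) \<otimes>\<^bsub>A\<^esub> cls (vtx (head E e)) = cls (edg e)" if "e \<in> arcs E" for e
  proof -
    have "edg e * vtx (head E e) - edg e \<in> rels" using that unfolding lpa_relators_def by blast
    then have "cls (edg e * vtx (head E e)) = cls (edg e)"
      using that by (intro cls_relator) (auto intro: F_mult gF head_tail)
    then show ?thesis using that by (simp add: gF head_tail)
  qed
  show "cls (vtx (head E e)) \<otimes>\<^bsub>A\<^esub> cls (gho e) = cls (gho e)" if "e \<in> arcs E" for e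
  proof -
    have "vtx (head E e) * gho e - gho e \<in> rels" using that unfolding lpa_relators_def by blast
    then have "cls (vtx (head E e) * gho e) = cls (gho e)"
      using that by (intro cls_relator) (auto intro: F_mult gF head_tail)
    then show ?thesis using that by (simp add: gF head_tail)
  qed
  show "cls (gho e) \<otimes>\<^bsub>A\<^esub> cls (vtx (tail E e)) = cls (gho e)" if "e \<in> arcs E" for e
  proof -
    have "gho e * vtx (tail E e) - gho e \<in> rels" using that unfolding lpa_relators_def by blast
    then have "cls (gho e * vtx (tail E e)) = cls (gho e)"
      using that by (intro cls_relator) (auto intro: F_mult gF head_tail)
    then show ?thesis using that by (simp add: gF head_tail)
  qed
  show "cls (gho e) \<otimes>\<^bsub>A\<^esub> cls (edg f) = (if e = f then cls (vtx (head E e)) else \<zero>\<^bsub>A\<^esub>)"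
    if "e \<in> arcs E" "f \<in> arcs E" for e f
  proof -
    have "gho e * edg f - (if e = f then vtx (head E e) else 0) \<in> rels"
      using that unfolding lpa_relators_def by blast
    then have "cls (gho e * edg f) = cls (if e = f then vtx (head E e) else 0)"
      using that by (intro cls_relator) (auto intro: F_mult gF F_zero head_tail)
    then show ?thesis using that by (simp add: gF zero_A)
  qed
  show "cls (vtx v) \<in> G 0" if "v \<in> verts E" for v
    using gen_var_H[OF gens(1)[OF that]] by (simp add: lpa_component_H)
  show "cls (edg e) \<in> G 1" if "e \<in> arcs E" for e
    using gen_var_H[OF gens(2)[OF that]] by (simp add: lpa_component_H)
  show "cls (gho e) \<in> G (- 1)" if "e \<in> arcs E" for e
    using gen_var_H[OF gens(3)[OF that]] by (simp add: lpa_component_H)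
  fix c d :: 'k and x y n
  show "c \<odot>\<^bsub>A\<^esub> x \<in> carrier A" if "x \<in> carrier A"
    using that by (auto simp: carrier_A F_scal)
  show "c \<odot>\<^bsub>A\<^esub> (x \<oplus>\<^bsub>A\<^esub> y) = c \<odot>\<^bsub>A\<^esub> x \<oplus>\<^bsub>A\<^esub> c \<odot>\<^bsub>A\<^esub> y" if "x \<in> carrier A" "y \<in> carrier A"
    using that by (auto simp: carrier_A F_scal F_add scal_simps)
  show "(c + d) \<odot>\<^bsub>A\<^esub> x = c \<odot>\<^bsub>A\<^esub> x \<oplus>\<^bsub>A\<^esub> d \<odot>\<^bsub>A\<^esub> x" if "x \<in> carrier A"
    using that by (auto simp: carrier_A F_scal scal_simps)
  show "c \<odot>\<^bsub>A\<^esub> (d \<odot>\<^bsub>A\<^esub> x) = (c * d) \<odot>\<^bsub>A\<^esub> x" if "x \<in> carrier A"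
    using that by (auto simp: carrier_A F_scal scal_simps)
  show "1 \<odot>\<^bsub>A\<^esub> x = x" if "x \<in> carrier A"
    using that by (auto simp: carrier_A scal_simps)
  show "(c \<odot>\<^bsub>A\<^esub> x) \<otimes>\<^bsub>A\<^esub> y = c \<odot>\<^bsub>A\<^esub> (x \<otimes>\<^bsub>A\<^esub> y)" if "x \<in> carrier A" "y \<in> carrier A"
    using that by (auto simp: carrier_A F_scal F_mult scal_mult_left)
  show "x \<otimes>\<^bsub>A\<^esub> (c \<odot>\<^bsub>A\<^esub> y) = c \<odot>\<^bsub>A\<^esub> (x \<otimes>\<^bsub>A\<^esub> y)" if "x \<in> carrier A" "y \<in> carrier A"
    using that by (auto simp: carrier_A F_scal F_mult scal_mult_right)
  show "c \<odot>\<^bsub>A\<^esub> x \<in> G n" if "x \<in> G n"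
  proof -
    obtain p where p: "p \<in> H n" "x = cls p"
      using component_cls[OF \<open>x \<in> G n\<close>] by (elim bexE) (rule that)
    have "scal c p \<in> H n" using keys_scal[of c p] by (intro H_I F_scal H_carrier[OF p(1)]) (auto intro: H_degree[OF p(1)])
    moreover have "c \<odot>\<^bsub>A\<^esub> x = cls (scal c p)" unfolding p(2) by (rule smult_A[OF H_carrier[OF p(1)]])
    ultimately show ?thesis unfolding lpa_component_H by (intro image_eqI)
  qed
qed

sublocale L: leavitt_family A G E "\<lambda>c x. c \<odot>\<^bsub>A\<^esub> x"
  "\<lambda>v. cls (vtx v)" "\<lambda>e. cls (edg e)" "\<lambda>e. cls (gho e)"
  by (rule leavitt_family_A)

lemma monomial_word:
  "\<lbrakk>ws \<noteq> []; set ws \<subseteq> lpa_gens E\<rbrakk> \<Longrightarrow>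
     L.monomial (word_degree (Word ws)) (cls (Poly_Mapping.single (Word ws) 1))"
proof (induction ws)
  case (Cons g ws)
  have g: "g \<in> lpa_gens E" using Cons.prems by simp
  show ?case
  proof (cases "ws = []")
    case True
    then have eq: "Poly_Mapping.single (Word (g # ws)) 1 = (gen_var g :: _ \<Rightarrow>\<^sub>0 'k)" by (simp add: gen_var_def)
    show ?thesis
      unfolding eq using g L.monomial_V_self L.monomial_Ed_self L.monomial_Gh_self True
      by (auto simp: lpa_gens_def word_degree_def)
  next
    case False
    then have IH: "L.monomial (word_degree (Word ws)) (cls (Poly_Mapping.single (Word ws) 1))"
      using Cons by simp
    have "Poly_Mapping.single (Word ws) 1 \<in> carrier F"
      using Cons.prems False by (simp add: free_algebra_def)
    then have eq: "cls (Poly_Mapping.single (Word (g # ws)) 1) = cls (gen_var g) \<otimes>\<^bsub>A\<^esub> cls (Poly_Mapping.single (Word ws) 1)"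
      using gen_var_F[OF g] by (simp add: gen_var_def mult_single plus_free_word_def)
    have deg: "word_degree (Word (g # ws)) = gen_degree g + word_degree (Word ws)"
      by (simp add: word_degree_def)
    show ?thesis
      unfolding eq deg using g L.monomial_V[OF IH] L.monomial_Ed[OF IH] L.monomial_Gh[OF IH]
      by (auto simp: lpa_gens_def add.commute)
  qed
qed simp

lemma component_span:
  assumes "x \<in> G n"
  shows "\<exists>L. x \<in> L.kspan (L.Mon n L 0)"
proof -
  obtain p where p: "p \<in> H n" "x = cls p"
    using component_cls[OF assms] by (elim bexE) (rule that)
  have pF: "p \<in> carrier F" by (rule H_carrier[OF p(1)])
  have word: "\<exists>L. cls (Poly_Mapping.single w c) \<in> L.kspan (L.Mon n L 0)" if w: "w \<in> Poly_Mapping.keys p" for w c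
  proof -
    have "L.monomial (word_degree (Word (letters w))) (cls (Poly_Mapping.single (Word (letters w)) 1))"
      using pF w by (intro monomial_word) (auto simp: free_algebra_def)
    then have "L.monomial n (cls (Poly_Mapping.single w 1))"
      using H_degree[OF p(1) w] by simp
    then obtain L where "cls (Poly_Mapping.single w 1) \<in> L.kspan (L.Mon n L 0)"
      using L.monomial_kspan by blast
    then have "c \<odot>\<^bsub>A\<^esub> cls (Poly_Mapping.single w 1) \<in> L.kspan (L.Mon n L 0)"
      by (intro L.kspan_scale L.Mon_carrier)
    then show ?thesis using F_single[OF pF w] by (auto simp: scal_simps)
  qed
  have "\<exists>L. cls (\<Sum>w\<in>S. Poly_Mapping.single w (Poly_Mapping.lookup p w)) \<in> L.kspan (L.Mon n L 0)"
    if "S \<subseteq> Poly_Mapping.keys p" for S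
    using finite_subset[OF that finite_keys] that
  proof (induction S rule: finite_induct)
    case empty
    then show ?case using L.kspan.zero by (simp add: zero_A[symmetric])
  next
    case (insert w S)
    let ?s = "\<lambda>w. Poly_Mapping.single w (Poly_Mapping.lookup p w)"
    have C: "?s w \<in> carrier F" "sum ?s S \<in> carrier F"
      using insert.prems by (auto intro!: F_single[OF pF] F_sum)
    have "\<exists>L. cls (?s w) \<oplus>\<^bsub>A\<^esub> cls (sum ?s S) \<in> L.kspan (L.Mon n L 0)"
      using insert by (intro L.kspan_Mon_add word) auto
    then show ?case using insert.hyps C by simp
  qed
  from this[OF subset_refl] show ?thesis
    unfolding p(2) by (simp only: poly_mapping_expansion[symmetric])
qed

lemma graded_regular_A: "graded_regular_ring A G"
  by (rule L.graded_regular) (rule component_span)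

lemma ring_A:
  assumes fin: "finite (verts E)"
  shows "ring A"
proof -
  have vF: "vtx v \<in> carrier F" if "v \<in> verts E" for v using that by (intro gen_var_F gens)
  have "cls (\<Sum>v\<in>S. vtx v) = finsum A (\<lambda>v. cls (vtx v)) S" if "S \<subseteq> verts E" for S
    using finite_subset[OF that fin] that
  proof (induction S rule: finite_induct)
    case empty
    then show ?case by (simp add: zero_A)
  next
    case (insert v S)
    have C: "vtx v \<in> carrier F" "(\<Sum>v\<in>S. vtx v) \<in> carrier F"
      using insert.prems by (auto intro!: vF F_sum)
    have "finsum A (\<lambda>v. cls (vtx v)) (insert v S) = cls (vtx v) \<oplus>\<^bsub>A\<^esub> finsum A (\<lambda>v. cls (vtx v)) S"
      using insert C by (intro A.finsum_insert) (auto simp: carrier_A vF)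
    moreover have "cls (\<Sum>v\<in>insert v S. vtx v) = cls (vtx v) \<oplus>\<^bsub>A\<^esub> cls (\<Sum>v\<in>S. vtx v)"
      using insert.hyps add_A[OF C] by simp
    ultimately show ?case using insert by simp
  qed
  then have one: "\<one>\<^bsub>A\<^esub> = finsum A (\<lambda>v. cls (vtx v)) (verts E)" by (simp add: one_A)
  have oneC: "\<one>\<^bsub>A\<^esub> \<in> carrier A" unfolding one by (intro A.finsum_closed) (auto simp: carrier_A vF)
  have "monoid A"
  proof (rule monoidI)
    show "\<one>\<^bsub>A\<^esub> \<otimes>\<^bsub>A\<^esub> x = x" "x \<otimes>\<^bsub>A\<^esub> \<one>\<^bsub>A\<^esub> = x" if "x \<in> carrier A" for x
      using L.vertex_sum_identity[OF component_span fin that] by (simp_all add: one)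
  qed (simp_all add: oneC A.m_assoc)
  then show ?thesis
    using A.abelian_group_axioms by (intro ringI) (simp_all add: A.l_distr A.r_distr)
qed

end


section \<open>The theorem\<close>

theorem mainTheorem2:
  fixes E :: "('v, 'e) pre_digraph"
    and A :: "('k :: field, (('v, 'e) lpa_gen free_word \<Rightarrow>\<^sub>0 'k) set) module"
    and G :: "int \<Rightarrow> (('v, 'e) lpa_gen free_word \<Rightarrow>\<^sub>0 'k) set set"
  assumes E: "wf_digraph E"
    and A: "A = leavitt_path_algebra E"
    and G: "G = lpa_component E"
  shows
   "\<comment> \<open>(a)\<close>
    (\<forall>I. right_ideal A I \<and> graded_subgroup A G I \<and> fg_right_ideal A I \<longrightarrow>
       (\<exists>e \<in> homogeneous G. e \<otimes>\<^bsub>A\<^esub> e = e \<and> I = right_ideal_gen A {e})) \<and>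
    (\<forall>I. left_ideal A I \<and> graded_subgroup A G I \<and> fg_left_ideal A I \<longrightarrow>
       (\<exists>e \<in> homogeneous G. e \<otimes>\<^bsub>A\<^esub> e = e \<and> I = left_ideal_gen A {e})) \<and>
    \<comment> \<open>(b)\<close>
    (\<forall>I. right_ideal A I \<and> graded_subgroup A G I \<longrightarrow> ideal_prod A I I = I) \<and>
    (\<forall>I. left_ideal A I \<and> graded_subgroup A G I \<longrightarrow> ideal_prod A I I = I) \<and>
    \<comment> \<open>(c)\<close>
    (\<forall>I. two_sided_ideal A I \<and> graded_subgroup A G I \<longrightarrow> semiprime_ideal A I) \<and>
    \<comment> \<open>(d)\<close>
    (\<forall>I. right_ideal A I \<and> graded_subgroup A G I \<and> fg_right_ideal A I \<longrightarrow>
       projective_right_module TYPE('n) TYPE('l) A (right_ideal_module A I)) \<and>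
    (\<forall>I. left_ideal A I \<and> graded_subgroup A G I \<and> fg_left_ideal A I \<longrightarrow>
       projective_left_module TYPE('n) TYPE('l) A (left_ideal_module A I)) \<and>
    \<comment> \<open>(e)\<close>
    jacobson_radical A = {\<zero>\<^bsub>A\<^esub>} \<and> graded_jacobson_radical A G = {\<zero>\<^bsub>A\<^esub>} \<and>
    \<comment> \<open>(f)\<close>
    (finite (verts E) \<longrightarrow> ring A \<and>
       (\<forall>(M :: (_, 'm) module) D.
          unital_right_module A M \<and> graded_right_module A G M D \<longrightarrow>
          flat_right_module TYPE('p) TYPE('q) A M) \<and>
       (\<forall>(M :: (_, 'm) module) D.
          unital_left_module A M \<and> graded_left_module A G M D \<longrightarrow>
          flat_left_module TYPE('p) TYPE('q) A M))"
proof -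
  interpret L: lpa E "TYPE('k)" by (rule lpa.intro[OF E])
  have reg: "graded_regular_ring A G" unfolding A G by (rule L.graded_regular_A)
  interpret R: graded_regular_ring A G by (rule reg)
  interpret O: graded_regular_ring "opposite_ring A" G by (rule opposite_graded_regular_ring[OF reg])
  have hom: "G 0 \<subseteq> homogeneous G" by (auto simp: homogeneous_def)
  have a_left: "\<exists>e\<in>G 0. e \<otimes>\<^bsub>A\<^esub> e = e \<and> e \<in> I \<and> I = left_ideal_gen A {e} \<and> (\<forall>x\<in>I. x \<otimes>\<^bsub>A\<^esub> e = x)"
    if "left_ideal A I \<and> graded_subgroup A G I \<and> fg_left_ideal A I" for I
    using that by (intro R.finitely_generated_graded_left_ideal) simp_all
  have a_right: "\<exists>e\<in>G 0. e \<otimes>\<^bsub>A\<^esub> e = e \<and> e \<in> I \<and> I = right_ideal_gen A {e} \<and> (\<forall>x\<in>I. e \<otimes>\<^bsub>A\<^esub> x = x)"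
    if "right_ideal A I \<and> graded_subgroup A G I \<and> fg_right_ideal A I" for I
    using O.finitely_generated_graded_left_ideal[of I] that by simp
  have d_left: "projective_left_module TYPE('n) TYPE('l) A (left_ideal_module A I)"
    if I: "left_ideal A I \<and> graded_subgroup A G I \<and> fg_left_ideal A I" for I
  proof -
    obtain e where "e \<in> I" "\<And>x. x \<in> I \<Longrightarrow> x \<otimes>\<^bsub>A\<^esub> e = x" using a_left[OF I] by blast
    then show ?thesis
      using I by (intro projective_left_ideal[OF R.nonunital_ring_axioms])
        (auto simp: left_ideal_module_def)
  qed
  have d_right: "projective_right_module TYPE('n) TYPE('l) A (right_ideal_module A I)"
    if I: "right_ideal A I \<and> graded_subgroup A G I \<and> fg_right_ideal A I" for I
  proof -
    obtain e where "e \<in> I" "\<And>x. x \<in> I \<Longrightarrow> e \<otimes>\<^bsub>A\<^esub> x = x" using a_right[OF I] by blast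
    then have "projective_left_module TYPE('n) TYPE('l) (opposite_ring A) (right_ideal_module A I)"
      using I by (intro projective_left_ideal[OF O.nonunital_ring_axioms])
        (auto simp: right_ideal_module_def fun_eq_iff)
    then show ?thesis by simp
  qed
  have b_right: "ideal_prod A I I = I" if "right_ideal A I \<and> graded_subgroup A G I" for I
    using O.graded_left_ideal_idempotent[of I] that by simp
  have f_right: "flat_right_module TYPE('p) TYPE('q) A M"
    if "unital_right_module A M \<and> graded_right_module A G M D" for M :: "(_, 'm) module" and D
  proof -
    interpret graded_unital_module A G M D
      using that reg
      by (intro graded_unital_module.intro graded_group.intro graded_group_axioms.intro
          graded_unital_module_axioms.intro)
        (auto simp: graded_right_module_def right_module_def)
    show ?thesis by (rule graded_right_module_flat)
  qed
  have f_left: "flat_left_module TYPE('p) TYPE('q) A M"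
    if "unital_left_module A M \<and> graded_left_module A G M D" for M :: "(_, 'm) module" and D
  proof (rule graded_left_module_flat)
    show "unital_left_module A M" using that by blast
    show "graded_unital_module (opposite_ring A) G M D"
      using that opposite_graded_regular_ring[OF reg]
      by (intro graded_unital_module.intro graded_group.intro graded_group_axioms.intro
          graded_unital_module_axioms.intro opposite_unital_right_module)
        (auto simp: graded_left_module_def left_module_def add.commute)
  qed
  show ?thesis
  proof (intro conjI allI impI)
    show "\<exists>e\<in>homogeneous G. e \<otimes>\<^bsub>A\<^esub> e = e \<and> I = right_ideal_gen A {e}"
      if "right_ideal A I \<and> graded_subgroup A G I \<and> fg_right_ideal A I" for I
      using a_right[OF that] hom by (elim bexE conjE) (intro bexI conjI, assumption+, rule subsetD)
    show "\<exists>e\<in>homogeneous G. e \<otimes>\<^bsub>A\<^esub> e = e \<and> I = left_ideal_gen A {e}"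
      if "left_ideal A I \<and> graded_subgroup A G I \<and> fg_left_ideal A I" for I
      using a_left[OF that] hom by (elim bexE conjE) (intro bexI conjI, assumption+, rule subsetD)
    show "ideal_prod A I I = I" if "right_ideal A I \<and> graded_subgroup A G I" for I
      by (rule b_right[OF that])
    show "ideal_prod A I I = I" if "left_ideal A I \<and> graded_subgroup A G I" for I
      using that by (intro R.graded_left_ideal_idempotent) simp_all
    show "semiprime_ideal A I" if "two_sided_ideal A I \<and> graded_subgroup A G I" for I
      using that by (intro R.graded_ideal_semiprime) simp_all
    show "ring A" if "finite (verts E)"
      unfolding A by (rule L.ring_A[OF that])
  qed (rule d_left d_right f_left f_right R.jacobson_radical_eq_zero R.graded_jacobson_radical_eq_zero,
      assumption?)+
qed

end
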